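(* Up to automorphism of $\mathbb{P}^2_{\mathbb{C}}$, there are six examples and two families of homogeneous pre-foliations of co-degree $1$ and degree $3$ on $\mathbb{P}^2_{\mathbb{C}}$ with a flat Legendre transform; that is, a homogeneous pre-foliation $\mathscr{H}$ of co-degree $1$ and degree $3$ has a flat dual $3$-web $\mathrm{Leg}\,\mathscr{H}$ if and only if it is conjugate, by an automorphism of $\mathbb{P}^2_{\mathbb{C}}$, to one of the following: 1. $\mathscr{H}_1^3=L_\infty\boxtimes\mathcal{H}_1^2$; 2. $\mathscr{H}_2^3=\{x=0\}\boxtimes\mathcal{H}_1^2$; 3. $\mathscr{H}_3^3=\{y-x=0\}\boxtimes\mathcal{H}_1^2$; 4. $\mathscr{H}_4^3=\{y+x=0\}\boxtimes\mathcal{H}_1^2$; 5. $\mathscr{H}_5^3=\{x=0\}\boxtimes\mathcal{H}_2^2(0,0)$; 6. $\mathscr{H}_6^3=\{y+x=0\}\boxtimes\mathcal{H}_3^2(-2)$; 7. $\mathscr{H}_7^3(\lambda)=L_\infty\boxtimes\mathcal{H}_3^2(\lambda)$, where $\lambda\in\mathbb{C}^*$; 8. $\mathscr{H}_8^3(\lambda,\mu)=L_\infty\boxtimes\mathcal{H}_2^2(\lambda,\mu)$, where $\lambda,\mu\in\mathbb{C}$ with $\lambda\mu\neq-1$.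
   Context: Homogeneous pre-foliations. A pre-foliation of co-degree $1$ and degree $3$ on $\mathbb{P}^2_{\mathbb{C}}$ is a pair, written $\ell\boxtimes\mathcal H$, of a line $\ell$ and a holomorphic foliation $\mathcal H$ of degree $2$. It is homogeneous if in some affine chart $(x,y)$ it is invariant under all homotheties $(x,y)\mapsto\lambda(x,y)$, $\lambda\in\mathbb{C}^*$; then $\ell$ passes through the origin or is the line at infinity $L_\infty$, and $\mathcal H$ is defined by $A\,dx+B\,dy$ with $A,B\in\mathbb{C}[x,y]_{2}$, $\gcd(A,B)=1$. Model foliations of degree $2$ (in the affine chart $(x,y)$): $\mathcal H_1^{2}$ is defined by $y^{2}dx-x^{2}dy$; $\mathcal H_2^{2}(\lambda,\mu)$ ($\lambda\mu\ne-1$) by $(x^{2}+\lambda y^{2})dx+(\mu x^{2}-y^{2})dy$; $\mathcal H_3^{2}(\lambda)$ ($\lambda\neq0$) by $(x^{2}+\lambda y^{2})dx+x^{2}dy$. Legendre transform. In the affine chart $(p,q)$ of $\check{\mathbb{P}}^2_{\mathbb{C}}$ associated to the line $\{y=px-q\}$, $\mathrm{Leg}\,\mathcal H$ is the $2$-web $A(x,px-q)+pB(x,px-q)=0$ with $x=dq/dp$; $\mathrm{Leg}\,\ell$ is the foliation by lines through the point dual to $\ell$ (given by $f(x,px-q)=0$, $x=dq/dp$, if $\ell=(f(x,y)=0)$; by $dp=0$ if $\ell=L_\infty$); $\mathrm{Leg}(\ell\boxtimes\mathcal H)=\mathrm{Leg}\,\ell\boxtimes\mathrm{Leg}\,\mathcal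 H$ is their superposition. Curvature. At a generic point a $3$-web is a superposition $\mathcal F_1\boxtimes\mathcal F_2\boxtimes\mathcal F_3$ of pairwise transverse foliations, $\mathcal F_i:\omega_i=0$. Put $\omega_i\wedge\omega_j=\delta_{ij}\,dx\wedge dy$ and let $\eta$ be the unique meromorphic 1-form with $d(\delta_{23}\omega_1)=\eta\wedge\delta_{23}\omega_1$, $d(\delta_{31}\omega_2)=\eta\wedge\delta_{31}\omega_2$, $d(\delta_{12}\omega_3)=\eta\wedge\delta_{12}\omega_3$. The curvature $K(\mathcal W)=d\eta$ is a well-defined global meromorphic 2-form; $\mathcal W$ is flat if $K(\mathcal W)\equiv0$. *)

theory Defs
  imports "HOL-Analysis.Analysis"
begin

section \<open>Lines, foliations and pre-foliations on the complex projective plane\<close>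

text \<open>
  Objects on the projective plane are represented in homogeneous coordinates \<open>[X : Y : Z]\<close>, i.e. on
  \<^typ>\<open>complex ^ 3\<close>. The affine chart \<open>(x, y)\<close> is \<open>[x : y : 1]\<close> and the line at infinity is \<open>Z = 0\<close>.
\<close>

definition homogeneous_poly :: "nat \<Rightarrow> (complex ^ 3 \<Rightarrow> complex) \<Rightarrow> bool" where
  "homogeneous_poly n f \<longleftrightarrow>
     (\<exists>c :: nat \<Rightarrow> nat \<Rightarrow> complex. \<forall>X. f X =
        (\<Sum>i\<le>n. \<Sum>j\<le>n - i. c i j * (X $ 1) ^ i * (X $ 2) ^ j * (X $ 3) ^ (n - i - j)))"

text \<open>
  A holomorphic foliation of degree \<open>d\<close> is given by a 1-form \<open>a dX + b dY + c dZ\<close> whose coefficients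
  (the components of \<open>\<Omega>\<close>) are homogeneous polynomials of degree \<open>d + 1\<close> without common factor and
  satisfy Euler's condition \<open>a X + b Y + c Z = 0\<close>. A common factor of homogeneous polynomials is
  itself homogeneous, so only homogeneous ones have to be excluded. The form is determined by the
  foliation up to a nonzero constant, see \<open>same_prefoliation\<close> below.
\<close>

definition foliation_form :: "nat \<Rightarrow> (complex ^ 3 \<Rightarrow> complex ^ 3) \<Rightarrow> bool" where
  "foliation_form d \<Omega> \<longleftrightarrow>
     (\<forall>i. homogeneous_poly (d + 1) (\<lambda>X. \<Omega> X $ i)) \<and>
     (\<forall>X. (\<Sum>i\<in>UNIV. \<Omega> X $ i * X $ i) = 0) \<and>
     \<not> (\<exists>e h \<Theta>. 1 \<le> e \<and> e \<le> d + 1 \<and> homogeneous_poly e h \<and>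
          (\<forall>i. homogeneous_poly (d + 1 - e) (\<lambda>X. \<Theta> X $ i)) \<and>
          (\<forall>X. \<Omega> X = h X *s \<Theta> X))"

text \<open>
  A pair of a line \<open>l\<^sub>1 X + l\<^sub>2 Y + l\<^sub>3 Z = 0\<close>, given by its coefficient vector, and a foliation.
\<close>

type_synonym prefoliation = "(complex ^ 3) \<times> (complex ^ 3 \<Rightarrow> complex ^ 3)"

text \<open>Pre-foliations of co-degree 1 and degree \<open>d\<close>.\<close>

definition is_prefoliation :: "nat \<Rightarrow> prefoliation \<Rightarrow> bool" where
  "is_prefoliation d P \<longleftrightarrow> 1 \<le> d \<and> fst P \<noteq> 0 \<and> foliation_form (d - 1) (snd P)"

definition same_prefoliation :: "prefoliation \<Rightarrow> prefoliation \<Rightarrow> bool" where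
  "same_prefoliation P Q \<longleftrightarrow>
     (\<exists>a b. a \<noteq> 0 \<and> b \<noteq> 0 \<and> fst Q = a *s fst P \<and> (\<forall>X. snd Q X = b *s snd P X))"

text \<open>
  Automorphisms of the projective plane are induced by invertible matrices; a line and a 1-form are
  pulled back along \<open>X \<mapsto> g X\<close>.
\<close>

definition pullback :: "complex ^ 3 ^ 3 \<Rightarrow> prefoliation \<Rightarrow> prefoliation" where
  "pullback g P = (transpose g *v fst P, \<lambda>X. transpose g *v snd P (g *v X))"

definition conjugate :: "prefoliation \<Rightarrow> prefoliation \<Rightarrow> bool" where
  "conjugate P Q \<longleftrightarrow> (\<exists>g. invertible g \<and> same_prefoliation (pullback g P) Q)"

text \<open>The homothety \<open>(x, y) \<mapsto> (s x, s y)\<close> of the affine chart.\<close>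

definition homothety :: "complex \<Rightarrow> complex ^ 3 ^ 3" where
  "homothety s = vector [vector [s, 0, 0], vector [0, s, 0], vector [0, 0, 1]]"

text \<open>Here \<open>g\<close> is the change of coordinates to the affine chart in which \<open>P\<close> is invariant.\<close>

definition homogeneous_prefoliation :: "prefoliation \<Rightarrow> bool" where
  "homogeneous_prefoliation P \<longleftrightarrow>
     (\<exists>g. invertible g \<and>
        (\<forall>s. s \<noteq> 0 \<longrightarrow> same_prefoliation (pullback (homothety s) (pullback g P)) (pullback g P)))"


section \<open>The models\<close>

text \<open>
  For \<open>A\<close>, \<open>B\<close> homogeneous of degree \<open>d\<close>, pulling \<open>A dx + B dy\<close> back along \<open>x = X / Z\<close>, \<open>y = Y / Z\<close>
  and multiplying by \<open>Z ^ (d + 2)\<close> gives \<open>Z (A dX + B dY) - (X A + Y B) dZ\<close>.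
\<close>

definition affine_form ::
  "(complex \<Rightarrow> complex \<Rightarrow> complex) \<Rightarrow> (complex \<Rightarrow> complex \<Rightarrow> complex) \<Rightarrow> complex ^ 3 \<Rightarrow> complex ^ 3" where
  "affine_form A B X =
     vector [X $ 3 * A (X $ 1) (X $ 2),
             X $ 3 * B (X $ 1) (X $ 2),
             - (X $ 1 * A (X $ 1) (X $ 2) + X $ 2 * B (X $ 1) (X $ 2))]"

definition H1 :: "complex ^ 3 \<Rightarrow> complex ^ 3" where
  "H1 = affine_form (\<lambda>x y. y\<^sup>2) (\<lambda>x y. - x\<^sup>2)"

definition H2 :: "complex \<Rightarrow> complex \<Rightarrow> complex ^ 3 \<Rightarrow> complex ^ 3" where
  "H2 lam mu = affine_form (\<lambda>x y. x\<^sup>2 + lam * y\<^sup>2) (\<lambda>x y. mu * x\<^sup>2 - y\<^sup>2)"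

definition H3 :: "complex \<Rightarrow> complex ^ 3 \<Rightarrow> complex ^ 3" where
  "H3 lam = affine_form (\<lambda>x y. x\<^sup>2 + lam * y\<^sup>2) (\<lambda>x y. x\<^sup>2)"

text \<open>The line \<open>a x + b y + c = 0\<close> of the affine chart.\<close>

definition line :: "complex \<Rightarrow> complex \<Rightarrow> complex \<Rightarrow> complex ^ 3" where
  "line a b c = vector [a, b, c]"

definition L_inf :: "complex ^ 3" where
  "L_inf = line 0 0 1"


section \<open>Plane webs and the Legendre transform\<close>

text \<open>
  A \<open>k\<close>-web on the plane with coordinates \<open>(p, q)\<close> is given by an implicit differential equation
  \<open>W (p, q) x = 0\<close>, \<open>x = dq/dp\<close>, where \<open>W (p, q)\<close> is a polynomial in \<open>x\<close> of formal degree \<open>k\<close>: if its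
  actual degree is smaller, the missing roots are at infinity, i.e. they are the direction \<open>dp = 0\<close>.
\<close>

type_synonym web = "complex \<times> complex \<Rightarrow> complex \<Rightarrow> complex"

definition superposition :: "web \<Rightarrow> web \<Rightarrow> web" where
  "superposition V W = (\<lambda>z x. V z x * W z x)"

text \<open>
  The Legendre transform in the chart \<open>(p, q)\<close> of the dual plane associated to the line \<open>y = p x - q\<close>.
  A line \<open>f (x, y) = 0\<close> becomes the 1-web \<open>f (x, p x - q) = 0\<close> of formal degree 1; for the line at
  infinity \<open>f\<close> is a constant, which encodes \<open>dp = 0\<close>. A foliation \<open>A dx + B dy\<close> of degree \<open>d\<close> becomes
  the \<open>d\<close>-web \<open>A (x, p x - q) + p B (x, p x - q) = 0\<close>. For a foliation which is not homogeneous,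
  \<open>A\<close> and \<open>B\<close> may have degree \<open>d + 1\<close>, but the terms of degree \<open>d + 1\<close> in \<open>x\<close> cancel by Euler's
  condition.
\<close>

definition Leg_line :: "complex ^ 3 \<Rightarrow> web" where
  "Leg_line l = (\<lambda>(p, q) x. l $ 1 * x + l $ 2 * (p * x - q) + l $ 3)"

definition Leg_foliation :: "(complex ^ 3 \<Rightarrow> complex ^ 3) \<Rightarrow> web" where
  "Leg_foliation \<Omega> = (\<lambda>(p, q) x.
     let X = vector [x, p * x - q, 1] in \<Omega> X $ 1 + p * \<Omega> X $ 2)"

definition Leg :: "prefoliation \<Rightarrow> web" where
  "Leg P = superposition (Leg_line (fst P)) (Leg_foliation (snd P))"


section \<open>Curvature of 3-webs\<close>

text \<open>Complex differentiability in two variables.\<close>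

definition holomorphic2_on :: "(complex \<times> complex \<Rightarrow> complex) \<Rightarrow> (complex \<times> complex) set \<Rightarrow> bool" where
  "holomorphic2_on f U \<longleftrightarrow>
     (\<forall>z\<in>U. \<exists>a b. (f has_derivative (\<lambda>(h, k). a * h + b * k)) (at z))"

text \<open>The pair \<open>\<omega> z = (a, b)\<close> stands for the 1-form \<open>a dp + b dq\<close> at \<open>z\<close>.\<close>

type_synonym one_form = "complex \<times> complex \<Rightarrow> complex \<times> complex"

definition holomorphic_form_on :: "one_form \<Rightarrow> (complex \<times> complex) set \<Rightarrow> bool" where
  "holomorphic_form_on \<omega> U \<longleftrightarrow>
     holomorphic2_on (\<lambda>z. fst (\<omega> z)) U \<and> holomorphic2_on (\<lambda>z. snd (\<omega> z)) U"

text \<open>2-forms are identified with their coefficient with respect to \<open>dp \<and> dq\<close>.\<close>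

definition wedge :: "one_form \<Rightarrow> one_form \<Rightarrow> complex \<times> complex \<Rightarrow> complex" where
  "wedge \<alpha> \<beta> z = fst (\<alpha> z) * snd (\<beta> z) - snd (\<alpha> z) * fst (\<beta> z)"

definition ext_deriv :: "one_form \<Rightarrow> complex \<times> complex \<Rightarrow> complex" where
  "ext_deriv \<omega> = (\<lambda>(p, q).
     deriv (\<lambda>t. snd (\<omega> (t, q))) p - deriv (\<lambda>t. fst (\<omega> (p, t))) q)"

definition scale_form :: "(complex \<times> complex \<Rightarrow> complex) \<Rightarrow> one_form \<Rightarrow> one_form" where
  "scale_form f \<omega> z = (f z * fst (\<omega> z), f z * snd (\<omega> z))"

text \<open>
  On \<open>U\<close> the 3-web \<open>W\<close> is the superposition of the pairwise transverse foliations \<open>\<omega>\<^sub>i = 0\<close>. The binary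
  form \<open>\<omega>\<^sub>1 \<omega>\<^sub>2 \<omega>\<^sub>3\<close> in \<open>(dp, dq)\<close> is compared with \<open>W\<close> at \<open>(1, x)\<close>. Transversality forces
  the \<open>\<omega>\<^sub>i\<close> to have no zeros on \<open>U\<close>.
\<close>

definition web_decomposition ::
  "web \<Rightarrow> (complex \<times> complex) set \<Rightarrow> one_form \<Rightarrow> one_form \<Rightarrow> one_form \<Rightarrow> bool" where
  "web_decomposition W U \<omega>1 \<omega>2 \<omega>3 \<longleftrightarrow>
     holomorphic_form_on \<omega>1 U \<and> holomorphic_form_on \<omega>2 U \<and> holomorphic_form_on \<omega>3 U \<and>
     (\<forall>z\<in>U. wedge \<omega>1 \<omega>2 z \<noteq> 0 \<and> wedge \<omega>2 \<omega>3 z \<noteq> 0 \<and> wedge \<omega>3 \<omega>1 z \<noteq> 0) \<and>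
     (\<forall>z\<in>U. \<exists>c. c \<noteq> 0 \<and>
        (\<forall>x. W z x = c * (fst (\<omega>1 z) + snd (\<omega>1 z) * x) *
                         (fst (\<omega>2 z) + snd (\<omega>2 z) * x) *
                         (fst (\<omega>3 z) + snd (\<omega>3 z) * x)))"

text \<open>
  \<open>\<eta>\<close> is unique where the foliations are pairwise transverse, and holomorphic there.
\<close>

definition web_connection ::
  "(complex \<times> complex) set \<Rightarrow> one_form \<Rightarrow> one_form \<Rightarrow> one_form \<Rightarrow> one_form \<Rightarrow> bool" where
  "web_connection U \<omega>1 \<omega>2 \<omega>3 \<eta> \<longleftrightarrow>
     holomorphic_form_on \<eta> U \<and>
     (let \<alpha>1 = scale_form (wedge \<omega>2 \<omega>3) \<omega>1;
          \<alpha>2 = scale_form (wedge \<omega>3 \<omega>1) \<omega>2;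
          \<alpha>3 = scale_form (wedge \<omega>1 \<omega>2) \<omega>3
      in \<forall>z\<in>U. ext_deriv \<alpha>1 z = wedge \<eta> \<alpha>1 z \<and>
               ext_deriv \<alpha>2 z = wedge \<eta> \<alpha>2 z \<and>
               ext_deriv \<alpha>3 z = wedge \<eta> \<alpha>3 z)"

text \<open>
  The curvature is the 2-form \<open>d\<eta>\<close>. It is a global meromorphic 2-form, holomorphic near every point at
  which the web is a superposition of pairwise transverse foliations. For a 3-web such points are
  dense, so the curvature vanishes identically if and only if it vanishes at those of them that belong
  to the chart \<open>(p, q)\<close>. The predicate is meant for \<open>W\<close> of formal degree 3 and generically transverse,
  as is \<open>Leg P\<close> for every pre-foliation \<open>P\<close> of co-degree 1 and degree 3; it holds vacuously if no point
  is regular.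
\<close>

definition flat_web :: "web \<Rightarrow> bool" where
  "flat_web W \<longleftrightarrow>
     (\<forall>U \<omega>1 \<omega>2 \<omega>3 \<eta>. open U \<and> web_decomposition W U \<omega>1 \<omega>2 \<omega>3 \<and>
        web_connection U \<omega>1 \<omega>2 \<omega>3 \<eta> \<longrightarrow> (\<forall>z\<in>U. ext_deriv \<eta> z = 0))"

end

theory Submission
  imports Defs "HOL-Complex_Analysis.Conformal_Mappings"
begin

text \<open>
  In the chart in which the foliation is homogeneous, it is given by \<open>A dx + B dy\<close> with coprime quadratic forms. The
  pencil spanned by \<open>A\<close> and \<open>B\<close> contains two squares, so \<open>A = a x\<^sup>2 + b y\<^sup>2\<close> and \<open>B = c x\<^sup>2 + d y\<^sup>2\<close> after a
  linear change of coordinates. Put \<open>E = a + c p\<close> and \<open>N = b + d p\<close>. The dual 2-web is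
  \<open>E x\<^sup>2 + N (p x - q)\<^sup>2 = 0\<close>, and together with the dual of the line it is invariant under \<open>q \<mapsto> s q\<close>, which
  makes the connection \<open>\<eta>\<close> explicit. It is closed if the line is at infinity. For the line
  \<open>\<alpha> x + \<beta> y = 0\<close> it is closed if and only if
  \<open>(\<alpha> + \<beta> p) (\<alpha> p N + \<beta> E) / (E N (\<beta>\<^sup>2 E + \<alpha>\<^sup>2 N))\<close> is constant, and comparing coefficients leaves the
  models, up to rescaling and exchanging \<open>x\<close> and \<open>y\<close>.

  Flatness does not depend on the decomposition because another choice changes \<open>\<eta>\<close> by a logarithmic
  differential. A projective change of coordinates adds the logarithmic differential of its
  Jacobian to the pullback of \<open>\<eta>\<close>; points that leave the chart \<open>(p, q)\<close> are reached by continuity.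
\<close>

section \<open>Partial derivatives in two complex variables\<close>

text \<open>The quotient arises as follows. In \<open>\<eta> = u(p) dp + v(p) dq / q\<close> only
  \<open>v\<close> matters, since \<open>d\<eta> = (v'(p) / q) dp dq\<close>. For the line at
  infinity \<open>v = 1\<close>. For a line through the origin
  \<open>v = 3 - (\<alpha> + \<beta> p) \<sigma>\<close>, where \<sigma> contains the difference
  \<open>E' / (2 E) - N' / (2 N)\<close> of logarithmic derivatives, whose numerator collapses to
  the constant \<open>(b c - a d) / 2\<close>. Coprimality of \<open>A\<close> and \<open>B\<close>,
  that is \<open>a d - b c \<noteq> 0\<close>, therefore makes \<open>v' = 0\<close> equivalent to
  constancy of the quotient, which clearing denominators turns into an identity of cubics in
  \<open>p\<close>.

  The obstacle is that \<open>flat_web\<close> ranges over all decompositions on all open sets, by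
  forms of which only complex differentiability at each point is known, while the explicit forms
  need square roots of \<open>E\<close> and \<open>N\<close> and hence live over small discs. Each
  comparison, of two decompositions or of two charts, must produce \<open>dF / F\<close> with
  \<open>F\<close> nowhere zero, and that this is closed rests on the symmetry of mixed partial
  derivatives, obtained here from mere differentiability.\<close>

definition has_partials ::
  "(complex \<times> complex \<Rightarrow> complex) \<Rightarrow> complex \<Rightarrow> complex \<Rightarrow> complex \<times> complex \<Rightarrow> bool" where
  "has_partials f a b z \<longleftrightarrow> (f has_derivative (\<lambda>(h, k). a * h + b * k)) (at z)"

lemma holomorphic2_on_iff: "holomorphic2_on f U \<longleftrightarrow> (\<forall>z\<in>U. \<exists>a b. has_partials f a b z)"
  by (simp add: holomorphic2_on_def has_partials_def)

lemma holomorphic2_on_subset: "holomorphic2_on f U \<Longrightarrow> V \<subseteq> U \<Longrightarrow> holomorphic2_on f V"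
  by (auto simp: holomorphic2_on_def)

lemma has_partials_eq:
  "has_partials f a b z \<Longrightarrow> a = a' \<Longrightarrow> b = b' \<Longrightarrow> has_partials f a' b' z"
  by simp

lemma has_partials_const: "has_partials (\<lambda>_. c) 0 0 z"
  by (simp add: has_partials_def case_prod_unfold)

lemma has_partials_fst: "has_partials (\<lambda>z. fst z) 1 0 z"
  unfolding has_partials_def by (auto intro!: derivative_eq_intros simp: case_prod_unfold)

lemma has_partials_snd: "has_partials (\<lambda>z. snd z) 0 1 z"
  unfolding has_partials_def by (auto intro!: derivative_eq_intros simp: case_prod_unfold)

lemma has_partials_add:
  "has_partials f a b z \<Longrightarrow> has_partials g a' b' z \<Longrightarrow>
    has_partials (\<lambda>z. f z + g z) (a + a') (b + b') z"
  unfolding has_partials_def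
  by (rule has_derivative_eq_rhs, (rule derivative_intros; assumption))
     (auto simp: fun_eq_iff algebra_simps)

lemma has_partials_minus:
  "has_partials f a b z \<Longrightarrow> has_partials (\<lambda>z. - f z) (- a) (- b) z"
  unfolding has_partials_def
  by (rule has_derivative_eq_rhs, (rule derivative_intros; assumption))
     (auto simp: fun_eq_iff algebra_simps)

lemma has_partials_diff:
  "has_partials f a b z \<Longrightarrow> has_partials g a' b' z \<Longrightarrow>
    has_partials (\<lambda>z. f z - g z) (a - a') (b - b') z"
  unfolding has_partials_def
  by (rule has_derivative_eq_rhs, (rule derivative_intros; assumption))
     (auto simp: fun_eq_iff algebra_simps)

lemma has_partials_mult:
  "has_partials f a b z \<Longrightarrow> has_partials g a' b' z \<Longrightarrow>
    has_partials (\<lambda>z. f z * g z) (a * g z + f z * a') (b * g z + f z * b') z"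
  unfolding has_partials_def
  by (rule has_derivative_eq_rhs, (rule derivative_intros; assumption))
     (auto simp: fun_eq_iff algebra_simps)

lemma has_partials_compose:
  assumes "has_partials f a b z" and "(h has_field_derivative h') (at (f z))"
  shows "has_partials (\<lambda>z. h (f z)) (h' * a) (h' * b) z"
proof -
  have "(h has_derivative (*) h') (at (f z))"
    using assms(2) by (simp add: has_field_derivative_def)
  from has_derivative_compose[OF assms(1)[unfolded has_partials_def] this]
  show ?thesis unfolding has_partials_def
    by (rule has_derivative_eq_rhs) (auto simp: fun_eq_iff algebra_simps)
qed

lemma has_partials_inverse:
  assumes "has_partials f a b z" and "f z \<noteq> 0"
  shows "has_partials (\<lambda>z. inverse (f z)) (- a / (f z)\<^sup>2) (- b / (f z)\<^sup>2) z"
proof -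
  have "(inverse has_field_derivative - (inverse (f z) ^ Suc (Suc 0))) (at (f z))"
    using DERIV_inverse[OF assms(2)] by simp
  from has_partials_compose[OF assms(1) this] show ?thesis
    by (rule has_partials_eq) (use assms(2) in \<open>simp_all add: power2_eq_square divide_simps\<close>)
qed

lemma has_partials_divide:
  assumes "has_partials f a b z" and "has_partials g a' b' z" and "g z \<noteq> 0"
  shows "has_partials (\<lambda>z. f z / g z) ((a * g z - f z * a') / (g z)\<^sup>2) ((b * g z - f z * b') / (g z)\<^sup>2) z"
  unfolding divide_inverse[of "f _"]
  by (rule has_partials_eq, rule has_partials_mult, rule assms, rule has_partials_inverse, rule assms, rule assms)
     (use assms(3) in \<open>simp_all add: power2_eq_square divide_simps\<close>)

lemma has_partials_compose2:
  assumes "has_partials f a b (\<phi> z, \<psi> z)" and "has_partials \<phi> c d z" and "has_partials \<psi> c' d' z"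
  shows "has_partials (\<lambda>z. f (\<phi> z, \<psi> z)) (a * c + b * c') (a * d + b * d') z"
proof -
  have "((\<lambda>z. (\<phi> z, \<psi> z)) has_derivative
      (\<lambda>h. ((\<lambda>(h, k). c * h + d * k) h, (\<lambda>(h, k). c' * h + d' * k) h))) (at z)"
    using assms(2,3) unfolding has_partials_def by (rule has_derivative_Pair)
  from has_derivative_compose[OF this] assms(1)
  have "((\<lambda>z. f (\<phi> z, \<psi> z)) has_derivative
     (\<lambda>h. (\<lambda>(h, k). a * h + b * k) ((\<lambda>(h, k). c * h + d * k) h, (\<lambda>(h, k). c' * h + d' * k) h))) (at z)"
    unfolding has_partials_def by blast
  then show ?thesis unfolding has_partials_def
    by (rule has_derivative_eq_rhs) (auto simp: fun_eq_iff algebra_simps)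
qed

lemma has_partials_transform:
  assumes "has_partials f a b z" and "open U" and "z \<in> U" and "\<And>w. w \<in> U \<Longrightarrow> f w = g w"
  shows "has_partials g a b z"
  using assms unfolding has_partials_def by (blast intro: has_derivative_transform_within_open)

lemma has_partials_isCont: "has_partials f a b z \<Longrightarrow> isCont f z"
  unfolding has_partials_def by (rule has_derivative_continuous)

lemma holomorphic2_on_continuous: "holomorphic2_on f U \<Longrightarrow> z \<in> U \<Longrightarrow> isCont f z"
  unfolding holomorphic2_on_iff by (blast intro: has_partials_isCont)

lemma has_partials_DERIV_fst:
  assumes "has_partials f a b (p, q)"
  shows "((\<lambda>t. f (t, q)) has_field_derivative a) (at p)"
proof -
  have "((\<lambda>t. (t, q)) has_derivative (\<lambda>h. (h, 0))) (at p)"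
    by (auto intro!: derivative_eq_intros)
  from has_derivative_compose[OF this assms[unfolded has_partials_def]]
  show ?thesis unfolding has_field_derivative_def by simp
qed

lemma has_partials_DERIV_snd:
  assumes "has_partials f a b (p, q)"
  shows "((\<lambda>t. f (p, t)) has_field_derivative b) (at q)"
proof -
  have "((\<lambda>t. (p, t)) has_derivative (\<lambda>h. (0, h))) (at q)"
    by (auto intro!: derivative_eq_intros)
  from has_derivative_compose[OF this assms[unfolded has_partials_def]]
  show ?thesis unfolding has_field_derivative_def by simp
qed

lemma ext_deriv_eq:
  assumes "has_partials (\<lambda>z. fst (\<omega> z)) a b z" and "has_partials (\<lambda>z. snd (\<omega> z)) c d z"
  shows "ext_deriv \<omega> z = c - b"
proof -
  obtain p q where z: "z = (p, q)" by (cases z)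
  show ?thesis
    using has_partials_DERIV_fst[OF assms(2)[unfolded z]] has_partials_DERIV_snd[OF assms(1)[unfolded z]]
    by (auto simp: ext_deriv_def z dest!: DERIV_imp_deriv)
qed

lemma holomorphic_form_onD:
  assumes "holomorphic_form_on \<omega> U" and "z \<in> U"
  obtains a b c d where "has_partials (\<lambda>z. fst (\<omega> z)) a b z" "has_partials (\<lambda>z. snd (\<omega> z)) c d z"
    "ext_deriv \<omega> z = c - b"
proof -
  obtain a b c d where "has_partials (\<lambda>z. fst (\<omega> z)) a b z" "has_partials (\<lambda>z. snd (\<omega> z)) c d z"
    using assms unfolding holomorphic_form_on_def holomorphic2_on_iff by blast
  with that ext_deriv_eq show thesis by blast
qed

lemma open_prod_ball:
  assumes "open U" and "(p, q) \<in> U"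
  obtains \<epsilon> where "\<epsilon> > 0" "cball p \<epsilon> \<times> cball q \<epsilon> \<subseteq> U"
proof -
  obtain A B where AB: "open A" "open B" "p \<in> A" "q \<in> B" "A \<times> B \<subseteq> U"
    using open_prod_elim[OF assms] by (metis mem_Times_iff fst_conv snd_conv)
  obtain e1 e2 where e: "e1 > 0" "cball p e1 \<subseteq> A" "e2 > 0" "cball q e2 \<subseteq> B"
    using AB by (meson open_contains_cball)
  have "cball p (min e1 e2) \<times> cball q (min e1 e2) \<subseteq> U" using AB(5) e by fastforce
  with e that[of "min e1 e2"] show ?thesis by auto
qed

lemma uniform_limit_slices:
  fixes f :: "complex \<times> complex \<Rightarrow> complex"
  assumes "continuous_on (cball p \<epsilon> \<times> cball q \<epsilon>) f" and "\<epsilon> > 0"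
  shows "uniform_limit (cball p \<epsilon>) (\<lambda>h t. f (t, q + h)) (\<lambda>t. f (t, q)) (at 0)"
proof -
  have "uniformly_continuous_on (cball p \<epsilon> \<times> cball q \<epsilon>) f"
    using assms by (intro compact_uniformly_continuous compact_Times compact_cball)
  then have uc: "\<exists>d>0. \<forall>x\<in>cball p \<epsilon> \<times> cball q \<epsilon>. \<forall>x'\<in>cball p \<epsilon> \<times> cball q \<epsilon>.
      dist x' x < d \<longrightarrow> dist (f x') (f x) < e" if "e > 0" for e
    using that unfolding uniformly_continuous_on_def by blast
  show ?thesis unfolding uniform_limit_iff
  proof (intro allI impI)
    fix e :: real assume "e > 0"
    from uc[OF this] obtain d where d: "d > 0" "\<And>x x'. x \<in> cball p \<epsilon> \<times> cball q \<epsilon> \<Longrightarrow>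
      x' \<in> cball p \<epsilon> \<times> cball q \<epsilon> \<Longrightarrow> dist x' x < d \<Longrightarrow> dist (f x') (f x) < e" by blast
    show "\<forall>\<^sub>F h in at 0. \<forall>t\<in>cball p \<epsilon>. dist (f (t, q + h)) (f (t, q)) < e"
      unfolding eventually_at
      by (rule exI[of _ "min d \<epsilon>"]) (use d assms(2) in \<open>auto intro!: d(2) simp: dist_Pair_Pair dist_norm\<close>)
  qed
qed

text \<open>
  The difference quotients of \<open>f\<close> in the second variable converge to its partial derivative locally
  uniformly in the first one, so that they may be differentiated termwise.
\<close>

lemma mixed_partials:
  assumes "open U" and z: "(p, q) \<in> U"
    and f: "\<And>w. w \<in> U \<Longrightarrow> has_partials f (g w) (k w) w"
    and g: "has_partials g a b (p, q)" and k: "\<And>w. w \<in> U \<Longrightarrow> \<exists>c d. has_partials k c d w"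
    and k': "has_partials k c d (p, q)"
  shows "b = c"
proof -
  obtain \<epsilon> where eps: "\<epsilon> > 0" and sub: "cball p \<epsilon> \<times> cball q \<epsilon> \<subseteq> U"
    using open_prod_ball[OF assms(1) z] by blast
  have subD: "(t, s) \<in> U" if "t \<in> cball p \<epsilon>" "s \<in> cball q \<epsilon>" for t s using sub that by blast
  have contk: "continuous_on (cball p \<epsilon> \<times> cball q \<epsilon>) k"
    using sub by (intro continuous_at_imp_continuous_on ballI) (metis k has_partials_isCont subsetD)
  define Q where "Q = (\<lambda>h t. (f (t, q + h) - f (t, q)) / h)"
  have lim: "uniform_limit (ball p \<epsilon>) Q (\<lambda>t. k (t, q)) (at 0)"
    unfolding uniform_limit_iff
  proof (intro allI impI)
    fix e :: real assume "e > 0"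
    then have "\<forall>\<^sub>F h in at 0. \<forall>t\<in>cball p \<epsilon>. dist (k (t, q + h)) (k (t, q)) < e / 2"
      using uniform_limit_slices[OF contk eps] unfolding uniform_limit_iff by (meson half_gt_zero)
    then obtain d where d: "d > 0" "\<And>h t. h \<noteq> 0 \<Longrightarrow> norm h < d \<Longrightarrow> t \<in> cball p \<epsilon> \<Longrightarrow>
       dist (k (t, q + h)) (k (t, q)) < e / 2"
      unfolding eventually_at by (auto simp: dist_norm)
    have "dist (Q h t) (k (t, q)) < e" if h: "h \<noteq> 0" "norm h < min d \<epsilon>" and t: "t \<in> ball p \<epsilon>" for h t
    proof -
      \<comment> \<open>Subtracting the linear function of slope \<open>k (t, q)\<close> turns the
        error of the difference quotient into an increment of \<open>G\<close> divided by
        \<open>h\<close>; the mean value inequality bounds it by the oscillation of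
        \<open>k\<close>.\<close>
      define G where "G = (\<lambda>s. f (t, s) - k (t, q) * s)"
      have "norm (G (q + h) - G q) \<le> (e / 2) * norm (q + h - q)"
      proof (rule field_differentiable_bound)
        show "convex (ball q (min d \<epsilon>))" by simp
        show "(G has_field_derivative k (t, s) - k (t, q)) (at s within ball q (min d \<epsilon>))"
          if "s \<in> ball q (min d \<epsilon>)" for s
        proof -
          have "((\<lambda>s. f (t, s)) has_field_derivative k (t, s)) (at s)"
            by (rule has_partials_DERIV_snd, rule f, rule subD) (use t that in auto)
          then have "(G has_field_derivative k (t, s) - k (t, q)) (at s)"
            unfolding G_def by (auto intro!: derivative_eq_intros)
          then show ?thesis by (rule has_field_derivative_at_within)
        qed
        show "norm (k (t, s) - k (t, q)) \<le> e / 2" if "s \<in> ball q (min d \<epsilon>)" for s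
        proof (cases "s = q")
          case True then show ?thesis using \<open>e > 0\<close> by simp
        next
          case False
          have "dist (k (t, q + (s - q))) (k (t, q)) < e / 2"
            using False that t by (intro d(2)) (auto simp: dist_norm norm_minus_commute)
          then show ?thesis by (simp add: dist_norm)
        qed
        show "q + h \<in> ball q (min d \<epsilon>)" "q \<in> ball q (min d \<epsilon>)" using h d(1) eps by (auto simp: dist_norm)
      qed
      moreover have "Q h t - k (t, q) = (G (q + h) - G q) / h"
        using h by (simp add: Q_def G_def field_simps)
      ultimately have "norm (Q h t - k (t, q)) \<le> e / 2"
        using h by (simp add: norm_divide pos_divide_le_eq)
      then show ?thesis using \<open>e > 0\<close> by (simp add: dist_norm)
    qed
    then show "\<forall>\<^sub>F h in at 0. \<forall>t\<in>ball p \<epsilon>. dist (Q h t) (k (t, q)) < e"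
      unfolding eventually_at using d(1) eps by (intro exI[of _ "min d \<epsilon>"]) (auto simp: dist_norm)
  qed
  have derQ: "(Q h has_field_derivative (g (t, q + h) - g (t, q)) / h) (at t)"
    if "norm h < \<epsilon>" "t \<in> ball p \<epsilon>" for h t
  proof -
    have "((\<lambda>t. f (t, q + h)) has_field_derivative g (t, q + h)) (at t)"
      by (rule has_partials_DERIV_fst, rule f, rule subD) (use that in \<open>auto simp: dist_norm\<close>)
    moreover have "((\<lambda>t. f (t, q)) has_field_derivative g (t, q)) (at t)"
      by (rule has_partials_DERIV_fst, rule f, rule subD) (use that eps in \<open>auto simp: dist_norm\<close>)
    ultimately show ?thesis unfolding Q_def by (intro DERIV_cdivide DERIV_diff)
  qed
  have evsmall: "\<forall>\<^sub>F h in at (0::complex). norm h < \<epsilon>"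
    using eps unfolding eventually_at by (intro exI[of _ \<epsilon>]) (auto simp: dist_norm)
  \<comment> \<open>One limit is computed twice: it is \<open>c\<close> by Weierstrass's theorem on
    derivatives of uniform limits, and \<open>b\<close> because \<open>deriv (Q h) p\<close> is the
    difference quotient of \<open>g\<close> in the second variable.\<close>
  have "((\<lambda>h. deriv (Q h) p) \<longlongrightarrow> deriv (\<lambda>t. k (t, q)) p) (at 0)"
  proof (rule deriv_complex_uniform_limit[OF lim])
    show "\<forall>\<^sub>F h in at 0. Q h holomorphic_on ball p \<epsilon>"
      using evsmall by eventually_elim (metis derQ holomorphic_on_open open_ball)
  qed (use eps in auto)
  moreover have "deriv (\<lambda>t. k (t, q)) p = c"
    using has_partials_DERIV_fst[OF k'] by (rule DERIV_imp_deriv)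
  moreover have "((\<lambda>h. deriv (Q h) p) \<longlongrightarrow> b) (at 0)"
  proof -
    have "((\<lambda>h. (g (p, q + h) - g (p, q)) / h) \<longlongrightarrow> b) (at 0)"
      using has_partials_DERIV_snd[OF g] unfolding DERIV_def by simp
    then show ?thesis
      by (rule Lim_transform_eventually)
         (use evsmall in eventually_elim, metis derQ DERIV_imp_deriv centre_in_ball eps)
  qed
  ultimately show ?thesis by (metis LIM_unique)
qed

text \<open>Here \<theta> is \<open>dF / F\<close>. Working with \<open>F\<close> itself avoids a
  branch of the logarithm: in the equality of the mixed partials of \<open>F\<close>, the products
  of the two coefficients of \<theta> cancel.\<close>

lemma log_differential_closed:
  assumes "open U" and z: "z \<in> U" and F: "\<And>w. w \<in> U \<Longrightarrow> F w \<noteq> 0"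
    and dF: "\<And>w. w \<in> U \<Longrightarrow> has_partials F (F w * fst (\<theta> w)) (F w * snd (\<theta> w)) w"
    and \<theta>: "holomorphic_form_on \<theta> U"
  shows "ext_deriv \<theta> z = 0"
proof -
  obtain p q where pq: "z = (p, q)" by (cases z)
  obtain a b c d where p1: "has_partials (\<lambda>z. fst (\<theta> z)) a b z"
    and p2: "has_partials (\<lambda>z. snd (\<theta> z)) c d z" and e: "ext_deriv \<theta> z = c - b"
    using holomorphic_form_onD[OF \<theta> z] .
  have hk: "\<exists>c d. has_partials (\<lambda>w. F w * snd (\<theta> w)) c d w" if "w \<in> U" for w
    using holomorphic_form_onD[OF \<theta> that] has_partials_mult[OF dF[OF that]] by metis
  have "F z * snd (\<theta> z) * fst (\<theta> z) + F z * b = F z * fst (\<theta> z) * snd (\<theta> z) + F z * c"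
    using mixed_partials[OF \<open>open U\<close> z[unfolded pq] dF
        has_partials_mult[OF dF[OF z] p1, unfolded pq] hk has_partials_mult[OF dF[OF z] p2, unfolded pq]]
    by (simp add: pq)
  then have "F z * b = F z * c" by (simp add: mult_ac)
  with F[OF z] e show ?thesis by simp
qed

section \<open>Flatness does not depend on the decomposition\<close>

lemma has_partials_wedge:
  assumes "has_partials (\<lambda>z. fst (\<alpha> z)) a b z" "has_partials (\<lambda>z. snd (\<alpha> z)) c d z"
    and "has_partials (\<lambda>z. fst (\<beta> z)) a' b' z" "has_partials (\<lambda>z. snd (\<beta> z)) c' d' z"
  shows "has_partials (wedge \<alpha> \<beta>)
    (a * snd (\<beta> z) + fst (\<alpha> z) * c' - (c * fst (\<beta> z) + snd (\<alpha> z) * a'))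
    (b * snd (\<beta> z) + fst (\<alpha> z) * d' - (d * fst (\<beta> z) + snd (\<alpha> z) * b')) z"
  unfolding wedge_def by (intro has_partials_diff has_partials_mult assms)

lemma holomorphic2_on_wedge:
  assumes "holomorphic_form_on \<alpha> U" "holomorphic_form_on \<beta> U"
  shows "holomorphic2_on (wedge \<alpha> \<beta>) U"
  unfolding holomorphic2_on_iff
  using assms has_partials_wedge by (metis holomorphic_form_onD)

lemma holomorphic2_on_mult:
  "holomorphic2_on f U \<Longrightarrow> holomorphic2_on g U \<Longrightarrow> holomorphic2_on (\<lambda>z. f z * g z) U"
  unfolding holomorphic2_on_iff using has_partials_mult by blast

lemma holomorphic2_on_add:
  "holomorphic2_on f U \<Longrightarrow> holomorphic2_on g U \<Longrightarrow> holomorphic2_on (\<lambda>z. f z + g z) U"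
  unfolding holomorphic2_on_iff using has_partials_add by blast

lemma holomorphic2_on_diff:
  "holomorphic2_on f U \<Longrightarrow> holomorphic2_on g U \<Longrightarrow> holomorphic2_on (\<lambda>z. f z - g z) U"
  unfolding holomorphic2_on_iff using has_partials_diff by blast

lemma holomorphic2_on_divide:
  "holomorphic2_on f U \<Longrightarrow> holomorphic2_on g U \<Longrightarrow> (\<And>z. z \<in> U \<Longrightarrow> g z \<noteq> 0) \<Longrightarrow>
    holomorphic2_on (\<lambda>z. f z / g z) U"
  unfolding holomorphic2_on_iff using has_partials_divide by blast

lemma holomorphic_form_on_subset:
  "holomorphic_form_on \<omega> U \<Longrightarrow> V \<subseteq> U \<Longrightarrow> holomorphic_form_on \<omega> V"
  unfolding holomorphic_form_on_def using holomorphic2_on_subset by blast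

lemma web_connection_subset:
  "web_connection U \<omega>1 \<omega>2 \<omega>3 \<eta> \<Longrightarrow> V \<subseteq> U \<Longrightarrow> web_connection V \<omega>1 \<omega>2 \<omega>3 \<eta>"
  unfolding web_connection_def Let_def using holomorphic_form_on_subset by blast

lemma web_connection_rotate:
  "web_connection U \<omega>1 \<omega>2 \<omega>3 \<eta> \<Longrightarrow> web_connection U \<omega>2 \<omega>3 \<omega>1 \<eta>"
  by (simp add: web_connection_def Let_def)

lemma scale_form_wedge_swap:
  "scale_form (wedge \<alpha> \<beta>) \<omega> = (\<lambda>z. - scale_form (wedge \<beta> \<alpha>) \<omega> z)"
  by (auto simp: scale_form_def wedge_def fun_eq_iff algebra_simps)

lemma wedge_uminus_right: "wedge \<alpha> (\<lambda>z. - \<beta> z) z = - wedge \<alpha> \<beta> z"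
  by (simp add: wedge_def)

lemma ext_deriv_uminus:
  assumes "holomorphic_form_on \<omega> U" "z \<in> U"
  shows "ext_deriv (\<lambda>z. - \<omega> z) z = - ext_deriv \<omega> z"
proof -
  obtain a b c d where p: "has_partials (\<lambda>z. fst (\<omega> z)) a b z" "has_partials (\<lambda>z. snd (\<omega> z)) c d z"
    and e: "ext_deriv \<omega> z = c - b" using holomorphic_form_onD[OF assms] .
  have "ext_deriv (\<lambda>z. - \<omega> z) z = - c - - b"
    by (rule ext_deriv_eq) (unfold fst_uminus snd_uminus, (rule has_partials_minus p)+)
  with e show ?thesis by simp
qed

lemma holomorphic_form_on_scale_wedge:
  assumes "holomorphic_form_on \<alpha> U" "holomorphic_form_on \<beta> U" "holomorphic_form_on \<omega> U"
  shows "holomorphic_form_on (scale_form (wedge \<alpha> \<beta>) \<omega>) U"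
  using assms unfolding holomorphic_form_on_def[of "scale_form _ _"] scale_form_def fst_conv snd_conv
  by (auto intro!: holomorphic2_on_mult holomorphic2_on_wedge simp: holomorphic_form_on_def)

text \<open>A transposition permutes the three scaled forms and changes all their signs; the
  equations for \<eta> are linear in these forms, so \<eta> stays the same. With the rotation this
  gives every reordering.\<close>

lemma web_connection_swap:
  assumes "web_connection U \<omega>1 \<omega>2 \<omega>3 \<eta>"
    and "holomorphic_form_on \<omega>1 U" "holomorphic_form_on \<omega>2 U" "holomorphic_form_on \<omega>3 U"
  shows "web_connection U \<omega>2 \<omega>1 \<omega>3 \<eta>"
  using assms unfolding web_connection_def Let_def
  by (simp add: scale_form_wedge_swap[of \<omega>1 \<omega>3] scale_form_wedge_swap[of \<omega>3 \<omega>2]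
      scale_form_wedge_swap[of \<omega>2 \<omega>1] wedge_uminus_right
      ext_deriv_uminus[OF holomorphic_form_on_scale_wedge])

lemma holomorphic2_on_nonzero_nbhd:
  assumes "holomorphic2_on g U" "open U" "z0 \<in> U" "g z0 \<noteq> 0"
  shows "\<exists>V. open V \<and> z0 \<in> V \<and> V \<subseteq> U \<and> (\<forall>z\<in>V. g z \<noteq> 0)"
proof -
  have "continuous_on U g"
    using assms(1) holomorphic2_on_continuous by (blast intro: continuous_at_imp_continuous_on)
  then have "open (U \<inter> g -` (- {0}))"
    using \<open>open U\<close> by (metis continuous_open_preimage open_Compl closed_singleton)
  then show ?thesis using assms by (intro exI[of _ "U \<inter> g -` (- {0})"]) auto
qed

text \<open>The factor is a quotient of coefficients, taken in a component in which \<alpha> does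
  not vanish at \<open>z0\<close>; hence the two cases and the smaller neighbourhood.\<close>

lemma proportional_forms:
  assumes "holomorphic_form_on \<alpha> U" "holomorphic_form_on \<beta> U" "open U" "z0 \<in> U"
    and "\<alpha> z0 \<noteq> 0" and "\<And>z. z \<in> U \<Longrightarrow> wedge \<alpha> \<beta> z = 0"
  obtains V f where "open V" "z0 \<in> V" "V \<subseteq> U" "holomorphic2_on f V"
    "\<And>z. z \<in> V \<Longrightarrow> \<beta> z = (f z * fst (\<alpha> z), f z * snd (\<alpha> z))"
proof -
  have hol: "holomorphic2_on (\<lambda>z. fst (\<alpha> z)) U" "holomorphic2_on (\<lambda>z. snd (\<alpha> z)) U"
    "holomorphic2_on (\<lambda>z. fst (\<beta> z)) U" "holomorphic2_on (\<lambda>z. snd (\<beta> z)) U"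
    using assms unfolding holomorphic_form_on_def by auto
  have w: "fst (\<alpha> z) * snd (\<beta> z) = snd (\<alpha> z) * fst (\<beta> z)" if "z \<in> U" for z
    using assms(6)[OF that] by (simp add: wedge_def)
  from \<open>\<alpha> z0 \<noteq> 0\<close> consider "fst (\<alpha> z0) \<noteq> 0" | "snd (\<alpha> z0) \<noteq> 0" by (metis prod.collapse zero_prod_def)
  then show thesis
  proof cases
    case 1
    then obtain V where V: "open V" "z0 \<in> V" "V \<subseteq> U" "\<And>z. z \<in> V \<Longrightarrow> fst (\<alpha> z) \<noteq> 0"
      using holomorphic2_on_nonzero_nbhd[OF hol(1) assms(3,4)] by blast
    show thesis
      by (rule that[of V "\<lambda>z. fst (\<beta> z) / fst (\<alpha> z)"])
        (use V w hol in \<open>auto intro!: holomorphic2_on_divide prod_eqI simp: subset_iff field_simps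
           intro: holomorphic2_on_subset[OF _ V(3)]\<close>)
  next
    case 2
    then obtain V where V: "open V" "z0 \<in> V" "V \<subseteq> U" "\<And>z. z \<in> V \<Longrightarrow> snd (\<alpha> z) \<noteq> 0"
      using holomorphic2_on_nonzero_nbhd[OF hol(2) assms(3,4)] by blast
    show thesis
      by (rule that[of V "\<lambda>z. snd (\<beta> z) / snd (\<alpha> z)"])
        (use V w hol in \<open>auto intro!: holomorphic2_on_divide prod_eqI simp: subset_iff field_simps
           intro: holomorphic2_on_subset[OF _ V(3)]\<close>)
  qed
qed

text \<open>Each scaled form acquires the same factor \<open>F = f1 f2 f3\<close>: one function from
  the form and two from the wedge. Hence \<open>\<eta>' - \<eta>\<close> is \<open>dF / F\<close>,
  which is closed.\<close>

lemma connection_rescale: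
  assumes "open U" "z0 \<in> U"
    and hol: "holomorphic_form_on \<alpha>1 U" "holomorphic_form_on \<alpha>2 U" "holomorphic_form_on \<alpha>3 U"
    and f: "holomorphic2_on f1 U" "holomorphic2_on f2 U" "holomorphic2_on f3 U"
    and \<beta>: "\<And>z. z \<in> U \<Longrightarrow> \<beta>1 z = (f1 z * fst (\<alpha>1 z), f1 z * snd (\<alpha>1 z))"
      "\<And>z. z \<in> U \<Longrightarrow> \<beta>2 z = (f2 z * fst (\<alpha>2 z), f2 z * snd (\<alpha>2 z))"
      "\<And>z. z \<in> U \<Longrightarrow> \<beta>3 z = (f3 z * fst (\<alpha>3 z), f3 z * snd (\<alpha>3 z))"
    and tr: "\<And>z. z \<in> U \<Longrightarrow> wedge \<alpha>1 \<alpha>2 z \<noteq> 0 \<and> wedge \<alpha>2 \<alpha>3 z \<noteq> 0 \<and> wedge \<alpha>3 \<alpha>1 z \<noteq> 0"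
    and tr': "\<And>z. z \<in> U \<Longrightarrow> wedge \<beta>1 \<beta>2 z \<noteq> 0 \<and> wedge \<beta>2 \<beta>3 z \<noteq> 0 \<and> wedge \<beta>3 \<beta>1 z \<noteq> 0"
    and \<eta>: "web_connection U \<alpha>1 \<alpha>2 \<alpha>3 \<eta>" and \<eta>': "web_connection U \<beta>1 \<beta>2 \<beta>3 \<eta>'"
  shows "ext_deriv \<eta> z0 = ext_deriv \<eta>' z0"
proof -
  define F where "F = (\<lambda>z. f1 z * f2 z * f3 z)"
  have F: "holomorphic2_on F U" unfolding F_def by (intro holomorphic2_on_mult f)
  have Fnz: "F z \<noteq> 0" if "z \<in> U" for z
    using tr'[OF that] \<beta>[OF that] by (auto simp: F_def wedge_def)
  define A1 where "A1 = scale_form (wedge \<alpha>2 \<alpha>3) \<alpha>1"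
  define A2 where "A2 = scale_form (wedge \<alpha>3 \<alpha>1) \<alpha>2"
  define B1 where "B1 = scale_form (wedge \<beta>2 \<beta>3) \<beta>1"
  define B2 where "B2 = scale_form (wedge \<beta>3 \<beta>1) \<beta>2"
  have B1: "B1 z = (F z * fst (A1 z), F z * snd (A1 z))"
    and B2: "B2 z = (F z * fst (A2 z), F z * snd (A2 z))" if "z \<in> U" for z
    unfolding A1_def B1_def A2_def B2_def scale_form_def wedge_def F_def
    by (simp_all add: \<beta>[OF that] algebra_simps)
  have hA: "holomorphic_form_on A1 U" "holomorphic_form_on A2 U"
    unfolding A1_def A2_def by (intro holomorphic_form_on_scale_wedge hol)+
  \<comment> \<open>By Leibniz, \<xi> = \<open>dF - F (\<eta>' - \<eta>)\<close> has zero wedge with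
    \<open>A\<close> whenever \<open>B = F A\<close> and both satisfy their connection
    equation.\<close>
  have key: "fst \<xi> * snd (A z) - snd \<xi> * fst (A z) = 0"
    if z: "z \<in> U" and A: "holomorphic_form_on A U" and e: "ext_deriv A z = wedge \<eta> A z"
      and e': "ext_deriv B z = wedge \<eta>' B z"
      and B: "\<And>w. w \<in> U \<Longrightarrow> B w = (F w * fst (A w), F w * snd (A w))"
      and Fp: "has_partials F a b z"
      and xi: "\<xi> = (a - F z * (fst (\<eta>' z) - fst (\<eta> z)), b - F z * (snd (\<eta>' z) - snd (\<eta> z)))"
    for z A B a b \<xi>
  proof -
    obtain r s t u where p: "has_partials (\<lambda>z. fst (A z)) r s z" "has_partials (\<lambda>z. snd (A z)) t u z"
      and eA: "ext_deriv A z = t - s" using holomorphic_form_onD[OF A z] .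
    have "has_partials (\<lambda>w. fst (B w)) (a * fst (A z) + F z * r) (b * fst (A z) + F z * s) z"
      by (rule has_partials_transform[OF has_partials_mult[OF Fp p(1)] \<open>open U\<close> z]) (simp add: B)
    moreover have "has_partials (\<lambda>w. snd (B w)) (a * snd (A z) + F z * t) (b * snd (A z) + F z * u) z"
      by (rule has_partials_transform[OF has_partials_mult[OF Fp p(2)] \<open>open U\<close> z]) (simp add: B)
    ultimately have "ext_deriv B z = a * snd (A z) + F z * t - (b * fst (A z) + F z * s)"
      by (rule ext_deriv_eq)
    with e e' eA have "a * snd (A z) + F z * t - (b * fst (A z) + F z * s) = wedge \<eta>' B z"
      "t - s = wedge \<eta> A z" by simp_all
    then show ?thesis unfolding xi wedge_def B[OF z] fst_conv snd_conv by algebra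
  qed
  define \<theta> where "\<theta> = (\<lambda>z. (fst (\<eta>' z) - fst (\<eta> z), snd (\<eta>' z) - snd (\<eta> z)))"
  have h\<eta>: "holomorphic_form_on \<eta> U" "holomorphic_form_on \<eta>' U"
    using \<eta> \<eta>' unfolding web_connection_def by auto
  then have h\<theta>: "holomorphic_form_on \<theta> U"
    unfolding \<theta>_def holomorphic_form_on_def fst_conv snd_conv by (auto intro!: holomorphic2_on_diff)
  have dF: "has_partials F (F z * fst (\<theta> z)) (F z * snd (\<theta> z)) z" if z: "z \<in> U" for z
  proof -
    obtain a b where Fp: "has_partials F a b z" using F z unfolding holomorphic2_on_iff by blast
    define \<xi> where "\<xi> = (a - F z * (fst (\<eta>' z) - fst (\<eta> z)), b - F z * (snd (\<eta>' z) - snd (\<eta> z)))"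
    have e: "ext_deriv A1 z = wedge \<eta> A1 z" "ext_deriv A2 z = wedge \<eta> A2 z"
      "ext_deriv B1 z = wedge \<eta>' B1 z" "ext_deriv B2 z = wedge \<eta>' B2 z"
      using \<eta> \<eta>' z unfolding web_connection_def Let_def A1_def A2_def B1_def B2_def by blast+
    have x1: "fst \<xi> * snd (A1 z) = snd \<xi> * fst (A1 z)"
      using key[OF z hA(1) e(1) e(3) B1 Fp \<xi>_def] by simp
    have x2: "fst \<xi> * snd (A2 z) = snd \<xi> * fst (A2 z)"
      using key[OF z hA(2) e(2) e(4) B2 Fp \<xi>_def] by simp
    \<comment> \<open>\<open>A1\<close> and \<open>A2\<close> are independent, their wedge being the
      product of the three pairwise wedges. A covector with zero wedge against both is zero, so
      \<xi> vanishes.\<close>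
    have "fst (A1 z) * snd (A2 z) - snd (A1 z) * fst (A2 z)
        = wedge \<alpha>2 \<alpha>3 z * wedge \<alpha>3 \<alpha>1 z * wedge \<alpha>1 \<alpha>2 z"
      unfolding A1_def A2_def scale_form_def wedge_def by (simp add: algebra_simps)
    then have nz: "fst (A1 z) * snd (A2 z) - snd (A1 z) * fst (A2 z) \<noteq> 0" using tr[OF z] by simp
    have "fst \<xi> * (fst (A1 z) * snd (A2 z) - snd (A1 z) * fst (A2 z)) = 0"
      "snd \<xi> * (fst (A1 z) * snd (A2 z) - snd (A1 z) * fst (A2 z)) = 0"
      using x1 x2 by algebra+
    with nz have "fst \<xi> = 0" "snd \<xi> = 0" by auto
    with Fp show ?thesis by (simp add: \<xi>_def \<theta>_def)
  qed
  have "ext_deriv \<theta> z0 = 0"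
    by (rule log_differential_closed[OF \<open>open U\<close> \<open>z0 \<in> U\<close> Fnz dF h\<theta>])
  moreover obtain a b c d where p: "has_partials (\<lambda>z. fst (\<eta> z)) a b z0" "has_partials (\<lambda>z. snd (\<eta> z)) c d z0"
      "ext_deriv \<eta> z0 = c - b" using holomorphic_form_onD[OF h\<eta>(1) \<open>z0 \<in> U\<close>] .
  moreover obtain a' b' c' d' where p': "has_partials (\<lambda>z. fst (\<eta>' z)) a' b' z0"
     "has_partials (\<lambda>z. snd (\<eta>' z)) c' d' z0"
      "ext_deriv \<eta>' z0 = c' - b'" using holomorphic_form_onD[OF h\<eta>(2) \<open>z0 \<in> U\<close>] .
  moreover have "ext_deriv \<theta> z0 = (c' - c) - (b' - b)"
    by (rule ext_deriv_eq) (unfold \<theta>_def fst_conv snd_conv, (rule has_partials_diff p p')+)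
  ultimately have "c' - c - (b' - b) = 0" "ext_deriv \<eta> z0 = c - b" "ext_deriv \<eta>' z0 = c' - b'" by simp_all
  then show ?thesis by algebra
qed

lemma connection_proportional:
  assumes "open U" "z0 \<in> U"
    and hol: "holomorphic_form_on \<alpha>1 U" "holomorphic_form_on \<alpha>2 U" "holomorphic_form_on \<alpha>3 U"
    and hol': "holomorphic_form_on \<beta>1 U" "holomorphic_form_on \<beta>2 U" "holomorphic_form_on \<beta>3 U"
    and w: "\<And>z. z \<in> U \<Longrightarrow> wedge \<alpha>1 \<beta>1 z = 0" "\<And>z. z \<in> U \<Longrightarrow> wedge \<alpha>2 \<beta>2 z = 0"
      "\<And>z. z \<in> U \<Longrightarrow> wedge \<alpha>3 \<beta>3 z = 0"
    and tr: "\<And>z. z \<in> U \<Longrightarrow> wedge \<alpha>1 \<alpha>2 z \<noteq> 0 \<and> wedge \<alpha>2 \<alpha>3 z \<noteq> 0 \<and> wedge \<alpha>3 \<alpha>1 z \<noteq> 0"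
    and tr': "\<And>z. z \<in> U \<Longrightarrow> wedge \<beta>1 \<beta>2 z \<noteq> 0 \<and> wedge \<beta>2 \<beta>3 z \<noteq> 0 \<and> wedge \<beta>3 \<beta>1 z \<noteq> 0"
    and \<eta>: "web_connection U \<alpha>1 \<alpha>2 \<alpha>3 \<eta>" and \<eta>': "web_connection U \<beta>1 \<beta>2 \<beta>3 \<eta>'"
  shows "ext_deriv \<eta> z0 = ext_deriv \<eta>' z0"
proof -
  have nz: "\<alpha>1 z0 \<noteq> 0" "\<alpha>2 z0 \<noteq> 0" "\<alpha>3 z0 \<noteq> 0" using tr[OF \<open>z0 \<in> U\<close>] by (auto simp: wedge_def)
  obtain V1 f1 where V1: "open V1" "z0 \<in> V1" "V1 \<subseteq> U" "holomorphic2_on f1 V1"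
    "\<And>z. z \<in> V1 \<Longrightarrow> \<beta>1 z = (f1 z * fst (\<alpha>1 z), f1 z * snd (\<alpha>1 z))"
    using proportional_forms[OF hol(1) hol'(1) assms(1,2) nz(1) w(1)] by blast
  obtain V2 f2 where V2: "open V2" "z0 \<in> V2" "V2 \<subseteq> U" "holomorphic2_on f2 V2"
    "\<And>z. z \<in> V2 \<Longrightarrow> \<beta>2 z = (f2 z * fst (\<alpha>2 z), f2 z * snd (\<alpha>2 z))"
    using proportional_forms[OF hol(2) hol'(2) assms(1,2) nz(2) w(2)] by blast
  obtain V3 f3 where V3: "open V3" "z0 \<in> V3" "V3 \<subseteq> U" "holomorphic2_on f3 V3"
    "\<And>z. z \<in> V3 \<Longrightarrow> \<beta>3 z = (f3 z * fst (\<alpha>3 z), f3 z * snd (\<alpha>3 z))"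
    using proportional_forms[OF hol(3) hol'(3) assms(1,2) nz(3) w(3)] by blast
  define V where "V = V1 \<inter> V2 \<inter> V3"
  have V: "open V" "z0 \<in> V" "V \<subseteq> U" "V \<subseteq> V1" "V \<subseteq> V2" "V \<subseteq> V3"
    using V1 V2 V3 unfolding V_def by auto
  note sub = subsetD[OF V(3)] subsetD[OF V(4)] subsetD[OF V(5)] subsetD[OF V(6)]
  show ?thesis
    by (rule connection_rescale[OF V(1,2) hol[THEN holomorphic_form_on_subset, OF V(3)]
        holomorphic2_on_subset[OF V1(4) V(4)] holomorphic2_on_subset[OF V2(4) V(5)]
        holomorphic2_on_subset[OF V3(4) V(6)] V1(5)[OF sub(2)] V2(5)[OF sub(3)] V3(5)[OF sub(4)]
        tr[OF sub(1)] tr'[OF sub(1)] web_connection_subset[OF \<eta> V(3)] web_connection_subset[OF \<eta>' V(3)]])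
qed

section \<open>Two factorizations of one cubic into linear factors\<close>

lemma cubic_coeffs_unique:
  fixes a0 :: complex
  assumes "\<And>x. a0 + a1 * x + a2 * x\<^sup>2 + a3 * x ^ 3 = b0 + b1 * x + b2 * x\<^sup>2 + b3 * x ^ 3"
  shows "a0 = b0" "a1 = b1" "a2 = b2" "a3 = b3"
proof -
  define w where "w = (\<lambda>(c0 :: complex) c1 c2 c3 i::nat. if i = 0 then c0 else if i = 1 then c1 else if i = 2 then c2 else c3)"
  have w: "(\<Sum>i\<le>3. w c0 c1 c2 c3 i * x ^ i) = c0 + c1 * x + c2 * x\<^sup>2 + c3 * x ^ 3" for c0 c1 c2 c3 x
    by (simp add: eval_nat_numeral w_def)
  have "\<forall>x. (\<Sum>i\<le>3. w a0 a1 a2 a3 i * x ^ i) = (\<Sum>i\<le>3. w b0 b1 b2 b3 i * x ^ i)"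
    unfolding w using assms by blast
  then have "\<And>i. i \<le> 3 \<Longrightarrow> w a0 a1 a2 a3 i = w b0 b1 b2 b3 i" unfolding polyfun_eq_coeffs by blast
  from this[of 0] this[of 1] this[of 2] this[of 3] show "a0 = b0" "a1 = b1" "a2 = b2" "a3 = b3"
    by (simp_all add: w_def)
qed

lemma product_of_affine_coeffs:
  fixes a1 b1 a2 b2 a3 b3 :: complex
  assumes "\<And>x. (a1 + b1 * x) * (a2 + b2 * x) * (a3 + b3 * x) = k * ((c1 + d1 * x) * (c2 + d2 * x) * (c3 + d3 * x))"
  shows "a1 * a2 * a3 = k * (c1 * c2 * c3)"
    "b1 * a2 * a3 + a1 * b2 * a3 + a1 * a2 * b3 = k * (d1 * c2 * c3 + c1 * d2 * c3 + c1 * c2 * d3)"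
    "b1 * b2 * a3 + b1 * a2 * b3 + a1 * b2 * b3 = k * (d1 * d2 * c3 + d1 * c2 * d3 + c1 * d2 * d3)"
    "b1 * b2 * b3 = k * (d1 * d2 * d3)"
proof -
  have "a1 * a2 * a3 + (b1 * a2 * a3 + a1 * b2 * a3 + a1 * a2 * b3) * x
      + (b1 * b2 * a3 + b1 * a2 * b3 + a1 * b2 * b3) * x\<^sup>2 + b1 * b2 * b3 * x ^ 3 =
    k * (c1 * c2 * c3) + k * (d1 * c2 * c3 + c1 * d2 * c3 + c1 * c2 * d3) * x
      + k * (d1 * d2 * c3 + d1 * c2 * d3 + c1 * d2 * d3) * x\<^sup>2 + k * (d1 * d2 * d3) * x ^ 3" for x
    using assms[of x] by algebra
  note e = cubic_coeffs_unique[OF this]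
  show "a1 * a2 * a3 = k * (c1 * c2 * c3)"
    "b1 * a2 * a3 + a1 * b2 * a3 + a1 * a2 * b3 = k * (d1 * c2 * c3 + c1 * d2 * c3 + c1 * c2 * d3)"
    "b1 * b2 * a3 + b1 * a2 * b3 + a1 * b2 * b3 = k * (d1 * d2 * c3 + d1 * c2 * d3 + c1 * d2 * d3)"
    "b1 * b2 * b3 = k * (d1 * d2 * d3)"
    by (fact e)+
qed


text \<open>Homogenize to factors \<open>a * s + b * t\<close> and evaluate at the zero
  \<open>(s, t) = (- b1, a1)\<close> of the first one. Passing through the coefficients covers
  \<open>b1 = 0\<close>, where this root lies at infinity.\<close>

lemma product_of_affine_root:
  fixes a1 b1 a2 b2 a3 b3 :: complex
  assumes "\<And>x. (a1 + b1 * x) * (a2 + b2 * x) * (a3 + b3 * x) = k * ((c1 + d1 * x) * (c2 + d2 * x) * (c3 + d3 * x))"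
    and "k \<noteq> 0"
  shows "(a1 * d1 - b1 * c1) * (a1 * d2 - b1 * c2) * (a1 * d3 - b1 * c3) = 0"
proof -
  have "k * ((a1 * d1 - b1 * c1) * (a1 * d2 - b1 * c2) * (a1 * d3 - b1 * c3)) = 0"
    using product_of_affine_coeffs[OF assms(1)] by algebra
  then show ?thesis using assms(2) by simp
qed

text \<open>Both sides are the discriminant of the cubic.\<close>

lemma product_of_affine_discriminant:
  fixes a1 b1 a2 b2 a3 b3 :: complex
  assumes "\<And>x. (a1 + b1 * x) * (a2 + b2 * x) * (a3 + b3 * x) = k * ((c1 + d1 * x) * (c2 + d2 * x) * (c3 + d3 * x))"
  shows "((a1 * b2 - b1 * a2) * (a2 * b3 - b2 * a3) * (a3 * b1 - b3 * a1))\<^sup>2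
    = k ^ 4 * ((c1 * d2 - d1 * c2) * (c2 * d3 - d2 * c3) * (c3 * d1 - d3 * c1))\<^sup>2"
proof -
  define D where "D = (\<lambda>A0 A1 A2 A3 :: complex. A1\<^sup>2 * A2\<^sup>2 - 4 * A0 * A2 ^ 3 - 4 * A1 ^ 3 * A3
     + 18 * A0 * A1 * A2 * A3 - 27 * A0\<^sup>2 * A3\<^sup>2)"
  have D: "((a1 * b2 - b1 * a2) * (a2 * b3 - b2 * a3) * (a3 * b1 - b3 * a1))\<^sup>2 =
    D (a1 * a2 * a3) (b1 * a2 * a3 + a1 * b2 * a3 + a1 * a2 * b3)
      (b1 * b2 * a3 + b1 * a2 * b3 + a1 * b2 * b3) (b1 * b2 * b3)" for a1 b1 a2 b2 a3 b3
    unfolding D_def by algebra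
  have Dk: "D (k * A0) (k * A1) (k * A2) (k * A3) = k ^ 4 * D A0 A1 A2 A3" for A0 A1 A2 A3
    unfolding D_def by algebra
  show ?thesis unfolding D product_of_affine_coeffs[OF assms] Dk ..
qed

abbreviation form_at :: "one_form \<Rightarrow> complex \<times> complex \<Rightarrow> complex \<Rightarrow> complex" where
  "form_at \<omega> z x \<equiv> fst (\<omega> z) + snd (\<omega> z) * x"

lemma web_decomposition_product:
  assumes "web_decomposition W U \<alpha>1 \<alpha>2 \<alpha>3" "web_decomposition W U' \<beta>1 \<beta>2 \<beta>3" "z \<in> U" "z \<in> U'"
  obtains k where "k \<noteq> 0"
    "\<And>x. form_at \<alpha>1 z x * form_at \<alpha>2 z x * form_at \<alpha>3 z x =
      k * (form_at \<beta>1 z x * form_at \<beta>2 z x * form_at \<beta>3 z x)"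
proof -
  obtain c where c: "c \<noteq> 0" "\<And>x. W z x = c * form_at \<alpha>1 z x *
      form_at \<alpha>2 z x * form_at \<alpha>3 z x"
    using assms unfolding web_decomposition_def by blast
  obtain d where d: "d \<noteq> 0" "\<And>x. W z x = d * form_at \<beta>1 z x *
      form_at \<beta>2 z x * form_at \<beta>3 z x"
    using assms unfolding web_decomposition_def by blast
  show thesis
    by (rule that[of "d / c"], use c d in simp) (use c d(1) d(2)[unfolded c(2)] in \<open>simp add: field_simps\<close>)
qed

lemma web_decomposition_rotate:
  "web_decomposition W U \<omega>1 \<omega>2 \<omega>3 \<Longrightarrow> web_decomposition W U \<omega>2 \<omega>3 \<omega>1"
  unfolding web_decomposition_def by (auto simp: mult_ac)

lemma web_decomposition_swap:
  "web_decomposition W U \<omega>1 \<omega>2 \<omega>3 \<Longrightarrow> web_decomposition W U \<omega>2 \<omega>1 \<omega>3"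
  unfolding web_decomposition_def
  by (auto simp: mult_ac wedge_def)

lemma web_decomposition_subset:
  "web_decomposition W U \<omega>1 \<omega>2 \<omega>3 \<Longrightarrow> V \<subseteq> U \<Longrightarrow> web_decomposition W V \<omega>1 \<omega>2 \<omega>3"
  unfolding web_decomposition_def using holomorphic_form_on_subset by blast

text \<open>
  Near a regular point each \<open>\<alpha>\<close> is proportional to exactly one of the \<open>\<beta>\<close>'s, and which one it is cannot jump.
\<close>

lemma proportional_nearby:
  assumes dec: "web_decomposition W U \<alpha>1 \<alpha>2 \<alpha>3" "web_decomposition W U \<beta>1 \<beta>2 \<beta>3"
    and U: "open U" "z0 \<in> U"
  obtains V \<beta> where "open V" "z0 \<in> V" "V \<subseteq> U" "\<beta> \<in> {\<beta>1, \<beta>2, \<beta>3}" "\<And>z. z \<in> V \<Longrightarrow> wedge \<alpha>1 \<beta> z = 0"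
proof -
  have h: "holomorphic_form_on \<alpha>1 U" "holomorphic_form_on \<beta>1 U" "holomorphic_form_on \<beta>2 U"
    "holomorphic_form_on \<beta>3 U" using dec unfolding web_decomposition_def by auto
  have root: "wedge \<alpha>1 \<beta>1 z * wedge \<alpha>1 \<beta>2 z * wedge \<alpha>1 \<beta>3 z = 0" if z: "z \<in> U" for z
  proof -
    obtain k where k: "k \<noteq> 0" "\<And>x. form_at \<alpha>1 z x * form_at \<alpha>2 z x *
        form_at \<alpha>3 z x = k * (form_at \<beta>1 z x *
        form_at \<beta>2 z x * form_at \<beta>3 z x)"
      using web_decomposition_product[OF dec z z] by blast
    from product_of_affine_root[OF k(2,1)] show ?thesis by (simp add: wedge_def)
  qed
  have nbhd: "\<exists>V. open V \<and> z0 \<in> V \<and> V \<subseteq> U \<and> (\<forall>z\<in>V. wedge \<alpha>1 \<beta> z \<noteq> 0)"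
    if "wedge \<alpha>1 \<beta> z0 \<noteq> 0" "holomorphic_form_on \<beta> U" for \<beta>
    using holomorphic2_on_nonzero_nbhd[OF holomorphic2_on_wedge[OF h(1) that(2)] U that(1)] .
  have sel: "\<exists>V. open V \<and> z0 \<in> V \<and> V \<subseteq> U \<and> (\<forall>z\<in>V. wedge \<alpha>1 \<beta> z = 0)"
    if nz: "wedge \<alpha>1 \<beta>' z0 \<noteq> 0" "wedge \<alpha>1 \<beta>'' z0 \<noteq> 0" and hb: "holomorphic_form_on \<beta>' U"
      "holomorphic_form_on \<beta>'' U"
      and r: "\<And>z. z \<in> U \<Longrightarrow> wedge \<alpha>1 \<beta> z * wedge \<alpha>1 \<beta>' z * wedge \<alpha>1 \<beta>'' z = 0" for \<beta> \<beta>' \<beta>''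
  proof -
    obtain V where V: "open V" "z0 \<in> V" "V \<subseteq> U" "\<forall>z\<in>V. wedge \<alpha>1 \<beta>' z \<noteq> 0"
      using nbhd[OF nz(1) hb(1)] by blast
    obtain V' where V': "open V'" "z0 \<in> V'" "V' \<subseteq> U" "\<forall>z\<in>V'. wedge \<alpha>1 \<beta>'' z \<noteq> 0"
      using nbhd[OF nz(2) hb(2)] by blast
    show ?thesis
    proof (intro exI[of _ "V \<inter> V'"] conjI ballI)
      fix z assume z: "z \<in> V \<inter> V'"
      with r[of z] V(3) have "wedge \<alpha>1 \<beta> z * wedge \<alpha>1 \<beta>' z * wedge \<alpha>1 \<beta>'' z = 0" by blast
      with z V(4) V'(4) show "wedge \<alpha>1 \<beta> z = 0" by auto
    qed (use V V' in auto)
  qed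
  have a: "fst (\<alpha>1 z0) \<noteq> 0 \<or> snd (\<alpha>1 z0) \<noteq> 0"
    using dec(1) U(2) unfolding web_decomposition_def wedge_def by force
  have b: "wedge \<beta>1 \<beta>2 z0 \<noteq> 0" "wedge \<beta>2 \<beta>3 z0 \<noteq> 0" "wedge \<beta>3 \<beta>1 z0 \<noteq> 0"
    using dec(2) U(2) unfolding web_decomposition_def by auto
  \<comment> \<open>Two of the \<beta>'s proportional to \<open>\<alpha>1 z0\<close> would be
    proportional to each other, so at \<open>z0\<close> at most one of the three wedges
    vanishes.\<close>
  have cross: "wedge \<beta> \<beta>' z0 = 0" if "wedge \<alpha>1 \<beta> z0 = 0" "wedge \<alpha>1 \<beta>' z0 = 0" for \<beta> \<beta>'
  proof -
    have "fst (\<alpha>1 z0) * wedge \<beta> \<beta>' z0 = 0" "snd (\<alpha>1 z0) * wedge \<beta> \<beta>' z0 = 0"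
      using that unfolding wedge_def by algebra+
    with a show ?thesis by auto
  qed
  consider "wedge \<alpha>1 \<beta>2 z0 \<noteq> 0" "wedge \<alpha>1 \<beta>3 z0 \<noteq> 0" | "wedge \<alpha>1 \<beta>1 z0 \<noteq> 0" "wedge \<alpha>1 \<beta>3 z0 \<noteq> 0"
    | "wedge \<alpha>1 \<beta>1 z0 \<noteq> 0" "wedge \<alpha>1 \<beta>2 z0 \<noteq> 0"
    using cross b by blast
  then show thesis
  proof cases
    case 1
    have "\<exists>V. open V \<and> z0 \<in> V \<and> V \<subseteq> U \<and> (\<forall>z\<in>V. wedge \<alpha>1 \<beta>1 z = 0)"
      by (rule sel[OF 1 h(3,4)]) (use root in \<open>simp add: mult_ac\<close>)
    then show thesis using that[of _ \<beta>1] by blast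
  next
    case 2
    have "\<exists>V. open V \<and> z0 \<in> V \<and> V \<subseteq> U \<and> (\<forall>z\<in>V. wedge \<alpha>1 \<beta>2 z = 0)"
      by (rule sel[OF 2 h(2,4)]) (use root in \<open>simp add: mult_ac\<close>)
    then show thesis using that[of _ \<beta>2] by blast
  next
    case 3
    have "\<exists>V. open V \<and> z0 \<in> V \<and> V \<subseteq> U \<and> (\<forall>z\<in>V. wedge \<alpha>1 \<beta>3 z = 0)"
      by (rule sel[OF 3 h(2,3)]) (use root in \<open>simp add: mult_ac\<close>)
    then show thesis using that[of _ \<beta>3] by blast
  qed
qed

text \<open>Each \<alpha> is matched near \<open>z0\<close> with some \<beta>. Different \<alpha>'s
  get different partners because they are transverse, so the matching is a permutation, under which
  \<eta>' remains a connection; what is left is a rescaling of proportional forms.\<close>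

lemma ext_deriv_connection_unique:
  assumes dec: "web_decomposition W U \<alpha>1 \<alpha>2 \<alpha>3" "web_decomposition W U \<beta>1 \<beta>2 \<beta>3"
    and U: "open U" "z0 \<in> U"
    and \<eta>: "web_connection U \<alpha>1 \<alpha>2 \<alpha>3 \<eta>" and \<eta>': "web_connection U \<beta>1 \<beta>2 \<beta>3 \<eta>'"
  shows "ext_deriv \<eta> z0 = ext_deriv \<eta>' z0"
proof -
  note dec2 = web_decomposition_rotate[OF dec(1)]
  note dec3 = web_decomposition_rotate[OF dec2]
  obtain V1 \<gamma>1 where V1: "open V1" "z0 \<in> V1" "V1 \<subseteq> U" "\<gamma>1 \<in> {\<beta>1, \<beta>2, \<beta>3}" "\<And>z. z \<in> V1 \<Longrightarrow> wedge \<alpha>1 \<gamma>1 z = 0"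
    using proportional_nearby[OF dec(1,2) U] by blast
  obtain V2 \<gamma>2 where V2: "open V2" "z0 \<in> V2" "V2 \<subseteq> U" "\<gamma>2 \<in> {\<beta>1, \<beta>2, \<beta>3}" "\<And>z. z \<in> V2 \<Longrightarrow> wedge \<alpha>2 \<gamma>2 z = 0"
    using proportional_nearby[OF dec2 dec(2) U] by blast
  obtain V3 \<gamma>3 where V3: "open V3" "z0 \<in> V3" "V3 \<subseteq> U" "\<gamma>3 \<in> {\<beta>1, \<beta>2, \<beta>3}" "\<And>z. z \<in> V3 \<Longrightarrow> wedge \<alpha>3 \<gamma>3 z = 0"
    using proportional_nearby[OF dec3 dec(2) U] by blast
  have tr: "wedge \<alpha>1 \<alpha>2 z0 \<noteq> 0" "wedge \<alpha>2 \<alpha>3 z0 \<noteq> 0" "wedge \<alpha>3 \<alpha>1 z0 \<noteq> 0"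
    "wedge \<beta>1 \<beta>2 z0 \<noteq> 0" "wedge \<beta>2 \<beta>3 z0 \<noteq> 0" "wedge \<beta>3 \<beta>1 z0 \<noteq> 0"
    using dec U(2) unfolding web_decomposition_def by auto
  have cross: "wedge \<alpha> \<alpha>' z0 = 0"
    if "wedge \<alpha> \<gamma> z0 = 0" "wedge \<alpha>' \<gamma> z0 = 0" "\<gamma> \<in> {\<beta>1, \<beta>2, \<beta>3}" for \<alpha> \<alpha>' \<gamma>
  proof -
    have nz: "fst (\<gamma> z0) \<noteq> 0 \<or> snd (\<gamma> z0) \<noteq> 0" using that(3) tr(4-6) unfolding wedge_def by auto
    have "fst (\<gamma> z0) * wedge \<alpha> \<alpha>' z0 = 0" "snd (\<gamma> z0) * wedge \<alpha> \<alpha>' z0 = 0"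
      using that(1,2) unfolding wedge_def by algebra+
    with nz show ?thesis by auto
  qed
  have ne: "\<gamma>1 \<noteq> \<gamma>2" "\<gamma>2 \<noteq> \<gamma>3" "\<gamma>3 \<noteq> \<gamma>1"
    using cross tr(1-3) V1(2,4,5) V2(2,4,5) V3(2,4,5) by metis+
  have hb: "holomorphic_form_on \<beta>1 U" "holomorphic_form_on \<beta>2 U" "holomorphic_form_on \<beta>3 U"
    using dec unfolding web_decomposition_def by auto
  let ?P = "\<lambda>a b c. web_decomposition W U a b c \<and> web_connection U a b c \<eta>'"
  \<comment> \<open>The identity and one transposition, followed by rotations, give all six
    orders.\<close>
  have P1: "?P \<beta>1 \<beta>2 \<beta>3" "?P \<beta>2 \<beta>1 \<beta>3"
    using dec(2) \<eta>' web_decomposition_swap web_connection_swap[OF \<eta>' hb] by blast+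
  then have P2: "?P \<beta>2 \<beta>3 \<beta>1" "?P \<beta>1 \<beta>3 \<beta>2"
    using web_decomposition_rotate web_connection_rotate by blast+
  then have P3: "?P \<beta>3 \<beta>1 \<beta>2" "?P \<beta>3 \<beta>2 \<beta>1"
    using web_decomposition_rotate web_connection_rotate by blast+
  have P: "?P \<gamma>1 \<gamma>2 \<gamma>3" using V1(4) V2(4) V3(4) ne P1 P2 P3 by auto
  define V where "V = V1 \<inter> V2 \<inter> V3"
  have V: "open V" "z0 \<in> V" "V \<subseteq> U" using V1 V2 V3 unfolding V_def by auto
  have d1: "web_decomposition W V \<alpha>1 \<alpha>2 \<alpha>3" and d2: "web_decomposition W V \<gamma>1 \<gamma>2 \<gamma>3"
    using dec(1) P V(3) web_decomposition_subset by blast+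
  have c1: "web_connection V \<alpha>1 \<alpha>2 \<alpha>3 \<eta>" and c2: "web_connection V \<gamma>1 \<gamma>2 \<gamma>3 \<eta>'"
    using \<eta> P V(3) web_connection_subset by blast+
  show ?thesis
    by (rule connection_proportional[OF V(1,2) _ _ _ _ _ _ V1(5) V2(5) V3(5) _ _ c1 c2])
      (use d1 d2 in \<open>auto simp: web_decomposition_def V_def\<close>)
qed

section \<open>Explicit connections\<close>

lemma ext_deriv_scale_wedge:
  assumes "has_partials (\<lambda>z. fst (\<omega>1 z)) a1 b1 z" "has_partials (\<lambda>z. snd (\<omega>1 z)) c1 d1 z"
    and "has_partials (\<lambda>z. fst (\<omega>2 z)) a2 b2 z" "has_partials (\<lambda>z. snd (\<omega>2 z)) c2 d2 z"
    and "has_partials (\<lambda>z. fst (\<omega>3 z)) a3 b3 z" "has_partials (\<lambda>z. snd (\<omega>3 z)) c3 d3 z"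
  shows "ext_deriv (scale_form (wedge \<omega>2 \<omega>3) \<omega>1) z =
    ((a2 * snd (\<omega>3 z) + fst (\<omega>2 z) * c3 - (c2 * fst (\<omega>3 z) + snd (\<omega>2 z) * a3)) * snd (\<omega>1 z)
      + wedge \<omega>2 \<omega>3 z * c1)
    - ((b2 * snd (\<omega>3 z) + fst (\<omega>2 z) * d3 - (d2 * fst (\<omega>3 z) + snd (\<omega>2 z) * b3)) * fst (\<omega>1 z)
      + wedge \<omega>2 \<omega>3 z * b1)"
  by (rule ext_deriv_eq)
     (unfold scale_form_def fst_conv snd_conv, (rule has_partials_mult has_partials_wedge assms)+)

text \<open>
  Where \<open>E = e\<^sup>2\<close> and \<open>N = n\<^sup>2\<close>, the 2-web \<open>E x\<^sup>2 + N (p x - q)\<^sup>2 = 0\<close> splits into the factors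
  \<open>e x + \<i> n (p x - q)\<close> and \<open>e x - \<i> n (p x - q)\<close>.
\<close>

definition root_form :: "(complex \<Rightarrow> complex) \<Rightarrow> (complex \<Rightarrow> complex) \<Rightarrow> one_form" where
  "root_form e n = (\<lambda>z. (- \<i> * n (fst z) * snd z, e (fst z) + \<i> * n (fst z) * fst z))"

text \<open>This is \<open>\<alpha> * x + \<beta> * (p * x - q) + \<gamma>\<close> with
  \<open>x = dq / dp\<close>, multiplied by \<open>dp\<close>.\<close>

definition line_form :: "complex \<Rightarrow> complex \<Rightarrow> complex \<Rightarrow> one_form" where
  "line_form \<alpha> \<beta> \<gamma> = (\<lambda>z. (\<gamma> - \<beta> * snd z, \<alpha> + \<beta> * fst z))"

lemma has_partials_of_fst:
  "(h has_field_derivative h') (at (fst z)) \<Longrightarrow> has_partials (\<lambda>z. h (fst z)) h' 0 z"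
  using has_partials_compose[OF has_partials_fst] by fastforce

lemmas has_partials_intros = has_partials_const has_partials_of_fst has_partials_fst has_partials_snd
  has_partials_add has_partials_minus has_partials_diff has_partials_mult has_partials_divide

lemma has_partials_root_form:
  assumes "(e has_field_derivative e') (at (fst z))" "(n has_field_derivative n') (at (fst z))"
  shows "has_partials (\<lambda>z. fst (root_form e n z)) (- \<i> * n' * snd z) (- \<i> * n (fst z)) z"
    and "has_partials (\<lambda>z. snd (root_form e n z)) (e' + \<i> * n' * fst z + \<i> * n (fst z)) 0 z"
  unfolding root_form_def fst_conv snd_conv
  by ((rule has_partials_eq, (rule has_partials_intros assms)+; simp add: algebra_simps)+)

lemma has_partials_line_form:
  shows "has_partials (\<lambda>z. fst (line_form \<alpha> \<beta> \<gamma> z)) 0 (- \<beta>) z"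
    and "has_partials (\<lambda>z. snd (line_form \<alpha> \<beta> \<gamma> z)) \<beta> 0 z"
  unfolding line_form_def fst_conv snd_conv
  by ((rule has_partials_eq, (rule has_partials_intros)+; simp)+)

text \<open>
  The web is invariant under \<open>q \<mapsto> s q\<close>, hence \<open>\<eta>\<close> has the form \<open>u(p) dp + v(p) dq / q\<close>; solving the linear
  equations for \<open>u\<close> and \<open>v\<close> leads to \<open>\<sigma>\<close>.
\<close>

lemma connection_line_origin:
  assumes "\<And>p. p \<in> S \<Longrightarrow> (e has_field_derivative e p * es p) (at p)"
    and "\<And>p. p \<in> S \<Longrightarrow> (n has_field_derivative n p * ns p) (at p)"
    and "\<And>p. p \<in> S \<Longrightarrow> \<beta>\<^sup>2 * (e p)\<^sup>2 + \<alpha>\<^sup>2 * (n p)\<^sup>2 \<noteq> 0"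
    and \<sigma>: "\<And>p. p \<in> S \<Longrightarrow> \<sigma> p * (\<beta>\<^sup>2 * (e p)\<^sup>2 + \<alpha>\<^sup>2 * (n p)\<^sup>2) =
       (es p - ns p) * (\<alpha> * p * (n p)\<^sup>2 + \<beta> * (e p)\<^sup>2)"
    and hol: "\<And>p. p \<in> S \<Longrightarrow> es field_differentiable at p" "\<And>p. p \<in> S \<Longrightarrow> ns field_differentiable at p"
       "\<And>p. p \<in> S \<Longrightarrow> \<sigma> field_differentiable at p"
  shows "web_connection (S \<times> (- {0})) (line_form \<alpha> \<beta> 0) (root_form e n) (root_form e (\<lambda>p. - n p))
    (\<lambda>z. (es (fst z) + ns (fst z) + \<beta> * \<sigma> (fst z), (3 - (\<alpha> + \<beta> * fst z) * \<sigma> (fst z)) / snd z))"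
    (is "web_connection ?U ?l ?r ?s ?\<eta>")
proof -
  have "holomorphic_form_on ?\<eta> ?U"
    unfolding holomorphic_form_on_def holomorphic2_on_iff fst_conv snd_conv
  proof (intro conjI ballI)
    fix z :: "complex \<times> complex" assume z: "z \<in> ?U"
    then have "fst z \<in> S" "snd z \<noteq> 0" by auto
    then obtain es' ns' \<sigma>' where d: "(es has_field_derivative es') (at (fst z))"
      "(ns has_field_derivative ns') (at (fst z))" "(\<sigma> has_field_derivative \<sigma>') (at (fst z))"
      using hol unfolding field_differentiable_def by blast
    show "\<exists>a b. has_partials (\<lambda>z. es (fst z) + ns (fst z) + \<beta> * \<sigma> (fst z)) a b z"
      by (intro exI) (rule has_partials_intros d)+
    show "\<exists>a b. has_partials (\<lambda>z. (3 - (\<alpha> + \<beta> * fst z) * \<sigma> (fst z)) / snd z) a b z"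
      by (intro exI) (rule has_partials_intros d \<open>snd z \<noteq> 0\<close>)+
  qed
  moreover have "ext_deriv (scale_form (wedge ?r ?s) ?l) z = wedge ?\<eta> (scale_form (wedge ?r ?s) ?l) z
    \<and> ext_deriv (scale_form (wedge ?s ?l) ?r) z = wedge ?\<eta> (scale_form (wedge ?s ?l) ?r) z
    \<and> ext_deriv (scale_form (wedge ?l ?r) ?s) z = wedge ?\<eta> (scale_form (wedge ?l ?r) ?s) z"
    if z: "z \<in> ?U" for z
  proof -
    obtain p q where pq: "z = (p, q)" "p \<in> S" "q \<noteq> 0" using z by auto
    have e: "(e has_field_derivative e p * es p) (at (fst z))"
      and n: "(n has_field_derivative n p * ns p) (at (fst z))"
      and n2: "((\<lambda>p. - n p) has_field_derivative - (n p * ns p)) (at (fst z))"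
      using assms(1,2)[OF pq(2)] by (auto simp: pq intro!: derivative_eq_intros)
    note L = has_partials_line_form[of \<alpha> \<beta> 0 z]
    note R = has_partials_root_form[OF e n]
    note S = has_partials_root_form[OF e n2]
    \<comment> \<open>\<open>algebra\<close> is to see polynomial relations only: the quotient
      becomes a name \<open>t\<close> with its equation, and the imaginary unit becomes a variable
      \<open>j\<close> with \<open>j * j = -1\<close>.\<close>
    define t where "t = (3 - (\<alpha> + \<beta> * p) * \<sigma> p) / q"
    have t: "t * q = 3 - (\<alpha> + \<beta> * p) * \<sigma> p" using pq(3) by (simp add: t_def)
    have ii: "\<i> * \<i> = -1" by simp
    define j where "j = \<i>"
    note j = ii[folded j_def]
    note s = \<sigma>[OF pq(2)]
    have "\<beta>\<^sup>2 * (e p)\<^sup>2 + \<alpha>\<^sup>2 * (n p)\<^sup>2 = (\<beta> * e p - j * n p * \<alpha>) * (\<beta> * e p + j * n p * \<alpha>)"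
      using j by algebra
    then have nz: "\<beta> * e p - j * n p * \<alpha> \<noteq> 0" "\<beta> * e p + j * n p * \<alpha> \<noteq> 0"
      using assms(3)[OF pq(2)] by auto
    show ?thesis
      unfolding ext_deriv_scale_wedge[OF L R S] ext_deriv_scale_wedge[OF R S L]
        ext_deriv_scale_wedge[OF S L R]
      unfolding wedge_def scale_form_def pq(1) fst_conv snd_conv t_def[symmetric]
      unfolding line_form_def root_form_def fst_conv snd_conv j_def[symmetric]
    proof (intro conjI, goal_cases)
      \<comment> \<open>The function \<sigma> enters \<eta> only through
        \<open>- \<sigma> / q\<close> times the line form. The equation for the line form therefore
        holds whatever \<sigma> is, while the other two amount to the relation
        \<open>s\<close>.\<close>
      case 1
      show ?case using t j by algebra
    next
      case 2
      show ?case by (rule mult_left_cancel[OF nz(1), THEN iffD1]) (use t j s in algebra)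
    next
      case 3
      show ?case by (rule mult_left_cancel[OF nz(2), THEN iffD1]) (use t j s in algebra)
    qed
  qed
  ultimately show ?thesis unfolding web_connection_def Let_def by blast
qed

text \<open>The \<open>dp\<close> coefficient is the logarithmic derivative of
  \<open>e\<^sup>2 + p\<^sup>2 * n\<^sup>2\<close>, the coefficient of \<open>x\<^sup>2\<close> in
  the 2-web. So \<eta> is the logarithmic differential of
  \<open>q * (e\<^sup>2 + p\<^sup>2 * n\<^sup>2)\<close>.\<close>

lemma connection_line_infinity:
  assumes "\<And>p. p \<in> S \<Longrightarrow> (e has_field_derivative e p * es p) (at p)"
    and "\<And>p. p \<in> S \<Longrightarrow> (n has_field_derivative n p * ns p) (at p)"
    and G: "\<And>p. p \<in> S \<Longrightarrow> (e p)\<^sup>2 + p\<^sup>2 * (n p)\<^sup>2 \<noteq> 0"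
    and hol: "\<And>p. p \<in> S \<Longrightarrow> es field_differentiable at p" "\<And>p. p \<in> S \<Longrightarrow> ns field_differentiable at p"
  shows "web_connection (S \<times> (- {0})) (line_form 0 0 \<gamma>) (root_form e n) (root_form e (\<lambda>p. - n p))
    (\<lambda>z. (2 * ((e (fst z))\<^sup>2 * es (fst z) + fst z * (n (fst z))\<^sup>2 * (1 + fst z * ns (fst z))) /
       ((e (fst z))\<^sup>2 + (fst z)\<^sup>2 * (n (fst z))\<^sup>2), 1 / snd z))"
    (is "web_connection ?U ?l ?r ?s ?\<eta>")
proof -
  have "holomorphic_form_on ?\<eta> ?U"
    unfolding holomorphic_form_on_def holomorphic2_on_iff fst_conv snd_conv power2_eq_square
  proof (intro conjI ballI)
    fix z :: "complex \<times> complex" assume z: "z \<in> ?U"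
    then have zS: "fst z \<in> S" "snd z \<noteq> 0" by auto
    then obtain es' ns' where d: "(es has_field_derivative es') (at (fst z))"
      "(ns has_field_derivative ns') (at (fst z))"
      using hol unfolding field_differentiable_def by blast
    note d = d assms(1,2)[OF zS(1)] zS(2) G[OF zS(1), unfolded power2_eq_square]
    show "\<exists>a b. has_partials (\<lambda>z. 2 * (e (fst z) * e (fst z) * es (fst z) +
        fst z * (n (fst z) * n (fst z)) * (1 + fst z * ns (fst z))) /
       (e (fst z) * e (fst z) + fst z * fst z * (n (fst z) * n (fst z)))) a b z"
      by (intro exI) (rule has_partials_intros d)+
    show "\<exists>a b. has_partials (\<lambda>z. 1 / snd z) a b z"
      by (intro exI) (rule has_partials_intros d)+
  qed
  moreover have "ext_deriv (scale_form (wedge ?r ?s) ?l) z = wedge ?\<eta> (scale_form (wedge ?r ?s) ?l) z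
    \<and> ext_deriv (scale_form (wedge ?s ?l) ?r) z = wedge ?\<eta> (scale_form (wedge ?s ?l) ?r) z
    \<and> ext_deriv (scale_form (wedge ?l ?r) ?s) z = wedge ?\<eta> (scale_form (wedge ?l ?r) ?s) z"
    if z: "z \<in> ?U" for z
  proof -
    obtain p q where pq: "z = (p, q)" "p \<in> S" "q \<noteq> 0" using z by auto
    have e: "(e has_field_derivative e p * es p) (at (fst z))"
      and n: "(n has_field_derivative n p * ns p) (at (fst z))"
      and n2: "((\<lambda>p. - n p) has_field_derivative - (n p * ns p)) (at (fst z))"
      using assms(1,2)[OF pq(2)] by (auto simp: pq intro!: derivative_eq_intros)
    note L = has_partials_line_form[of 0 0 \<gamma> z]
    note R = has_partials_root_form[OF e n]
    note S = has_partials_root_form[OF e n2]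
    define t where "t = 1 / q"
    have t: "t * q = 1" using pq(3) by (simp add: t_def)
    define g where "g = 2 * ((e p)\<^sup>2 * es p + p * (n p)\<^sup>2 * (1 + p * ns p)) / ((e p)\<^sup>2 + p\<^sup>2 * (n p)\<^sup>2)"
    have g: "g * ((e p)\<^sup>2 + p\<^sup>2 * (n p)\<^sup>2) = 2 * ((e p)\<^sup>2 * es p + p * (n p)\<^sup>2 * (1 + p * ns p))"
      using G[OF pq(2)] by (simp add: g_def)
    have ii: "\<i> * \<i> = -1" by simp
    define j where "j = \<i>"
    note j = ii[folded j_def]
    show ?thesis
      unfolding ext_deriv_scale_wedge[OF L R S] ext_deriv_scale_wedge[OF R S L]
        ext_deriv_scale_wedge[OF S L R]
      unfolding wedge_def scale_form_def pq(1) fst_conv snd_conv t_def[symmetric] g_def[symmetric]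
      unfolding line_form_def root_form_def fst_conv snd_conv j_def[symmetric]
    proof (intro conjI, goal_cases)
      case 1
      show ?case using t j by algebra
    next
      case 2
      show ?case using t j g by algebra
    next
      case 3
      show ?case using t j g by algebra
    qed
  qed
  ultimately show ?thesis unfolding web_connection_def Let_def by blast
qed

section \<open>Legendre transforms of the diagonal homogeneous foliations\<close>

definition diag_form :: "complex \<Rightarrow> complex \<Rightarrow> complex \<Rightarrow> complex \<Rightarrow> complex ^ 3 \<Rightarrow> complex ^ 3" where
  "diag_form a b c d = affine_form (\<lambda>x y. a * x\<^sup>2 + b * y\<^sup>2) (\<lambda>x y. c * x\<^sup>2 + d * y\<^sup>2)"

lemma Leg_diag_form:
  "Leg (line \<alpha> \<beta> \<gamma>, diag_form a b c d) (p, q) x =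
    (\<alpha> * x + \<beta> * (p * x - q) + \<gamma>) * ((a + c * p) * x\<^sup>2 + (b + d * p) * (p * x - q)\<^sup>2)"
  by (simp add: Leg_def superposition_def Leg_line_def Leg_foliation_def Let_def line_def diag_form_def
      affine_form_def algebra_simps)

lemma Leg_diag_form_product:
  assumes "(e p)\<^sup>2 = a + c * p" "(n p)\<^sup>2 = b + d * p"
  shows "Leg (line \<alpha> \<beta> \<gamma>, diag_form a b c d) (p, q) x = 1 *
     form_at (line_form \<alpha> \<beta> \<gamma>) (p, q) x *
     form_at (root_form e n) (p, q) x *
     form_at (root_form e (\<lambda>p. - n p)) (p, q) x"
proof -
  have ii: "\<i> * \<i> = -1" by simp
  define j where "j = \<i>"
  note j = ii[folded j_def]
  show ?thesis
    unfolding Leg_diag_form assms[symmetric] line_form_def root_form_def fst_conv snd_conv j_def[symmetric]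
    using j by algebra
qed

lemma wedge_root_line:
  "wedge (root_form e n) (root_form e (\<lambda>p. - n p)) (p, q) = - 2 * \<i> * n p * e p * q"
  "wedge (line_form \<alpha> \<beta> \<gamma>) (root_form e n) (p, q) =
     \<gamma> * (e p + \<i> * n p * p) - q * (\<beta> * e p - \<i> * n p * \<alpha>)"
  "wedge (root_form e n) (line_form \<alpha> \<beta> \<gamma>) (p, q) =
     - \<gamma> * (e p + \<i> * n p * p) + q * (\<beta> * e p - \<i> * n p * \<alpha>)"
  by (simp_all add: wedge_def root_form_def line_form_def algebra_simps)

text \<open>Any transverse decomposition makes the discriminant of the cubic at the point nonzero.
  For the explicit splitting the discriminant is a product of wedges, from which the four conditions
  are read off. Only one point is involved, so the discontinuous \<open>csqrt\<close> serves as a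
  root.\<close>

lemma regular_point_diag:
  assumes "web_decomposition (Leg (line \<alpha> \<beta> \<gamma>, diag_form a b c d)) U \<omega>1 \<omega>2 \<omega>3" "(p, q) \<in> U"
  shows "q \<noteq> 0" "a + c * p \<noteq> 0" "b + d * p \<noteq> 0"
    "(\<gamma> - q * \<beta>)\<^sup>2 * (a + c * p) + (\<gamma> * p + q * \<alpha>)\<^sup>2 * (b + d * p) \<noteq> 0"
proof -
  define e where "e = (\<lambda>p. csqrt (a + c * p))"
  define n where "n = (\<lambda>p. csqrt (b + d * p))"
  have en: "(e p)\<^sup>2 = a + c * p" "(n p)\<^sup>2 = b + d * p" by (simp_all add: e_def n_def)
  let ?l = "line_form \<alpha> \<beta> \<gamma>" let ?r = "root_form e n" let ?s = "root_form e (\<lambda>p. - n p)" let ?z = "(p, q)"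
  obtain k where k: "k \<noteq> 0" "\<And>x. Leg (line \<alpha> \<beta> \<gamma>, diag_form a b c d) ?z x = k * form_at \<omega>1 ?z x *
      form_at \<omega>2 ?z x * form_at \<omega>3 ?z x"
    using assms unfolding web_decomposition_def by blast
  have tr: "wedge \<omega>1 \<omega>2 ?z \<noteq> 0" "wedge \<omega>2 \<omega>3 ?z \<noteq> 0" "wedge \<omega>3 \<omega>1 ?z \<noteq> 0"
    using assms unfolding web_decomposition_def by auto
  have "form_at ?l ?z x * form_at ?r ?z x * form_at ?s ?z x =
     k * (form_at \<omega>1 ?z x * form_at \<omega>2 ?z x * form_at \<omega>3 ?z x)" for x
    using k(2)[of x] Leg_diag_form_product[where e = e and n = n, OF en, of \<alpha> \<beta> \<gamma> q x] by (simp add: mult.assoc)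
  from product_of_affine_discriminant[OF this]
  have "(wedge ?l ?r ?z * wedge ?r ?s ?z * wedge ?s ?l ?z)\<^sup>2 =
      k ^ 4 * (wedge \<omega>1 \<omega>2 ?z * wedge \<omega>2 \<omega>3 ?z * wedge \<omega>3 \<omega>1 ?z)\<^sup>2"
    unfolding wedge_def .
  then have nz: "wedge ?l ?r ?z \<noteq> 0" "wedge ?r ?s ?z \<noteq> 0" "wedge ?s ?l ?z \<noteq> 0"
    using tr k(1) by auto
  then show "q \<noteq> 0" "a + c * p \<noteq> 0" "b + d * p \<noteq> 0"
    using en by (auto simp: wedge_root_line)
  have ii: "\<i> * \<i> = -1" by simp
  define j where "j = \<i>"
  note j = ii[folded j_def]
  have "wedge ?l ?r ?z * wedge ?s ?l ?z = - ((\<gamma> - q * \<beta>)\<^sup>2 * (e p)\<^sup>2 + (\<gamma> * p + q * \<alpha>)\<^sup>2 * (n p)\<^sup>2)"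
    unfolding wedge_root_line j_def[symmetric] using j by algebra
  with nz show "(\<gamma> - q * \<beta>)\<^sup>2 * (a + c * p) + (\<gamma> * p + q * \<alpha>)\<^sup>2 * (b + d * p) \<noteq> 0"
    unfolding en by (metis mult_eq_0_iff neg_equal_0_iff_equal)
qed

lemma regular_point_diag_origin:
  assumes "web_decomposition (Leg (line \<alpha> \<beta> 0, diag_form a b c d)) U \<omega>1 \<omega>2 \<omega>3" "(p, q) \<in> U"
  shows "\<beta>\<^sup>2 * (a + c * p) + \<alpha>\<^sup>2 * (b + d * p) \<noteq> 0"
proof -
  have "(0 - q * \<beta>)\<^sup>2 * (a + c * p) + (0 * p + q * \<alpha>)\<^sup>2 * (b + d * p)
    = q\<^sup>2 * (\<beta>\<^sup>2 * (a + c * p) + \<alpha>\<^sup>2 * (b + d * p))"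
    by (simp add: power_mult_distrib algebra_simps)
  with regular_point_diag(4)[OF assms] show ?thesis by auto
qed

lemma regular_point_diag_infinity:
  assumes "web_decomposition (Leg (line 0 0 \<gamma>, diag_form a b c d)) U \<omega>1 \<omega>2 \<omega>3" "(p, q) \<in> U"
  shows "\<gamma> \<noteq> 0" "(a + c * p) + p\<^sup>2 * (b + d * p) \<noteq> 0"
proof -
  have "(\<gamma> - q * 0)\<^sup>2 * (a + c * p) + (\<gamma> * p + q * 0)\<^sup>2 * (b + d * p)
    = \<gamma>\<^sup>2 * (a + c * p + p\<^sup>2 * (b + d * p))"
    by (simp add: power_mult_distrib algebra_simps)
  with regular_point_diag(4)[OF assms] show "\<gamma> \<noteq> 0" "a + c * p + p\<^sup>2 * (b + d * p) \<noteq> 0" by auto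
qed

lemma holomorphic_form_on_line_form: "holomorphic_form_on (line_form \<alpha> \<beta> \<gamma>) U"
  unfolding holomorphic_form_on_def holomorphic2_on_iff using has_partials_line_form by blast

lemma holomorphic_form_on_root_form:
  assumes "\<And>p. p \<in> S \<Longrightarrow> (e has_field_derivative e' p) (at p)"
    and "\<And>p. p \<in> S \<Longrightarrow> (n has_field_derivative n' p) (at p)"
  shows "holomorphic_form_on (root_form e n) (S \<times> T)"
  unfolding holomorphic_form_on_def holomorphic2_on_iff
  using has_partials_root_form[OF assms] by (metis mem_Sigma_iff prod.collapse)

text \<open>A disc is contractible, so nonvanishing functions have holomorphic square roots on it.
  Differentiating \<open>(e p)\<^sup>2 = a + c * p\<close> gives the derivative as a multiple of
  \<open>e p\<close>, the shape the connection lemmas ask for.\<close>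

lemma local_square_roots:
  fixes a b c d p0 :: complex
  assumes "open A" "p0 \<in> A" "a + c * p0 \<noteq> 0" "b + d * p0 \<noteq> 0"
  shows "\<exists>\<epsilon> e n. \<epsilon> > 0 \<and> ball p0 \<epsilon> \<subseteq> A \<and>
    (\<forall>p\<in>ball p0 \<epsilon>. a + c * p \<noteq> 0) \<and> (\<forall>p\<in>ball p0 \<epsilon>. b + d * p \<noteq> 0) \<and>
    (\<forall>p\<in>ball p0 \<epsilon>. (e p)\<^sup>2 = a + c * p) \<and> (\<forall>p\<in>ball p0 \<epsilon>. (n p)\<^sup>2 = b + d * p) \<and>
    (\<forall>p\<in>ball p0 \<epsilon>. (e has_field_derivative e p * (c / (2 * (a + c * p)))) (at p)) \<and>
    (\<forall>p\<in>ball p0 \<epsilon>. (n has_field_derivative n p * (d / (2 * (b + d * p)))) (at p))"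
proof -
  have op: "open {p. r + s * p \<noteq> 0}" for r s :: complex
    by (intro open_Collect_neq continuous_intros)
  have "open (A \<inter> {p. a + c * p \<noteq> 0} \<inter> {p. b + d * p \<noteq> 0})" by (intro open_Int assms(1) op[of a c] op[of b d])
  moreover have "p0 \<in> A \<inter> {p. a + c * p \<noteq> 0} \<inter> {p. b + d * p \<noteq> 0}" using assms by auto
  ultimately obtain \<epsilon> where eps: "\<epsilon> > 0" "ball p0 \<epsilon> \<subseteq> A \<inter> {p. a + c * p \<noteq> 0} \<inter> {p. b + d * p \<noteq> 0}"
    by (meson openE)
  have root: "\<exists>e. \<forall>p\<in>ball p0 \<epsilon>. (e p)\<^sup>2 = r + s * p \<and> (e has_field_derivative e p * (s / (2 * (r + s * p)))) (at p)"
    if nz: "\<And>p. p \<in> ball p0 \<epsilon> \<Longrightarrow> r + s * p \<noteq> 0" for r s :: complex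
  proof -
    obtain g where g: "g holomorphic_on ball p0 \<epsilon>" "\<And>z. z \<in> ball p0 \<epsilon> \<Longrightarrow> r + s * z = g z ^ 2"
      by (rule contractible_imp_holomorphic_sqrt[of "\<lambda>p. r + s * p" "ball p0 \<epsilon>"])
         (auto intro!: holomorphic_intros convex_imp_contractible nz)
    have "(g has_field_derivative g p * (s / (2 * (r + s * p)))) (at p)" if p: "p \<in> ball p0 \<epsilon>" for p
    proof -
      obtain g' where g': "(g has_field_derivative g') (at p)"
        using g(1) p by (metis holomorphic_on_open open_ball)
      have "((\<lambda>p. r + s * p) has_field_derivative s) (at p)" by (auto intro!: derivative_eq_intros)
      moreover have "((\<lambda>p. r + s * p) has_field_derivative 2 * g p * g') (at p)"
        by (rule DERIV_cong[OF has_field_derivative_transform_within_open[of "\<lambda>p. g p ^ 2" "2 * g p * g'" p "ball p0 \<epsilon>"]])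
           (use g p in \<open>auto intro!: derivative_eq_intros g'\<close>)
      ultimately have "s = 2 * g p * g'" by (rule DERIV_unique)
      moreover have "g p \<noteq> 0" using nz[OF p] g(2)[OF p] by auto
      ultimately have "g' = g p * (s / (2 * (r + s * p)))"
        unfolding g(2)[OF p] by (simp add: power2_eq_square)
      with g' show ?thesis by simp
    qed
    with g(2) show ?thesis by (intro exI[of _ g]) simp
  qed
  have "\<And>p. p \<in> ball p0 \<epsilon> \<Longrightarrow> a + c * p \<noteq> 0" "\<And>p. p \<in> ball p0 \<epsilon> \<Longrightarrow> b + d * p \<noteq> 0" using eps(2) by auto
  note nz = this
  obtain e n where "\<forall>p\<in>ball p0 \<epsilon>. (e p)\<^sup>2 = a + c * p \<and> (e has_field_derivative e p * (c / (2 * (a + c * p)))) (at p)"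
    "\<forall>p\<in>ball p0 \<epsilon>. (n p)\<^sup>2 = b + d * p \<and> (n has_field_derivative n p * (d / (2 * (b + d * p)))) (at p)"
    using root[of a c, OF nz(1)] root[of b d, OF nz(2)] by blast
  then show ?thesis using eps nz by (intro exI[of _ \<epsilon>] exI[of _ e] exI[of _ n]) auto
qed

lemma web_decomposition_diag:
  assumes "\<And>p. p \<in> S \<Longrightarrow> (e p)\<^sup>2 = a + c * p" "\<And>p. p \<in> S \<Longrightarrow> (n p)\<^sup>2 = b + d * p"
    and de: "\<And>p. p \<in> S \<Longrightarrow> (e has_field_derivative e' p) (at p)"
    and dn: "\<And>p. p \<in> S \<Longrightarrow> (n has_field_derivative n' p) (at p)"
    and nz: "\<And>p q. p \<in> S \<Longrightarrow> q \<noteq> 0 \<Longrightarrow> a + c * p \<noteq> 0 \<and> b + d * p \<noteq> 0 \<and>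
      (\<gamma> - q * \<beta>)\<^sup>2 * (a + c * p) + (\<gamma> * p + q * \<alpha>)\<^sup>2 * (b + d * p) \<noteq> 0"
  shows "web_decomposition (Leg (line \<alpha> \<beta> \<gamma>, diag_form a b c d)) (S \<times> - {0})
    (line_form \<alpha> \<beta> \<gamma>) (root_form e n) (root_form e (\<lambda>p. - n p))"
  unfolding web_decomposition_def
proof (intro conjI ballI)
  have dn': "((\<lambda>p. - n p) has_field_derivative - n' p) (at p)" if "p \<in> S" for p
    using dn[OF that] by (rule DERIV_minus)
  show "holomorphic_form_on (line_form \<alpha> \<beta> \<gamma>) (S \<times> - {0})" by (rule holomorphic_form_on_line_form)
  show "holomorphic_form_on (root_form e n) (S \<times> - {0})"
    by (rule holomorphic_form_on_root_form[OF de dn])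
  show "holomorphic_form_on (root_form e (\<lambda>p. - n p)) (S \<times> - {0})"
    by (rule holomorphic_form_on_root_form[OF de dn'])
  fix z :: "complex \<times> complex" assume "z \<in> S \<times> - {0}"
  then obtain p q where z: "z = (p, q)" "p \<in> S" "q \<noteq> 0" by auto
  note en = assms(1,2)[OF z(2)]
  have ii: "\<i> * \<i> = -1" by simp
  define j where "j = \<i>"
  note j = ii[folded j_def]
  note N = nz[OF z(2,3), folded en]
  then have "e p \<noteq> 0" "n p \<noteq> 0" by auto
  then show "wedge (root_form e n) (root_form e (\<lambda>p. - n p)) z \<noteq> 0"
    using z by (simp add: wedge_root_line)
  have "wedge (line_form \<alpha> \<beta> \<gamma>) (root_form e n) z * wedge (root_form e (\<lambda>p. - n p)) (line_form \<alpha> \<beta> \<gamma>) z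
    = - ((\<gamma> - q * \<beta>)\<^sup>2 * (e p)\<^sup>2 + (\<gamma> * p + q * \<alpha>)\<^sup>2 * (n p)\<^sup>2)"
    unfolding wedge_root_line z j_def[symmetric] using j by algebra
  with N have "wedge (line_form \<alpha> \<beta> \<gamma>) (root_form e n) z * wedge (root_form e (\<lambda>p. - n p)) (line_form \<alpha> \<beta> \<gamma>) z \<noteq> 0"
    by (metis neg_equal_0_iff_equal)
  then show "wedge (line_form \<alpha> \<beta> \<gamma>) (root_form e n) z \<noteq> 0"
    "wedge (root_form e (\<lambda>p. - n p)) (line_form \<alpha> \<beta> \<gamma>) z \<noteq> 0" by auto
  show "\<exists>k. k \<noteq> 0 \<and> (\<forall>x. Leg (line \<alpha> \<beta> \<gamma>, diag_form a b c d) z x = k *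
     form_at (line_form \<alpha> \<beta> \<gamma>) z x *
     form_at (root_form e n) z x *
     form_at (root_form e (\<lambda>p. - n p)) z x)"
    unfolding z by (rule exI[of _ 1], rule conjI, simp)
      (rule allI, rule Leg_diag_form_product[where e = e and n = n, OF en])
qed

lemma flat_diag_line_infinity: "flat_web (Leg (line 0 0 \<gamma>, diag_form a b c d))"
  unfolding flat_web_def
proof (intro allI impI ballI)
  fix U \<omega>1 \<omega>2 \<omega>3 \<eta> z
  assume "open U \<and> web_decomposition (Leg (line 0 0 \<gamma>, diag_form a b c d)) U \<omega>1 \<omega>2 \<omega>3 \<and> web_connection U \<omega>1 \<omega>2 \<omega>3 \<eta>"
    and z: "z \<in> U"
  then have U: "open U" and dec: "web_decomposition (Leg (line 0 0 \<gamma>, diag_form a b c d)) U \<omega>1 \<omega>2 \<omega>3"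
    and con: "web_connection U \<omega>1 \<omega>2 \<omega>3 \<eta>" by auto
  obtain p0 q0 where pq: "z = (p0, q0)" by (cases z)
  note z' = z[unfolded pq]
  note reg = regular_point_diag(1-3)[OF dec z'] regular_point_diag_infinity[OF dec z']
  let ?A = "{p. a + c * p + p\<^sup>2 * (b + d * p) \<noteq> 0}"
  have A: "open ?A" "p0 \<in> ?A" using reg by (auto intro!: open_Collect_neq continuous_intros)
  obtain \<epsilon> e n where roots: "\<epsilon> > 0" "ball p0 \<epsilon> \<subseteq> ?A"
    "\<forall>p\<in>ball p0 \<epsilon>. a + c * p \<noteq> 0" "\<forall>p\<in>ball p0 \<epsilon>. b + d * p \<noteq> 0"
    "\<forall>p\<in>ball p0 \<epsilon>. (e p)\<^sup>2 = a + c * p" "\<forall>p\<in>ball p0 \<epsilon>. (n p)\<^sup>2 = b + d * p"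
    "\<forall>p\<in>ball p0 \<epsilon>. (e has_field_derivative e p * (c / (2 * (a + c * p)))) (at p)"
    "\<forall>p\<in>ball p0 \<epsilon>. (n has_field_derivative n p * (d / (2 * (b + d * p)))) (at p)"
    using local_square_roots[OF A reg(2,3)] by blast
  note eps = roots(1,2) roots(3-8)[rule_format]
  let ?S = "ball p0 \<epsilon>"
  have dec': "web_decomposition (Leg (line 0 0 \<gamma>, diag_form a b c d)) (?S \<times> - {0})
      (line_form 0 0 \<gamma>) (root_form e n) (root_form e (\<lambda>p. - n p))"
  proof (rule web_decomposition_diag[OF eps(5-8)])
    fix p q :: complex assume p: "p \<in> ?S"
    then have "a + c * p + p\<^sup>2 * (b + d * p) \<noteq> 0" using eps(2) by auto
    then have "\<gamma>\<^sup>2 * (a + c * p + p\<^sup>2 * (b + d * p)) \<noteq> 0" using reg(4) by simp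
    then show "a + c * p \<noteq> 0 \<and> b + d * p \<noteq> 0 \<and>
        (\<gamma> - q * 0)\<^sup>2 * (a + c * p) + (\<gamma> * p + q * 0)\<^sup>2 * (b + d * p) \<noteq> 0"
      using eps(3,4)[OF p] by (simp add: power_mult_distrib algebra_simps)
  qed
  define es where "es = (\<lambda>p. c / (2 * (a + c * p)))"
  define ns where "ns = (\<lambda>p. d / (2 * (b + d * p)))"
  define h where "h = (\<lambda>p. 2 * ((e p)\<^sup>2 * es p + p * (n p)\<^sup>2 * (1 + p * ns p)) / ((e p)\<^sup>2 + p\<^sup>2 * (n p)\<^sup>2))"
  have con': "web_connection (?S \<times> - {0}) (line_form 0 0 \<gamma>) (root_form e n) (root_form e (\<lambda>p. - n p))
      (\<lambda>z. (h (fst z), 1 / snd z))"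
    unfolding h_def
  proof (rule connection_line_infinity)
    fix p assume p: "p \<in> ?S"
    show "(e has_field_derivative e p * es p) (at p)" "(n has_field_derivative n p * ns p) (at p)"
      using eps(7,8)[OF p] by (simp_all add: es_def ns_def)
    show "(e p)\<^sup>2 + p\<^sup>2 * (n p)\<^sup>2 \<noteq> 0" using eps(2) p by (auto simp: eps(5,6)[OF p])
    show "es field_differentiable at p" "ns field_differentiable at p"
      unfolding es_def ns_def using eps(3,4)[OF p] by (auto intro!: derivative_intros simp del: distrib_left_numeral)
  qed
  let ?U = "U \<inter> ?S \<times> - {0}"
  have oU: "open ?U" using U by (intro open_Int open_Times) auto
  have zU: "z \<in> ?U" using z pq reg eps(1) by auto
  have "ext_deriv \<eta> z = ext_deriv (\<lambda>z. (h (fst z), 1 / snd z)) z"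
    by (rule ext_deriv_connection_unique[OF web_decomposition_subset[OF dec] web_decomposition_subset[OF dec'] oU zU
          web_connection_subset[OF con] web_connection_subset[OF con']]) auto
  \<comment> \<open>The \<open>dp\<close> coefficient depends on the first variable only and the
    \<open>dq\<close> coefficient on the second only.\<close>
  also have "\<dots> = 0"
    unfolding pq ext_deriv_def by simp
  finally show "ext_deriv \<eta> z = 0" .
qed

text \<open>Numerator and denominator of \<open>(\<alpha> + \<beta> * p) * \<sigma> p\<close>, with
  the constant \<open>(c * b - a * d) / 2\<close> left out. The zeros of the denominator are those
  of \<open>E\<close>, of \<open>N\<close>, and of
  \<open>\<beta>\<^sup>2 * E + \<alpha>\<^sup>2 * N\<close>, where the line is tangent to one of the
  other two foliations.\<close>

abbreviation flatness_num :: "complex \<Rightarrow> complex \<Rightarrow> complex \<Rightarrow> complex \<Rightarrow> complex \<Rightarrow> complex \<Rightarrow> complex \<Rightarrow> complex" where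
  "flatness_num \<alpha> \<beta> a b c d p \<equiv> (\<alpha> + \<beta> * p) * (\<alpha> * p * (b + d * p) + \<beta> * (a + c * p))"

abbreviation flatness_den :: "complex \<Rightarrow> complex \<Rightarrow> complex \<Rightarrow> complex \<Rightarrow> complex \<Rightarrow> complex \<Rightarrow> complex \<Rightarrow> complex" where
  "flatness_den \<alpha> \<beta> a b c d p \<equiv> (a + c * p) * (b + d * p) * (\<beta>\<^sup>2 * (a + c * p) + \<alpha>\<^sup>2 * (b + d * p))"

text \<open>The formula for the curvature serves both directions: a constant quotient makes it zero,
  and when \<open>a * d - b * c \<noteq> 0\<close> its vanishing forces \<open>D = 0\<close>. The
  \<open>dp\<close> coefficient of \<eta> does not depend on \<open>q\<close>, so only the
  derivative of the \<open>dq\<close> coefficient remains.\<close>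

lemma diag_line_origin_local:
  assumes "open A" "p0 \<in> A" "a + c * p0 \<noteq> 0" "b + d * p0 \<noteq> 0" "\<beta>\<^sup>2 * (a + c * p0) + \<alpha>\<^sup>2 * (b + d * p0) \<noteq> 0"
  shows "\<exists>\<epsilon> \<omega>1 \<omega>2 \<omega>3 \<eta>. \<epsilon> > 0 \<and> ball p0 \<epsilon> \<subseteq> A \<and>
    (\<forall>p\<in>ball p0 \<epsilon>. flatness_den \<alpha> \<beta> a b c d p \<noteq> 0) \<and>
    web_decomposition (Leg (line \<alpha> \<beta> 0, diag_form a b c d)) (ball p0 \<epsilon> \<times> - {0}) \<omega>1 \<omega>2 \<omega>3 \<and>
    web_connection (ball p0 \<epsilon> \<times> - {0}) \<omega>1 \<omega>2 \<omega>3 \<eta> \<and>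
    (\<forall>p\<in>ball p0 \<epsilon>. \<forall>q D. q \<noteq> 0 \<longrightarrow>
      ((\<lambda>p. flatness_num \<alpha> \<beta> a b c d p / flatness_den \<alpha> \<beta> a b c d p) has_field_derivative D) (at p) \<longrightarrow>
      ext_deriv \<eta> (p, q) = - (c * b - a * d) / 2 * D / q)"
proof -
  let ?V = "\<lambda>p. \<beta>\<^sup>2 * (a + c * p) + \<alpha>\<^sup>2 * (b + d * p)"
  let ?A = "A \<inter> {p. ?V p \<noteq> 0}"
  have A: "open ?A" "p0 \<in> ?A" using assms by (auto intro!: open_Int open_Collect_neq continuous_intros)
  obtain \<epsilon> e n where roots: "\<epsilon> > 0" "ball p0 \<epsilon> \<subseteq> ?A"
    "\<forall>p\<in>ball p0 \<epsilon>. a + c * p \<noteq> 0" "\<forall>p\<in>ball p0 \<epsilon>. b + d * p \<noteq> 0"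
    "\<forall>p\<in>ball p0 \<epsilon>. (e p)\<^sup>2 = a + c * p" "\<forall>p\<in>ball p0 \<epsilon>. (n p)\<^sup>2 = b + d * p"
    "\<forall>p\<in>ball p0 \<epsilon>. (e has_field_derivative e p * (c / (2 * (a + c * p)))) (at p)"
    "\<forall>p\<in>ball p0 \<epsilon>. (n has_field_derivative n p * (d / (2 * (b + d * p)))) (at p)"
    using local_square_roots[OF A assms(3,4)] by blast
  note eps = roots(1,2) roots(3-8)[rule_format]
  let ?S = "ball p0 \<epsilon>"
  have V: "?V p \<noteq> 0" if "p \<in> ?S" for p using eps(2) that by auto
  have dec': "web_decomposition (Leg (line \<alpha> \<beta> 0, diag_form a b c d)) (?S \<times> - {0})
      (line_form \<alpha> \<beta> 0) (root_form e n) (root_form e (\<lambda>p. - n p))"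
  proof (rule web_decomposition_diag[OF eps(5-8)])
    fix p q :: complex assume p: "p \<in> ?S" and q: "q \<noteq> 0"
    have "(0 - q * \<beta>)\<^sup>2 * (a + c * p) + (0 * p + q * \<alpha>)\<^sup>2 * (b + d * p) = q\<^sup>2 * ?V p"
      by (simp add: power_mult_distrib algebra_simps)
    then show "a + c * p \<noteq> 0 \<and> b + d * p \<noteq> 0 \<and>
        (0 - q * \<beta>)\<^sup>2 * (a + c * p) + (0 * p + q * \<alpha>)\<^sup>2 * (b + d * p) \<noteq> 0"
      using eps(3,4)[OF p] V[OF p] q by simp
  qed
  define es where "es = (\<lambda>p. c / (2 * (a + c * p)))"
  define ns where "ns = (\<lambda>p. d / (2 * (b + d * p)))"
  define R where "R = (\<lambda>p. (\<alpha> * p * (b + d * p) + \<beta> * (a + c * p)) / ((a + c * p) * (b + d * p) * ?V p))"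
  define \<sigma> where "\<sigma> = (\<lambda>p. (c * b - a * d) / 2 * R p)"
  define \<eta> where "\<eta> = (\<lambda>z. (es (fst z) + ns (fst z) + \<beta> * \<sigma> (fst z), (3 - (\<alpha> + \<beta> * fst z) * \<sigma> (fst z)) / snd z))"
  have con': "web_connection (?S \<times> - {0}) (line_form \<alpha> \<beta> 0) (root_form e n) (root_form e (\<lambda>p. - n p)) \<eta>"
    unfolding \<eta>_def
  proof (rule connection_line_origin)
    fix p assume p: "p \<in> ?S"
    show "(e has_field_derivative e p * es p) (at p)" "(n has_field_derivative n p * ns p) (at p)"
      using eps(7,8)[OF p] by (simp_all add: es_def ns_def)
    show "\<beta>\<^sup>2 * (e p)\<^sup>2 + \<alpha>\<^sup>2 * (n p)\<^sup>2 \<noteq> 0" using V[OF p] by (simp add: eps(5,6)[OF p])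
    have nz: "a + c * p \<noteq> 0" "b + d * p \<noteq> 0" "?V p \<noteq> 0" using p eps(3,4) V by auto
    \<comment> \<open>The terms in \<open>p\<close> cancel in \<open>c * N - d * E\<close>, which
      leaves a constant numerator.\<close>
    have "es p - ns p = (c * b - a * d) / (2 * ((a + c * p) * (b + d * p)))"
    proof -
      have "c / (2 * E) - d / (2 * N) = (c * N - d * E) / (2 * (E * N))" if "E \<noteq> 0" "N \<noteq> 0" for E N
        using that by (simp add: divide_simps)
      moreover have "c * (b + d * p) - d * (a + c * p) = c * b - a * d" by algebra
      ultimately show ?thesis using nz(1,2) unfolding es_def ns_def by metis
    qed
    then show "\<sigma> p * (\<beta>\<^sup>2 * (e p)\<^sup>2 + \<alpha>\<^sup>2 * (n p)\<^sup>2) =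
       (es p - ns p) * (\<alpha> * p * (n p)\<^sup>2 + \<beta> * (e p)\<^sup>2)"
      unfolding eps(5,6)[OF p] \<sigma>_def R_def using nz by simp
    show "es field_differentiable at p" "ns field_differentiable at p" "\<sigma> field_differentiable at p"
      unfolding es_def ns_def \<sigma>_def R_def using nz by (auto intro!: derivative_intros simp del: distrib_left_numeral)
  qed
  show ?thesis
  proof (rule exI[of _ \<epsilon>], rule exI[of _ "line_form \<alpha> \<beta> 0"], rule exI[of _ "root_form e n"],
      rule exI[of _ "root_form e (\<lambda>p. - n p)"], rule exI[of _ \<eta>], intro conjI ballI allI impI, rule eps(1), goal_cases)
    case 1 show ?case using eps(2) by auto
  next
    case (2 p)
    then show ?case using eps(3,4) V by simp
  next
    case 3 show ?case by (rule dec')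
  next
    case 4 show ?case by (rule con')
  next
    case (5 p q D)
    have e: "(\<alpha> + \<beta> * p) * \<sigma> p = (c * b - a * d) / 2 * (flatness_num \<alpha> \<beta> a b c d p / ((a + c * p) * (b + d * p) * ?V p))" for p
      unfolding \<sigma>_def R_def by simp
    have "((\<lambda>p. (3 - (\<alpha> + \<beta> * p) * \<sigma> p) / q) has_field_derivative (- (c * b - a * d) / 2 * D / q)) (at p)"
      unfolding e by (rule DERIV_cong[OF DERIV_cdivide[OF DERIV_diff[OF DERIV_const DERIV_cmult[OF 5(3)]]]]) (simp add: left_diff_distrib diff_divide_distrib)
    then show ?case
      unfolding ext_deriv_def \<eta>_def by (simp add: DERIV_imp_deriv)
  qed
qed

lemma flat_diag_line_originI:
  assumes k: "\<And>p. flatness_num \<alpha> \<beta> a b c d p = \<kappa> * flatness_den \<alpha> \<beta> a b c d p"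
  shows "flat_web (Leg (line \<alpha> \<beta> 0, diag_form a b c d))"
  unfolding flat_web_def
proof (intro allI impI ballI)
  let ?W = "Leg (line \<alpha> \<beta> 0, diag_form a b c d)"
  fix U \<omega>1 \<omega>2 \<omega>3 \<eta> z
  assume "open U \<and> web_decomposition ?W U \<omega>1 \<omega>2 \<omega>3 \<and> web_connection U \<omega>1 \<omega>2 \<omega>3 \<eta>"
    and z: "z \<in> U"
  then have U: "open U" and dec: "web_decomposition ?W U \<omega>1 \<omega>2 \<omega>3"
    and con: "web_connection U \<omega>1 \<omega>2 \<omega>3 \<eta>" by auto
  obtain p0 q0 where pq: "z = (p0, q0)" by (cases z)
  note z' = z[unfolded pq]
  note reg = regular_point_diag(1-3)[OF dec z'] regular_point_diag_origin[OF dec z']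
  let ?f = "\<lambda>p. flatness_num \<alpha> \<beta> a b c d p / flatness_den \<alpha> \<beta> a b c d p"
  obtain \<epsilon> \<omega>1' \<omega>2' \<omega>3' \<eta>' where L: "\<epsilon> > 0"
    "\<forall>p\<in>ball p0 \<epsilon>. flatness_den \<alpha> \<beta> a b c d p \<noteq> 0"
    "web_decomposition ?W (ball p0 \<epsilon> \<times> - {0}) \<omega>1' \<omega>2' \<omega>3'"
    "web_connection (ball p0 \<epsilon> \<times> - {0}) \<omega>1' \<omega>2' \<omega>3' \<eta>'"
    "\<forall>p\<in>ball p0 \<epsilon>. \<forall>q D. q \<noteq> 0 \<longrightarrow> (?f has_field_derivative D) (at p) \<longrightarrow>
      ext_deriv \<eta>' (p, q) = - (c * b - a * d) / 2 * D / q"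
    using diag_line_origin_local[OF open_UNIV UNIV_I reg(2-4)] by blast
  note L2 = L(2)[rule_format] and L5 = L(5)[rule_format]
  have f: "?f p = \<kappa>" if "p \<in> ball p0 \<epsilon>" for p
    using L2[OF that] unfolding k by simp
  have "(?f has_field_derivative 0) (at p0)"
    by (rule has_field_derivative_transform_within_open[of "\<lambda>_. \<kappa>" 0 p0 "ball p0 \<epsilon>"])
       (rule DERIV_const, rule open_ball, simp add: L(1), rule f[symmetric])
  then have "ext_deriv \<eta>' z = 0" using L5[of p0 q0 0] L(1) reg(1) by (simp add: pq)
  moreover let ?U = "U \<inter> ball p0 \<epsilon> \<times> - {0}"
  have oU: "open ?U" using U by (intro open_Int open_Times) auto
  have zU: "z \<in> ?U" using z pq reg L(1) by auto
  have "ext_deriv \<eta> z = ext_deriv \<eta>' z"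
    by (rule ext_deriv_connection_unique[OF web_decomposition_subset[OF dec] web_decomposition_subset[OF L(3)] oU zU
          web_connection_subset[OF con] web_connection_subset[OF L(4)]]) auto
  ultimately show "ext_deriv \<eta> z = 0" by simp
qed

lemma finite_affine_roots:
  fixes r s :: complex
  assumes "r \<noteq> 0 \<or> s \<noteq> 0"
  shows "finite {p. r + s * p = 0}"
proof (cases "s = 0")
  case False
  then have "{p. r + s * p = 0} \<subseteq> {- r / s}" by (auto simp: add_eq_0_iff divide_simps mult.commute)
  then show ?thesis by (rule finite_subset) simp
qed (use assms in simp)

text \<open>Flatness is applied to the explicit connection over a single disc on which the
  denominator has no zero. The quotient is constant there, and analytic continuation carries the
  polynomial identity to all \<open>p\<close>.\<close>

lemma flat_diag_line_originD:
  assumes flat: "flat_web (Leg (line \<alpha> \<beta> 0, diag_form a b c d))"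
    and det: "a * d - b * c \<noteq> 0" and l: "\<alpha> \<noteq> 0 \<or> \<beta> \<noteq> 0"
  obtains \<kappa> where "\<And>p. flatness_num \<alpha> \<beta> a b c d p = \<kappa> * flatness_den \<alpha> \<beta> a b c d p"
proof -
  let ?W = "Leg (line \<alpha> \<beta> 0, diag_form a b c d)"
  let ?f = "\<lambda>p. flatness_num \<alpha> \<beta> a b c d p / flatness_den \<alpha> \<beta> a b c d p"
  \<comment> \<open>Coprimality makes \<open>E\<close> and \<open>N\<close> linearly independent, so
    \<open>\<beta>\<^sup>2 * E + \<alpha>\<^sup>2 * N\<close> is not the zero polynomial and a point
    off all zeros exists.\<close>
  have "\<beta>\<^sup>2 * a + \<alpha>\<^sup>2 * b \<noteq> 0 \<or> \<beta>\<^sup>2 * c + \<alpha>\<^sup>2 * d \<noteq> 0"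
  proof (rule ccontr)
    assume "\<not> ?thesis"
    then have "\<beta>\<^sup>2 * a + \<alpha>\<^sup>2 * b = 0" "\<beta>\<^sup>2 * c + \<alpha>\<^sup>2 * d = 0" by simp_all
    then have "\<beta>\<^sup>2 * (a * d - b * c) = 0" "\<alpha>\<^sup>2 * (a * d - b * c) = 0" by algebra+
    with det l show False by simp
  qed
  then have "finite {p. (\<beta>\<^sup>2 * a + \<alpha>\<^sup>2 * b) + (\<beta>\<^sup>2 * c + \<alpha>\<^sup>2 * d) * p = 0}"
    by (rule finite_affine_roots)
  moreover have "finite {p. a + c * p = 0}" "finite {p. b + d * p = 0}"
    by (rule finite_affine_roots, use det in auto)+
  ultimately have "finite ({p. (\<beta>\<^sup>2 * a + \<alpha>\<^sup>2 * b) + (\<beta>\<^sup>2 * c + \<alpha>\<^sup>2 * d) * p = 0} \<union> {p. a + c * p = 0} \<union> {p. b + d * p = 0})"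
    (is "finite ?F") by blast
  from ex_new_if_finite[OF infinite_UNIV_char_0 this] obtain p0 where "p0 \<notin> ?F" ..
  then have p0: "a + c * p0 \<noteq> 0" "b + d * p0 \<noteq> 0" "\<beta>\<^sup>2 * (a + c * p0) + \<alpha>\<^sup>2 * (b + d * p0) \<noteq> 0"
    by (simp_all add: algebra_simps)
  obtain \<epsilon> \<omega>1' \<omega>2' \<omega>3' \<eta>' where L: "\<epsilon> > 0"
    "\<forall>p\<in>ball p0 \<epsilon>. flatness_den \<alpha> \<beta> a b c d p \<noteq> 0"
    "web_decomposition ?W (ball p0 \<epsilon> \<times> - {0}) \<omega>1' \<omega>2' \<omega>3'"
    "web_connection (ball p0 \<epsilon> \<times> - {0}) \<omega>1' \<omega>2' \<omega>3' \<eta>'"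
    "\<forall>p\<in>ball p0 \<epsilon>. \<forall>q D. q \<noteq> 0 \<longrightarrow> (?f has_field_derivative D) (at p) \<longrightarrow>
      ext_deriv \<eta>' (p, q) = - (c * b - a * d) / 2 * D / q"
    using diag_line_origin_local[OF open_UNIV UNIV_I p0] by blast
  note L2 = L(2)[rule_format] and L5 = L(5)[rule_format]
  have "\<exists>\<kappa>. \<forall>p\<in>ball p0 \<epsilon>. ?f p = \<kappa>"
  proof (rule has_field_derivative_zero_constant)
    fix p assume p: "p \<in> ball p0 \<epsilon>"
    have "?f field_differentiable at p" using L2[OF p] by (auto intro!: derivative_intros)
    then obtain D where D: "(?f has_field_derivative D) (at p)" unfolding field_differentiable_def by blast
    have "ext_deriv \<eta>' (p, 1) = 0"
    proof -
      have "open (ball p0 \<epsilon> \<times> - {0::complex})" by (intro open_Times) auto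
      with flat L(3,4) have "\<forall>z\<in>ball p0 \<epsilon> \<times> - {0}. ext_deriv \<eta>' z = 0" unfolding flat_web_def by blast
      with p show ?thesis by auto
    qed
    with L5[OF p _ D, of 1] have "(c * b - a * d) * D = 0" by auto
    moreover have "c * b - a * d \<noteq> 0" using det by (simp add: mult.commute)
    ultimately have "D = 0" by simp
    with D show "(?f has_field_derivative 0) (at p within ball p0 \<epsilon>)"
      by (auto intro: has_field_derivative_at_within)
  qed simp
  then obtain \<kappa> where \<kappa>: "\<And>p. p \<in> ball p0 \<epsilon> \<Longrightarrow> ?f p = \<kappa>" by blast
  have "flatness_num \<alpha> \<beta> a b c d p = \<kappa> * flatness_den \<alpha> \<beta> a b c d p" for p
  proof (rule analytic_continuation_open[of "ball p0 \<epsilon>" UNIV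
      "\<lambda>p. flatness_num \<alpha> \<beta> a b c d p"
      "\<lambda>p. \<kappa> * flatness_den \<alpha> \<beta> a b c d p"])
    show "ball p0 \<epsilon> \<noteq> {}" using L(1) by auto
    fix p assume p: "p \<in> ball p0 \<epsilon>"
    show "flatness_num \<alpha> \<beta> a b c d p = \<kappa> * flatness_den \<alpha> \<beta> a b c d p"
      unfolding \<kappa>[OF p, symmetric] using L2[OF p] by simp
  qed (auto intro!: holomorphic_intros)
  with that show thesis by blast
qed

section \<open>Flatness under changes of coordinates\<close>

text \<open>
  \<open>A\<^sub>1 dp + B\<^sub>1 dq\<close> and \<open>A\<^sub>2 dp + B\<^sub>2 dq\<close> are the differentials of the components of the map along
  which the form is pulled back.
\<close>

definition pull_form ::
  "(complex \<times> complex \<Rightarrow> complex) \<Rightarrow> (complex \<times> complex \<Rightarrow> complex) \<Rightarrow>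
   (complex \<times> complex \<Rightarrow> complex) \<Rightarrow> (complex \<times> complex \<Rightarrow> complex) \<Rightarrow>
   (complex \<times> complex \<Rightarrow> complex) \<Rightarrow> (complex \<times> complex \<Rightarrow> complex) \<Rightarrow> one_form \<Rightarrow> one_form" where
  "pull_form f1 f2 A1 B1 A2 B2 \<omega> z =
    (fst (\<omega> (f1 z, f2 z)) * A1 z + snd (\<omega> (f1 z, f2 z)) * A2 z,
     fst (\<omega> (f1 z, f2 z)) * B1 z + snd (\<omega> (f1 z, f2 z)) * B2 z)"

locale coordinate_change =
  fixes U :: "(complex \<times> complex) set" and f1 f2 A1 B1 A2 B2
  assumes open_U: "open U"
    and f1: "z \<in> U \<Longrightarrow> has_partials f1 (A1 z) (B1 z) z"
    and f2: "z \<in> U \<Longrightarrow> has_partials f2 (A2 z) (B2 z) z"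
    and hol: "holomorphic2_on A1 U" "holomorphic2_on B1 U" "holomorphic2_on A2 U" "holomorphic2_on B2 U"
begin

abbreviation "pull \<equiv> pull_form f1 f2 A1 B1 A2 B2"

definition J where "J z = A1 z * B2 z - B1 z * A2 z"

lemma wedge_pull: "wedge (pull \<alpha>) (pull \<beta>) z = J z * wedge \<alpha> \<beta> (f1 z, f2 z)"
  unfolding wedge_def pull_form_def J_def by (simp add: algebra_simps)

text \<open>The exterior derivative commutes with pullback: the second derivatives of
  \<open>f1\<close> and \<open>f2\<close> cancel by symmetry of the mixed partials
  (\<open>m1\<close> and \<open>m2\<close>). \<open>J\<close> is the Jacobian determinant.\<close>

lemma partials_pull:
  assumes \<omega>: "holomorphic_form_on \<omega> V" and z: "z \<in> U" and V: "(f1 z, f2 z) \<in> V"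
  shows "(\<exists>a b. has_partials (\<lambda>z. fst (pull \<omega> z)) a b z) \<and> (\<exists>a b. has_partials (\<lambda>z. snd (pull \<omega> z)) a b z) \<and>
    ext_deriv (pull \<omega>) z = J z * ext_deriv \<omega> (f1 z, f2 z)"
proof -
  obtain a b c d where p: "has_partials (\<lambda>z. fst (\<omega> z)) a b (f1 z, f2 z)"
    "has_partials (\<lambda>z. snd (\<omega> z)) c d (f1 z, f2 z)" and e: "ext_deriv \<omega> (f1 z, f2 z) = c - b"
    using holomorphic_form_onD[OF \<omega> V] .
  note c1 = has_partials_compose2[OF p(1) f1[OF z] f2[OF z]]
  note c2 = has_partials_compose2[OF p(2) f1[OF z] f2[OF z]]
  obtain r1 s1 where A1: "has_partials A1 r1 s1 z" using hol z unfolding holomorphic2_on_iff by blast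
  obtain r2 s2 where B1: "has_partials B1 r2 s2 z" using hol z unfolding holomorphic2_on_iff by blast
  obtain r3 s3 where A2: "has_partials A2 r3 s3 z" using hol z unfolding holomorphic2_on_iff by blast
  obtain r4 s4 where B2: "has_partials B2 r4 s4 z" using hol z unfolding holomorphic2_on_iff by blast
  obtain p q where pq: "z = (p, q)" by (cases z)
  have m1: "s1 = r2"
    by (rule mixed_partials[OF open_U z[unfolded pq] f1 A1[unfolded pq] _ B1[unfolded pq]])
       (use hol in \<open>auto simp: holomorphic2_on_iff\<close>)
  have m2: "s3 = r4"
    by (rule mixed_partials[OF open_U z[unfolded pq] f2 A2[unfolded pq] _ B2[unfolded pq]])
       (use hol in \<open>auto simp: holomorphic2_on_iff\<close>)
  note P1 = has_partials_add[OF has_partials_mult[OF c1 A1] has_partials_mult[OF c2 A2]]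
  note P2 = has_partials_add[OF has_partials_mult[OF c1 B1] has_partials_mult[OF c2 B2]]
  have q1: "(\<lambda>z. fst (pull \<omega> z)) = (\<lambda>z. fst (\<omega> (f1 z, f2 z)) * A1 z + snd (\<omega> (f1 z, f2 z)) * A2 z)"
    and q2: "(\<lambda>z. snd (pull \<omega> z)) = (\<lambda>z. fst (\<omega> (f1 z, f2 z)) * B1 z + snd (\<omega> (f1 z, f2 z)) * B2 z)"
    by (simp_all add: pull_form_def)
  note P = P1[folded q1] P2[folded q2]
  have "ext_deriv (pull \<omega>) z = J z * ext_deriv \<omega> (f1 z, f2 z)"
    unfolding ext_deriv_eq[OF P] e J_def m1 m2 by (simp add: algebra_simps)
  with P show ?thesis by blast
qed

lemma holomorphic_form_on_pull:
  assumes "holomorphic_form_on \<omega> V" "\<And>z. z \<in> U \<Longrightarrow> (f1 z, f2 z) \<in> V"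
  shows "holomorphic_form_on (pull \<omega>) U"
  using partials_pull[OF assms(1) _ assms(2)] unfolding holomorphic_form_on_def holomorphic2_on_iff by blast

text \<open>A wedge of pulled-back forms carries a factor \<open>J\<close>, so every scaled form
  becomes \<open>J\<close> times the pullback of the old one. This adds \<open>dJ / J\<close>, here
  \<theta>, to the pullback of \<eta>.\<close>

lemma connection_pull:
  assumes con: "web_connection V \<omega>1 \<omega>2 \<omega>3 \<eta>" and V: "\<And>z. z \<in> U \<Longrightarrow> (f1 z, f2 z) \<in> V"
    and hol: "holomorphic_form_on \<omega>1 V" "holomorphic_form_on \<omega>2 V" "holomorphic_form_on \<omega>3 V"
    and \<theta>: "holomorphic_form_on \<theta> U"
    and J: "\<And>z. z \<in> U \<Longrightarrow> has_partials J (J z * fst (\<theta> z)) (J z * snd (\<theta> z)) z"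
  shows "web_connection U (pull \<omega>1) (pull \<omega>2) (pull \<omega>3)
    (\<lambda>z. (fst (pull \<eta> z) + fst (\<theta> z), snd (pull \<eta> z) + snd (\<theta> z)))"
    (is "web_connection U _ _ _ ?\<eta>")
proof -
  have h\<eta>: "holomorphic_form_on \<eta> V" using con unfolding web_connection_def by auto
  have "holomorphic_form_on ?\<eta> U"
    using holomorphic_form_on_pull[OF h\<eta> V] \<theta> unfolding holomorphic_form_on_def fst_conv snd_conv
    by (auto intro!: holomorphic2_on_add)
  moreover have "ext_deriv (scale_form (wedge (pull \<beta>) (pull \<gamma>)) (pull \<alpha>)) z =
      wedge ?\<eta> (scale_form (wedge (pull \<beta>) (pull \<gamma>)) (pull \<alpha>)) z"
    if z: "z \<in> U" and h: "holomorphic_form_on \<alpha> V" "holomorphic_form_on \<beta> V" "holomorphic_form_on \<gamma> V"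
      and e: "ext_deriv (scale_form (wedge \<beta> \<gamma>) \<alpha>) (f1 z, f2 z) = wedge \<eta> (scale_form (wedge \<beta> \<gamma>) \<alpha>) (f1 z, f2 z)"
    for \<alpha> \<beta> \<gamma> z
  proof -
    define A where "A = scale_form (wedge \<beta> \<gamma>) \<alpha>"
    have hA: "holomorphic_form_on A V"
      unfolding A_def by (intro holomorphic_form_on_scale_wedge h)
    have eq: "scale_form (wedge (pull \<beta>) (pull \<gamma>)) (pull \<alpha>) = (\<lambda>z. (J z * fst (pull A z), J z * snd (pull A z)))"
      by (auto simp: scale_form_def wedge_pull A_def fun_eq_iff pull_form_def algebra_simps)
    obtain a b c d where p: "has_partials (\<lambda>z. fst (pull A z)) a b z" "has_partials (\<lambda>z. snd (pull A z)) c d z"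
      and eA: "ext_deriv (pull A) z = J z * ext_deriv A (f1 z, f2 z)"
      using partials_pull[OF hA z V[OF z]] by blast
    have ecb: "c - b = J z * wedge \<eta> A (f1 z, f2 z)"
      using eA ext_deriv_eq[OF p] e unfolding A_def by simp
    have "ext_deriv (\<lambda>z. (J z * fst (pull A z), J z * snd (pull A z))) z =
       (J z * fst (\<theta> z) * snd (pull A z) + J z * c) - (J z * snd (\<theta> z) * fst (pull A z) + J z * b)"
      by (rule ext_deriv_eq) (unfold fst_conv snd_conv, (rule has_partials_mult[OF J[OF z]] p)+)
    also have "\<dots> = J z * (J z * wedge \<eta> A (f1 z, f2 z) + wedge \<theta> (pull A) z)"
      using ecb unfolding wedge_def by algebra
    also have "\<dots> = wedge ?\<eta> (\<lambda>z. (J z * fst (pull A z), J z * snd (pull A z))) z"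
      unfolding wedge_pull[symmetric] by (simp add: wedge_def algebra_simps)
    finally show ?thesis unfolding eq .
  qed
  ultimately show ?thesis
    using con V hol unfolding web_connection_def Let_def by blast
qed

text \<open>A direction \<open>(1, x)\<close> is sent to \<open>(A1 + B1 x, A2 + B2 x)\<close>, and
  a 3-web is a binary cubic in directions, hence the third power. Where \<open>A1 + B1 x = 0\<close>
  the image slope is infinite; at most one such \<open>x\<close> exists, since
  \<open>J z \<noteq> 0\<close>, and it is reached by continuity in \<open>x\<close>.\<close>

lemma decomposition_pull:
  assumes dec: "web_decomposition W' V \<omega>1 \<omega>2 \<omega>3" and V: "\<And>z. z \<in> U \<Longrightarrow> (f1 z, f2 z) \<in> V"
    and J: "\<And>z. z \<in> U \<Longrightarrow> J z \<noteq> 0"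
    and cont: "\<And>z x. z \<in> U \<Longrightarrow> isCont (W z) x"
    and W: "\<And>z. z \<in> U \<Longrightarrow> \<exists>k. k \<noteq> 0 \<and> (\<forall>x. A1 z + B1 z * x \<noteq> 0 \<longrightarrow>
      W z x = k * (A1 z + B1 z * x) ^ 3 * W' (f1 z, f2 z) ((A2 z + B2 z * x) / (A1 z + B1 z * x)))"
  shows "web_decomposition W U (pull \<omega>1) (pull \<omega>2) (pull \<omega>3)"
  unfolding web_decomposition_def
proof (intro conjI ballI)
  show "holomorphic_form_on (pull \<omega>1) U" "holomorphic_form_on (pull \<omega>2) U" "holomorphic_form_on (pull \<omega>3) U"
    using dec holomorphic_form_on_pull[OF _ V] unfolding web_decomposition_def by blast+
  fix z assume z: "z \<in> U"
  show "wedge (pull \<omega>1) (pull \<omega>2) z \<noteq> 0" "wedge (pull \<omega>2) (pull \<omega>3) z \<noteq> 0" "wedge (pull \<omega>3) (pull \<omega>1) z \<noteq> 0"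
    unfolding wedge_pull using J[OF z] dec V[OF z] unfolding web_decomposition_def by auto
  let ?z = "(f1 z, f2 z)"
  obtain k where k: "k \<noteq> 0" "\<And>x. A1 z + B1 z * x \<noteq> 0 \<Longrightarrow>
      W z x = k * (A1 z + B1 z * x) ^ 3 * W' ?z ((A2 z + B2 z * x) / (A1 z + B1 z * x))"
    using W[OF z] by blast
  obtain c where c: "c \<noteq> 0" "\<And>x. W' ?z x = c * form_at \<omega>1 ?z x *
    form_at \<omega>2 ?z x * form_at \<omega>3 ?z x"
    using dec V[OF z] unfolding web_decomposition_def by blast
  define R where "R = (\<lambda>x. k * c * form_at (pull \<omega>1) z x *
     form_at (pull \<omega>2) z x * form_at (pull \<omega>3) z x)"
  have eq: "W z x = R x" if nz: "A1 z + B1 z * x \<noteq> 0" for x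
  proof -
    let ?\<tau> = "A1 z + B1 z * x" and ?y = "(A2 z + B2 z * x) / (A1 z + B1 z * x)"
    have y: "?\<tau> * ?y = A2 z + B2 z * x" using nz by simp
    have "fst (pull \<omega> z) + snd (pull \<omega> z) * x = ?\<tau> * (fst (\<omega> ?z) + snd (\<omega> ?z) * ?y)" for \<omega>
      unfolding pull_form_def fst_conv snd_conv distrib_left[of ?\<tau>] mult.left_commute[of ?\<tau>] y
      by (simp add: algebra_simps)
    then show ?thesis
      unfolding k(2)[OF nz] c(2) R_def by (simp only: power3_eq_cube mult_ac)
  qed
  have "W z x = R x" for x
  proof (cases "A1 z + B1 z * x = 0")
    case False then show ?thesis by (rule eq)
  next
    case True
    have B: "B1 z \<noteq> 0" using True J[OF z] unfolding J_def by auto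
    have "A1 z + B1 z * y \<noteq> 0" if "y \<noteq> x" for y
    proof
      assume "A1 z + B1 z * y = 0"
      then have "B1 z * (y - x) = 0" using True by algebra
      then show False using B that by simp
    qed
    then have "\<forall>\<^sub>F y in at x. W z y = R y"
      unfolding eventually_at_filter by (intro always_eventually allI impI eq) simp
    moreover have "(W z \<longlongrightarrow> W z x) (at x)" using cont[OF z] by (simp add: isCont_def)
    ultimately have "(R \<longlongrightarrow> W z x) (at x)" by (rule Lim_transform_eventually[rotated])
    moreover have "(R \<longlongrightarrow> R x) (at x)"
      unfolding R_def by (intro tendsto_intros)
    ultimately show ?thesis by (rule LIM_unique)
  qed
  then show "\<exists>c. c \<noteq> 0 \<and> (\<forall>x. W z x = c * form_at (pull \<omega>1) z x *
     form_at (pull \<omega>2) z x * form_at (pull \<omega>3) z x)"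
    using k(1) c(1) unfolding R_def by (intro exI[of _ "k * c"]) simp
qed

text \<open>The pulled-back decomposition belongs to the flat web \<open>W\<close>, so the pullback
  of \<eta> plus \<theta> is closed. As \<theta> is closed too, \<open>J\<close> times the curvature
  at the image point is zero.\<close>

lemma flat_pull:
  assumes flat: "flat_web W"
    and dec: "web_decomposition W' V \<omega>1 \<omega>2 \<omega>3" and con: "web_connection V \<omega>1 \<omega>2 \<omega>3 \<eta>"
    and V: "\<And>z. z \<in> U \<Longrightarrow> (f1 z, f2 z) \<in> V"
    and \<theta>: "holomorphic_form_on \<theta> U"
    and J: "\<And>z. z \<in> U \<Longrightarrow> has_partials J (J z * fst (\<theta> z)) (J z * snd (\<theta> z)) z"
    and Jnz: "\<And>z. z \<in> U \<Longrightarrow> J z \<noteq> 0"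
    and cont: "\<And>z x. z \<in> U \<Longrightarrow> isCont (W z) x"
    and W: "\<And>z. z \<in> U \<Longrightarrow> \<exists>k. k \<noteq> 0 \<and> (\<forall>x. A1 z + B1 z * x \<noteq> 0 \<longrightarrow>
      W z x = k * (A1 z + B1 z * x) ^ 3 * W' (f1 z, f2 z) ((A2 z + B2 z * x) / (A1 z + B1 z * x)))"
    and z: "z \<in> U"
  shows "ext_deriv \<eta> (f1 z, f2 z) = 0"
proof -
  let ?\<eta> = "\<lambda>z. (fst (pull \<eta> z) + fst (\<theta> z), snd (pull \<eta> z) + snd (\<theta> z))"
  have h: "holomorphic_form_on \<omega>1 V" "holomorphic_form_on \<omega>2 V" "holomorphic_form_on \<omega>3 V"
    using dec unfolding web_decomposition_def by auto
  have h\<eta>: "holomorphic_form_on \<eta> V" using con unfolding web_connection_def by auto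
  have "ext_deriv ?\<eta> z = 0"
    using flat open_U decomposition_pull[OF dec V Jnz cont W] connection_pull[OF con V h \<theta> J] z
    unfolding flat_web_def by blast
  moreover obtain a b c d where p: "has_partials (\<lambda>z. fst (pull \<eta> z)) a b z" "has_partials (\<lambda>z. snd (pull \<eta> z)) c d z"
    and e: "ext_deriv (pull \<eta>) z = J z * ext_deriv \<eta> (f1 z, f2 z)"
    using partials_pull[OF h\<eta> z V[OF z]] by blast
  moreover obtain a' b' c' d' where p': "has_partials (\<lambda>z. fst (\<theta> z)) a' b' z" "has_partials (\<lambda>z. snd (\<theta> z)) c' d' z"
    and e': "ext_deriv \<theta> z = c' - b'" using holomorphic_form_onD[OF \<theta> z] .
  moreover have "ext_deriv \<theta> z = 0"
    by (rule log_differential_closed[OF open_U z Jnz J \<theta>])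
  moreover have "ext_deriv ?\<eta> z = (c + c') - (b + b')"
    by (rule ext_deriv_eq) (unfold fst_conv snd_conv, (rule has_partials_add p p')+)
  ultimately have "J z * ext_deriv \<eta> (f1 z, f2 z) = 0"
    using ext_deriv_eq[OF p] by (simp add: algebra_simps)
  with Jnz[OF z] show ?thesis by simp
qed

end

section \<open>Continuity of the exterior derivative along the coordinate directions\<close>

lemma tendsto_deriv_fst:
  assumes "holomorphic2_on f U" "open U" "(p, q) \<in> U"
  shows "((\<lambda>s. deriv (\<lambda>t. f (t, q + s)) p) \<longlongrightarrow> deriv (\<lambda>t. f (t, q)) p) (at 0)"
proof -
  obtain \<epsilon> where eps: "\<epsilon> > 0" and sub: "cball p \<epsilon> \<times> cball q \<epsilon> \<subseteq> U"
    using open_prod_ball[OF assms(2,3)] by blast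
  have "continuous_on (cball p \<epsilon> \<times> cball q \<epsilon>) f"
    using sub holomorphic2_on_continuous[OF assms(1)] by (intro continuous_at_imp_continuous_on) blast
  from uniform_limit_slices[OF this eps]
  have lim: "uniform_limit (ball p \<epsilon>) (\<lambda>h t. f (t, q + h)) (\<lambda>t. f (t, q)) (at 0)"
    by (rule uniform_limit_on_subset) auto
  have ev: "\<forall>\<^sub>F h in at (0::complex). norm h < \<epsilon>"
    using eps unfolding eventually_at by (intro exI[of _ \<epsilon>]) (auto simp: dist_norm)
  show ?thesis
  proof (rule deriv_complex_uniform_limit[OF lim])
    show "\<forall>\<^sub>F h in at 0. (\<lambda>t. f (t, q + h)) holomorphic_on ball p \<epsilon>"
      using ev
    proof eventually_elim
      case (elim h)
      have "\<exists>D. ((\<lambda>t. f (t, q + h)) has_field_derivative D) (at t)" if "t \<in> ball p \<epsilon>" for t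
      proof -
        have "(t, q + h) \<in> U" using that elim sub by (auto simp: dist_norm subset_iff)
        then obtain a b where "has_partials f a b (t, q + h)"
          using assms(1) unfolding holomorphic2_on_iff by blast
        then show ?thesis using has_partials_DERIV_fst by blast
      qed
      then show ?case by (simp add: holomorphic_on_open)
    qed
  qed (use eps in auto)
qed

lemma tendsto_deriv_snd:
  assumes "holomorphic2_on f U" "open U" "(p, q) \<in> U"
  shows "((\<lambda>s. deriv (\<lambda>t. f (p, t)) (q + s)) \<longlongrightarrow> deriv (\<lambda>t. f (p, t)) q) (at 0)"
proof -
  obtain \<epsilon> where eps: "\<epsilon> > 0" and sub: "cball p \<epsilon> \<times> cball q \<epsilon> \<subseteq> U"
    using open_prod_ball[OF assms(2,3)] by blast
  have "\<exists>D. ((\<lambda>t. f (p, t)) has_field_derivative D) (at t)" if "t \<in> ball q \<epsilon>" for t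
  proof -
    have "(p, t) \<in> U" using that sub eps by (auto simp: dist_norm subset_iff)
    then obtain a b where "has_partials f a b (p, t)"
      using assms(1) unfolding holomorphic2_on_iff by blast
    then show ?thesis using has_partials_DERIV_snd by blast
  qed
  then have "(\<lambda>t. f (p, t)) holomorphic_on ball q \<epsilon>" by (simp add: holomorphic_on_open)
  then have "deriv (\<lambda>t. f (p, t)) holomorphic_on ball q \<epsilon>" by (rule holomorphic_deriv) simp
  then have "isCont (deriv (\<lambda>t. f (p, t))) q"
    using eps by (metis continuous_on_interior holomorphic_on_imp_continuous_on interior_open open_ball centre_in_ball)
  then show ?thesis by (simp add: isCont_iff)
qed

lemma holomorphic2_on_swap:
  assumes "holomorphic2_on f U"
  shows "holomorphic2_on (\<lambda>z. f (snd z, fst z)) (prod.swap ` U)"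
  unfolding holomorphic2_on_iff
proof
  fix z assume "z \<in> prod.swap ` U"
  then have "(snd z, fst z) \<in> U" by auto
  then obtain a b where "has_partials f a b (snd z, fst z)" using assms unfolding holomorphic2_on_iff by blast
  from has_partials_compose2[OF this has_partials_snd has_partials_fst]
  show "\<exists>a b. has_partials (\<lambda>z. f (snd z, fst z)) a b z" by blast
qed

text \<open>A point outside the image of the chart is approached along \<open>q\<close> or along
  \<open>p\<close>, so continuity in one variable at a time is enough.\<close>

lemma ext_deriv_zero_limit:
  assumes "holomorphic_form_on \<eta> U" "open U" "(p, q) \<in> U"
  shows "(\<forall>\<^sub>F s in at 0. ext_deriv \<eta> (p, q + s) = 0) \<Longrightarrow> ext_deriv \<eta> (p, q) = 0"
    and "(\<forall>\<^sub>F s in at 0. ext_deriv \<eta> (p + s, q) = 0) \<Longrightarrow> ext_deriv \<eta> (p, q) = 0"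
proof -
  have h: "holomorphic2_on (\<lambda>z. fst (\<eta> z)) U" "holomorphic2_on (\<lambda>z. snd (\<eta> z)) U"
    using assms(1) unfolding holomorphic_form_on_def by auto
  have "((\<lambda>s. ext_deriv \<eta> (p, q + s)) \<longlongrightarrow> ext_deriv \<eta> (p, q)) (at 0)"
    unfolding ext_deriv_def prod.case
    by (intro tendsto_diff tendsto_deriv_fst[OF h(2) assms(2,3)] tendsto_deriv_snd[OF h(1) assms(2,3)])
  then show "(\<forall>\<^sub>F s in at 0. ext_deriv \<eta> (p, q + s) = 0) \<Longrightarrow> ext_deriv \<eta> (p, q) = 0"
    by (rule LIM_unique[OF _ tendsto_eventually])
  \<comment> \<open>Exchanging the two variables reduces approach along \<open>p\<close> to the
    limits already known along \<open>q\<close>.\<close>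
  have "open (prod.swap -` U)" using assms(2) by (intro open_vimage continuous_on_swap)
  moreover have "prod.swap -` U = prod.swap ` U" by force
  ultimately have "open (prod.swap ` U)" by simp
  moreover have "(q, p) \<in> prod.swap ` U" using assms(3) by force
  ultimately have "((\<lambda>s. ext_deriv \<eta> (p + s, q)) \<longlongrightarrow> ext_deriv \<eta> (p, q)) (at 0)"
    unfolding ext_deriv_def prod.case
    using tendsto_deriv_fst[OF holomorphic2_on_swap[OF h(1)]] tendsto_deriv_snd[OF holomorphic2_on_swap[OF h(2)]]
    by (intro tendsto_diff) simp_all
  then show "(\<forall>\<^sub>F s in at 0. ext_deriv \<eta> (p + s, q) = 0) \<Longrightarrow> ext_deriv \<eta> (p, q) = 0"
    by (rule LIM_unique[OF _ tendsto_eventually])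
qed

section \<open>Projective changes of coordinates and the Legendre transform\<close>

lemma homogeneous_poly_scale:
  assumes "homogeneous_poly n f"
  shows "f (c *s X) = c ^ n * f X"
proof -
  obtain k where k: "\<And>X. f X = (\<Sum>i\<le>n. \<Sum>j\<le>n - i. k i j * (X $ 1) ^ i * (X $ 2) ^ j * (X $ 3) ^ (n - i - j))"
    using assms unfolding homogeneous_poly_def by blast
  have "k i j * (c * X $ 1) ^ i * (c * X $ 2) ^ j * (c * X $ 3) ^ (n - i - j) =
      c ^ n * (k i j * (X $ 1) ^ i * (X $ 2) ^ j * (X $ 3) ^ (n - i - j))" if "i \<le> n" "j \<le> n - i" for i j
  proof -
    have "c ^ n = c ^ i * c ^ j * c ^ (n - i - j)" using that by (simp flip: power_add)
    then show ?thesis by (simp add: power_mult_distrib)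
  qed
  then show ?thesis unfolding k sum_distrib_left by (intro sum.cong refl) auto
qed

lemma homogeneous_poly_isCont:
  assumes "homogeneous_poly n f" "isCont r x" "isCont s x" "isCont t x"
  shows "isCont (\<lambda>x. f (vector [r x, s x, t x])) x"
proof -
  obtain k where k: "\<And>X. f X = (\<Sum>i\<le>n. \<Sum>j\<le>n - i. k i j * (X $ 1) ^ i * (X $ 2) ^ j * (X $ 3) ^ (n - i - j))"
    using assms unfolding homogeneous_poly_def by blast
  show ?thesis unfolding k vector_3 by (intro continuous_intros assms)
qed

text \<open>
  The dual action of \<open>g\<close> in the chart \<open>(p, q)\<close>: the line with coefficient vector \<open>(p, -1, -q)\<close> is pulled back
  along \<open>g\<close> to a multiple of the line \<open>(p', -1, -q')\<close> with \<open>p' = num1 / den\<close> and \<open>q' = num2 / den\<close>.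
\<close>

definition den :: "complex ^ 3 ^ 3 \<Rightarrow> complex \<times> complex \<Rightarrow> complex" where
  "den g z = g $ 2 $ 2 - g $ 1 $ 2 * fst z + g $ 3 $ 2 * snd z"

definition num1 :: "complex ^ 3 ^ 3 \<Rightarrow> complex \<times> complex \<Rightarrow> complex" where
  "num1 g z = g $ 1 $ 1 * fst z - g $ 2 $ 1 - g $ 3 $ 1 * snd z"

definition num2 :: "complex ^ 3 ^ 3 \<Rightarrow> complex \<times> complex \<Rightarrow> complex" where
  "num2 g z = g $ 2 $ 3 - g $ 1 $ 3 * fst z + g $ 3 $ 3 * snd z"

lemma has_partials_den: "has_partials (den g) (- g $ 1 $ 2) (g $ 3 $ 2) z"
  and has_partials_num1: "has_partials (num1 g) (g $ 1 $ 1) (- g $ 3 $ 1) z"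
  and has_partials_num2: "has_partials (num2 g) (- g $ 1 $ 3) (g $ 3 $ 3) z"
  unfolding den_def num1_def num2_def
  by ((rule has_partials_eq, (rule has_partials_const has_partials_fst has_partials_snd has_partials_add has_partials_diff has_partials_mult)+; simp)+)

definition dual_vec :: "complex \<times> complex \<Rightarrow> complex ^ 3" where
  "dual_vec z = vector [fst z, - 1, - snd z]"

lemma transpose_mult_3:
  fixes g :: "complex ^ 3 ^ 3"
  shows
  "(transpose g *v v) $ j = g $ 1 $ j * v $ 1 + g $ 2 $ j * v $ 2 + g $ 3 $ j * (v $ 3 :: complex)"
  by (simp add: matrix_vector_mult_def transpose_def sum_3)

lemma mult_3:
  fixes g :: "complex ^ 3 ^ 3"
  shows
  "(g *v v) $ j = g $ j $ 1 * v $ 1 + g $ j $ 2 * v $ 2 + g $ j $ 3 * (v $ 3 :: complex)"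
  by (simp add: matrix_vector_mult_def sum_3)

lemma transpose_dual_vec:
  "transpose g *v dual_vec z = vector [num1 g z, - den g z, - num2 g z]"
  unfolding vec_eq_iff forall_3 transpose_mult_3 vector_3 dual_vec_def num1_def num2_def den_def
  by simp

text \<open>The transposed matrices act on coefficient vectors of lines and undo each other; the
  second coordinate of \<open>dual_vec\<close>, fixed to -1, gives
  \<open>den h w * den g z = 1\<close>.\<close>

lemma dual_map_inverse:
  assumes gh: "h ** g = mat 1" and D: "den h w \<noteq> 0"
    and z: "z = (num1 h w / den h w, num2 h w / den h w)"
  shows "den g z \<noteq> 0" "num1 g z / den g z = fst w" "num2 g z / den g z = snd w"
proof -
  have "den h w *s dual_vec z = transpose h *v dual_vec w"
    unfolding transpose_dual_vec z by (simp add: vec_eq_iff forall_3 dual_vec_def D)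
  then have "transpose g *v (den h w *s dual_vec z) = dual_vec w"
    using gh by (simp only: matrix_vector_mul_assoc matrix_transpose_mul[symmetric] transpose_mat matrix_vector_mul_lid)
  then have "den h w *s (transpose g *v dual_vec z) = dual_vec w"
    by (simp only: vector_scalar_commute)
  then have e: "den h w * num1 g z = fst w" "den h w * den g z = 1" "den h w * num2 g z = snd w"
    unfolding transpose_dual_vec by (simp_all add: vec_eq_iff forall_3 dual_vec_def)
  then show n: "den g z \<noteq> 0" by auto
  have "den h w = 1 / den g z" using e(2) n by (simp add: field_simps)
  with e(1,3) show "num1 g z / den g z = fst w" "num2 g z / den g z = snd w" by auto
qed

text \<open>A slope \<open>x\<close> at \<open>(p, q)\<close> is the abscissa of a point of the line
  \<open>y = p x - q\<close>. The transformed slope is the abscissa of the point of the transformed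
  line that \<open>g\<close> maps there, so both sides evaluate the same line and form at
  proportional vectors. \<open>A1\<close>, \<open>B1\<close>, \<open>A2\<close>, \<open>B2\<close>
  are the partials of the dual map.\<close>

lemma Leg_pullback:
  assumes \<Omega>: "\<And>c X. \<Omega> (c *s X) = c ^ 3 *s \<Omega> X" and euler: "\<And>X. (\<Sum>i\<in>UNIV. \<Omega> X $ i * X $ i) = 0"
    and D: "den g z \<noteq> 0" and g: "det g \<noteq> 0"
    and A1: "A1 = (g $ 1 $ 1 * den g z - num1 g z * (- g $ 1 $ 2)) / (den g z)\<^sup>2"
    and B1: "B1 = (- g $ 3 $ 1 * den g z - num1 g z * g $ 3 $ 2) / (den g z)\<^sup>2"
    and A2: "A2 = (- g $ 1 $ 3 * den g z - num2 g z * (- g $ 1 $ 2)) / (den g z)\<^sup>2"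
    and B2: "B2 = (g $ 3 $ 3 * den g z - num2 g z * g $ 3 $ 2) / (den g z)\<^sup>2"
    and nz: "A1 + B1 * x \<noteq> 0"
  shows "Leg (l, \<Omega>) z x = (den g z) ^ 7 / (det g) ^ 4 * (A1 + B1 * x) ^ 3 *
    Leg (pullback g (l, \<Omega>)) (num1 g z / den g z, num2 g z / den g z) ((A2 + B2 * x) / (A1 + B1 * x))"
proof -
  obtain p q where z: "z = (p, q)" by (cases z)
  define d where "d = den g z"
  define n1 where "n1 = num1 g z"
  define n2 where "n2 = num2 g z"
  \<comment> \<open>\<open>y1\<close>, \<open>y2\<close>, \<open>y3\<close> are the entries of the
    adjugate of \<open>g\<close> applied to \<open>(x, p x - q, 1)\<close>: homogeneous coordinates
    of the preimage point, in a form free of division.\<close>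
  define y1 where "y1 = (- g $ 1 $ 3 * d - n2 * (- g $ 1 $ 2)) + (g $ 3 $ 3 * d - n2 * g $ 3 $ 2) * x"
  define y2 where "y2 = n1 * (- g $ 1 $ 3 + g $ 3 $ 3 * x) - n2 * (g $ 1 $ 1 - g $ 3 $ 1 * x)"
  define y3 where "y3 = (g $ 1 $ 1 * d - n1 * (- g $ 1 $ 2)) + (- g $ 3 $ 1 * d - n1 * g $ 3 $ 2) * x"
  have d0: "d \<noteq> 0" using D by (simp add: d_def)
  have t: "A1 + B1 * x = y3 / d\<^sup>2" and t2: "A2 + B2 * x = y1 / d\<^sup>2"
    unfolding A1 B1 A2 B2 y1_def y3_def d_def[symmetric] n1_def[symmetric] n2_def[symmetric]
    by (simp_all only: add_divide_distrib times_divide_eq_left)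
  have y3: "y3 \<noteq> 0" using nz t by auto
  define x' where "x' = (A2 + B2 * x) / (A1 + B1 * x)"
  have x': "x' = y1 / y3" unfolding x'_def t t2 using d0 by simp
  have "n1 * y1 - n2 * y3 = d * y2" unfolding y1_def y2_def y3_def by (simp add: algebra_simps)
  then have y2: "n1 / d * x' - n2 / d = y2 / y3" unfolding x' using d0 y3 by (simp add: field_simps)
  define X where "X = (vector [x, p * x - q, 1] :: complex ^ 3)"
  define X' where "X' = (vector [x', n1 / d * x' - n2 / d, 1] :: complex ^ 3)"
  have dd: "d = g $ 2 $ 2 - g $ 1 $ 2 * p + g $ 3 $ 2 * q" "n1 = g $ 1 $ 1 * p - g $ 2 $ 1 - g $ 3 $ 1 * q"
    "n2 = g $ 2 $ 3 - g $ 1 $ 3 * p + g $ 3 $ 3 * q"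
    by (simp_all add: d_def n1_def n2_def den_def num1_def num2_def z)
  have gX: "g *v X' = (det g / y3) *s X"
  proof -
    have h: "g $ i $ 1 * y1 + g $ i $ 2 * y2 + g $ i $ 3 * y3 = det g * X $ i" for i
    proof -
      have "\<forall>i. g $ i $ 1 * y1 + g $ i $ 2 * y2 + g $ i $ 3 * y3 = det g * X $ i"
        unfolding forall_3 X_def vector_3 det_3 y1_def y2_def y3_def dd by (intro conjI; algebra)
      then show ?thesis ..
    qed
    have "X' = vector [y1 / y3, y2 / y3, y3 / y3]"
      unfolding X'_def y2 unfolding x' using y3 by simp
    then have "(g *v X') $ i = (g $ i $ 1 * y1 + g $ i $ 2 * y2 + g $ i $ 3 * y3) / y3" for i
      using y3 by (simp add: mult_3 add_divide_distrib)
    with h show ?thesis by (simp add: vec_eq_iff)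
  qed
  define s where "s = det g / y3"
  have L: "Leg_line (transpose g *v l) (n1 / d, n2 / d) x' = s * Leg_line l z x"
  proof -
    have "Leg_line (transpose g *v l) (n1 / d, n2 / d) x' =
        l $ 1 * (g *v X') $ 1 + l $ 2 * (g *v X') $ 2 + l $ 3 * (g *v X') $ 3"
      unfolding Leg_line_def prod.case transpose_mult_3 unfolding mult_3 X'_def vector_3 by (simp add: algebra_simps)
    also have "\<dots> = s * Leg_line l z x"
      unfolding gX s_def X_def z by (simp add: Leg_line_def vector_3 algebra_simps)
    finally show ?thesis .
  qed
  \<comment> \<open>Euler's relation eliminates the third component of \<Omega>, which does not
    occur in \<open>Leg_foliation\<close>.\<close>
  have "\<Omega> X $ 1 * x + \<Omega> X $ 2 * (p * x - q) + \<Omega> X $ 3 = 0"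
    using euler[of X] unfolding sum_3 by (simp add: X_def vector_3)
  then have W: "d * (transpose g *v \<Omega> X) $ 1 + n1 * (transpose g *v \<Omega> X) $ 2 = y3 * (\<Omega> X $ 1 + p * \<Omega> X $ 2)"
    unfolding transpose_mult_3 y3_def dd by algebra
  have F: "Leg_foliation (\<lambda>X. transpose g *v \<Omega> (g *v X)) (n1 / d, n2 / d) x' = s ^ 3 * y3 / d * Leg_foliation \<Omega> z x"
  proof -
    have "Leg_foliation (\<lambda>X. transpose g *v \<Omega> (g *v X)) (n1 / d, n2 / d) x' =
        (transpose g *v \<Omega> (g *v X')) $ 1 + n1 / d * (transpose g *v \<Omega> (g *v X')) $ 2"
      unfolding Leg_foliation_def prod.case Let_def X'_def ..
    also have "\<dots> = s ^ 3 * ((transpose g *v \<Omega> X) $ 1 + n1 / d * (transpose g *v \<Omega> X) $ 2)"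
      unfolding gX \<Omega> s_def[symmetric] vector_scalar_commute by (simp add: algebra_simps)
    also have "\<dots> = s ^ 3 / d * (d * (transpose g *v \<Omega> X) $ 1 + n1 * (transpose g *v \<Omega> X) $ 2)"
      using d0 by (simp add: field_simps)
    also have "\<dots> = s ^ 3 * y3 / d * Leg_foliation \<Omega> z x"
      unfolding W by (simp add: z Leg_foliation_def Let_def X_def)
    finally show ?thesis .
  qed
  \<comment> \<open>The line contributes the factor \<open>s\<close> and the foliation
    \<open>s ^ 3 * y3 / d\<close>; this is where the powers 7 and 4 in the statement come
    from.\<close>
  have "d ^ 7 / (det g) ^ 4 * (y3 / d\<^sup>2) ^ 3 * (s * (s ^ 3 * y3 / d)) = 1"
    unfolding s_def using d0 y3 g by (simp add: field_simps power_divide eval_nat_numeral)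
  moreover have "a * b = K * (u * a * (v * b))" if "K * (u * v) = 1" for a b K u v :: complex
    using that by algebra
  ultimately show ?thesis
    unfolding Leg_def superposition_def pullback_def fst_conv snd_conv
      d_def[symmetric] n1_def[symmetric] n2_def[symmetric] x'_def[symmetric]
    unfolding L F unfolding t by blast
qed

text \<open>The dual map has Jacobian \<open>det g / den ^ 3\<close>, whose logarithmic differential
  is -3 times that of \<open>den g\<close>; this is \<theta> below.\<close>

lemma flat_web_pullback_chart:
  assumes \<Omega>: "foliation_form 2 \<Omega>" and g: "invertible g" and flat: "flat_web (Leg (l, \<Omega>))"
    and V: "open V" and dec: "web_decomposition (Leg (pullback g (l, \<Omega>))) V \<omega>1 \<omega>2 \<omega>3"
    and con: "web_connection V \<omega>1 \<omega>2 \<omega>3 \<eta>"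
    and z: "den g z \<noteq> 0" "(num1 g z / den g z, num2 g z / den g z) \<in> V"
  shows "ext_deriv \<eta> (num1 g z / den g z, num2 g z / den g z) = 0"
proof -
  have det: "det g \<noteq> 0" using g by (simp add: invertible_det_nz)
  have hom: "homogeneous_poly 3 (\<lambda>X. \<Omega> X $ i)" for i
    using \<Omega> unfolding foliation_form_def by (simp add: eval_nat_numeral)
  have sc: "\<Omega> (c *s X) = c ^ 3 *s \<Omega> X" for c X
    using homogeneous_poly_scale[OF hom] by (simp add: vec_eq_iff)
  have euler: "(\<Sum>i\<in>UNIV. \<Omega> X $ i * X $ i) = 0" for X using \<Omega> unfolding foliation_form_def by blast
  define f1 where "f1 = (\<lambda>z. num1 g z / den g z)"
  define f2 where "f2 = (\<lambda>z. num2 g z / den g z)"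
  define A1 where "A1 = (\<lambda>z. (g $ 1 $ 1 * den g z - num1 g z * (- g $ 1 $ 2)) / (den g z)\<^sup>2)"
  define B1 where "B1 = (\<lambda>z. (- g $ 3 $ 1 * den g z - num1 g z * g $ 3 $ 2) / (den g z)\<^sup>2)"
  define A2 where "A2 = (\<lambda>z. (- g $ 1 $ 3 * den g z - num2 g z * (- g $ 1 $ 2)) / (den g z)\<^sup>2)"
  define B2 where "B2 = (\<lambda>z. (g $ 3 $ 3 * den g z - num2 g z * g $ 3 $ 2) / (den g z)\<^sup>2)"
  define U0 where "U0 = {z. den g z \<noteq> 0}"
  define U where "U = {z \<in> U0. (f1 z, f2 z) \<in> V}"
  have U0: "open U0"
    unfolding U0_def den_def by (intro open_Collect_neq continuous_intros)
  have pf: "has_partials f1 (A1 z) (B1 z) z" "has_partials f2 (A2 z) (B2 z) z" if "z \<in> U0" for z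
    unfolding f1_def f2_def A1_def B1_def A2_def B2_def using that
    by (rule_tac [!] has_partials_divide[OF _ has_partials_den])
       (simp_all only: has_partials_num1 has_partials_num2 U0_def mem_Collect_eq not_False_eq_True)
  have "continuous_on U0 (\<lambda>z. (f1 z, f2 z))"
    using pf[THEN has_partials_isCont] by (intro continuous_on_Pair continuous_at_imp_continuous_on) auto
  then have "open (U0 \<inter> (\<lambda>z. (f1 z, f2 z)) -` V)" using U0 V by (rule continuous_open_preimage)
  then have U: "open U" unfolding U_def by (simp add: Int_def vimage_def)
  have nz: "den g z \<noteq> 0" if "z \<in> U" for z using that by (simp add: U_def U0_def)
  note hp = has_partials_divide has_partials_mult has_partials_diff has_partials_const has_partials_num1
    has_partials_num2 has_partials_den
  have hol: "holomorphic2_on A1 U" "holomorphic2_on B1 U" "holomorphic2_on A2 U" "holomorphic2_on B2 U"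
    unfolding holomorphic2_on_iff A1_def B1_def A2_def B2_def power2_eq_square
    by (intro ballI exI, (rule hp)+, use nz in simp)+
  interpret coordinate_change U f1 f2 A1 B1 A2 B2
    by unfold_locales (use U pf hol in \<open>auto simp: U_def\<close>)
  have J: "J z = det g / (den g z) ^ 3" if "z \<in> U" for z
  proof -
    have "den g z * ((g $ 1 $ 1 * den g z - num1 g z * (- g $ 1 $ 2)) * (g $ 3 $ 3 * den g z - num2 g z * g $ 3 $ 2) -
       (- g $ 3 $ 1 * den g z - num1 g z * g $ 3 $ 2) * (- g $ 1 $ 3 * den g z - num2 g z * (- g $ 1 $ 2)))
      = det g * (den g z)\<^sup>2"
      unfolding det_3 den_def num1_def num2_def by algebra
    then have "den g z * ((g $ 1 $ 1 * den g z - num1 g z * (- g $ 1 $ 2)) * (g $ 3 $ 3 * den g z - num2 g z * g $ 3 $ 2) -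
       (- g $ 3 $ 1 * den g z - num1 g z * g $ 3 $ 2) * (- g $ 1 $ 3 * den g z - num2 g z * (- g $ 1 $ 2)))
      = den g z * (det g * den g z)" by (simp only: power2_eq_square mult_ac)
    then have e: "(g $ 1 $ 1 * den g z - num1 g z * (- g $ 1 $ 2)) * (g $ 3 $ 3 * den g z - num2 g z * g $ 3 $ 2) -
       (- g $ 3 $ 1 * den g z - num1 g z * g $ 3 $ 2) * (- g $ 1 $ 3 * den g z - num2 g z * (- g $ 1 $ 2))
      = det g * den g z" using nz[OF that] by (simp only: mult_left_cancel not_False_eq_True)
    have "J z = A1 z * B2 z - B1 z * A2 z" by (rule J_def)
    also have "\<dots> = det g * den g z / ((den g z)\<^sup>2 * (den g z)\<^sup>2)"
      unfolding A1_def B1_def A2_def B2_def times_divide_times_eq diff_divide_distrib[symmetric] e ..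
    also have "\<dots> = det g / (den g z) ^ 3"
      using nz[OF that] by (simp add: power2_eq_square power3_eq_cube)
    finally show ?thesis .
  qed
  define \<theta> where "\<theta> = (\<lambda>z. (- 3 * (- g $ 1 $ 2) / den g z, - 3 * g $ 3 $ 2 / den g z))"
  have h\<theta>: "holomorphic_form_on \<theta> U"
    unfolding holomorphic_form_on_def holomorphic2_on_iff \<theta>_def fst_conv snd_conv
    by (intro conjI ballI exI, (rule hp)+, use nz in simp, (rule hp)+, use nz in simp)
  have Jp: "has_partials J (J z * fst (\<theta> z)) (J z * snd (\<theta> z)) z" if "z \<in> U" for z
  proof (rule has_partials_transform[OF _ U that])
    show "has_partials (\<lambda>z. det g / (den g z * den g z * den g z)) (J z * fst (\<theta> z)) (J z * snd (\<theta> z)) z"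
      by (rule has_partials_eq, (rule hp)+, use nz[OF that] in simp)
         (use nz[OF that] in \<open>simp_all add: J[OF that] \<theta>_def field_simps eval_nat_numeral\<close>)
    show "det g / (den g w * den g w * den g w) = J w" if "w \<in> U" for w
      by (simp add: J[OF that] power3_eq_cube)
  qed
  have cont: "isCont (Leg (l, \<Omega>) z) x" for z x
    unfolding Leg_def superposition_def Leg_line_def Leg_foliation_def Let_def fst_conv snd_conv case_prod_unfold
    by (intro continuous_intros homogeneous_poly_isCont[OF hom])
  have "ext_deriv \<eta> (f1 z, f2 z) = 0"
  proof (rule flat_pull[OF flat dec con _ h\<theta> Jp _ cont])
    show "(f1 z, f2 z) \<in> V" if "z \<in> U" for z using that by (simp add: U_def)
    show "J z \<noteq> 0" if "z \<in> U" for z using J[OF that] nz[OF that] det by simp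
    show "z \<in> U" using z by (simp add: U_def U0_def f1_def f2_def)
    show "\<exists>k. k \<noteq> 0 \<and> (\<forall>x. A1 z + B1 z * x \<noteq> 0 \<longrightarrow> Leg (l, \<Omega>) z x = k * (A1 z + B1 z * x) ^ 3 *
        Leg (pullback g (l, \<Omega>)) (f1 z, f2 z) ((A2 z + B2 z * x) / (A1 z + B1 z * x)))" if "z \<in> U" for z
      using nz[OF that] det Leg_pullback[OF sc euler nz[OF that] det A1_def[THEN fun_cong] B1_def[THEN fun_cong]
          A2_def[THEN fun_cong] B2_def[THEN fun_cong]]
      unfolding f1_def f2_def by (intro exI[of _ "den g z ^ 7 / det g ^ 4"]) simp
  qed
  then show ?thesis by (simp add: f1_def f2_def)
qed

text \<open>With \<open>h\<close> inverse to \<open>g\<close>, points with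
  \<open>den h w = 0\<close> come from outside the chart. The second column of \<open>h\<close> is
  nonzero, so \<open>den h\<close> changes along \<open>p\<close> or along \<open>q\<close> there,
  and the curvature vanishes as a limit in that direction.\<close>

lemma flat_web_pullback:
  assumes \<Omega>: "foliation_form 2 (snd P)" and g: "invertible g" and flat: "flat_web (Leg P)"
  shows "flat_web (Leg (pullback g P))"
  unfolding flat_web_def
proof (intro allI impI ballI)
  fix U \<omega>1 \<omega>2 \<omega>3 \<eta> w
  assume A: "open U \<and> web_decomposition (Leg (pullback g P)) U \<omega>1 \<omega>2 \<omega>3 \<and> web_connection U \<omega>1 \<omega>2 \<omega>3 \<eta>"
    and w: "w \<in> U"
  then have U: "open U" and dec: "web_decomposition (Leg (pullback g (fst P, snd P))) U \<omega>1 \<omega>2 \<omega>3"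
    and con: "web_connection U \<omega>1 \<omega>2 \<omega>3 \<eta>" by auto
  have flat': "flat_web (Leg (fst P, snd P))" using flat by simp
  obtain h where gh: "h ** g = mat 1" using g unfolding invertible_def by blast
  have good: "ext_deriv \<eta> w = 0" if w: "w \<in> U" "den h w \<noteq> 0" for w
  proof -
    define z where "z = (num1 h w / den h w, num2 h w / den h w)"
    note z = dual_map_inverse[OF gh w(2) z_def]
    have "(num1 g z / den g z, num2 g z / den g z) = w" using z(2,3) by simp
    with flat_web_pullback_chart[OF \<Omega> g flat' U dec con z(1)] w(1) show ?thesis by simp
  qed
  obtain p q where pq: "w = (p, q)" by (cases w)
  have h\<eta>: "holomorphic_form_on \<eta> U" using con unfolding web_connection_def by auto
  obtain \<epsilon> where eps: "\<epsilon> > 0" and sub: "cball p \<epsilon> \<times> cball q \<epsilon> \<subseteq> U"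
    using open_prod_ball[OF U w[unfolded pq]] by blast
  have ev: "\<forall>\<^sub>F s in at (0::complex). s \<noteq> 0 \<and> norm s < \<epsilon>"
    using eps unfolding eventually_at by (intro exI[of _ \<epsilon>]) (auto simp: dist_norm)
  show "ext_deriv \<eta> w = 0"
  proof (cases "den h w = 0")
    case False then show ?thesis using good w by blast
  next
    case True
    have "h $ 1 $ 2 \<noteq> 0 \<or> h $ 3 $ 2 \<noteq> 0"
    proof (rule ccontr)
      assume "\<not> ?thesis"
      then have "h $ 1 $ 2 = 0" "h $ 3 $ 2 = 0" "h $ 2 $ 2 = 0" using True by (auto simp: den_def)
      then have "det h = 0" by (simp add: det_3)
      moreover have "det h * det g = 1" using gh by (metis det_I det_mul)
      ultimately show False by simp
    qed
    then show ?thesis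
    proof
      assume n: "h $ 1 $ 2 \<noteq> 0"
      have "\<forall>\<^sub>F s in at 0. ext_deriv \<eta> (p + s, q) = 0"
        using ev
      proof eventually_elim
        case (elim s)
        have "den h (p + s, q) = - (h $ 1 $ 2 * s)" using True by (simp add: den_def pq algebra_simps)
        then show ?case using n elim sub eps by (intro good) (auto simp: dist_norm subset_iff)
      qed
      then show ?thesis unfolding pq by (rule ext_deriv_zero_limit(2)[OF h\<eta> U w[unfolded pq]])
    next
      assume n: "h $ 3 $ 2 \<noteq> 0"
      have "\<forall>\<^sub>F s in at 0. ext_deriv \<eta> (p, q + s) = 0"
        using ev
      proof eventually_elim
        case (elim s)
        have "den h (p, q + s) = h $ 3 $ 2 * s" using True by (simp add: den_def pq algebra_simps)
        then show ?case using n elim sub eps by (intro good) (auto simp: dist_norm subset_iff)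
      qed
      then show ?thesis unfolding pq by (rule ext_deriv_zero_limit(1)[OF h\<eta> U w[unfolded pq]])
    qed
  qed
qed

lemma flat_web_same_prefoliation:
  assumes "same_prefoliation P Q" "flat_web (Leg P)"
  shows "flat_web (Leg Q)"
proof -
  obtain a b where ab: "a \<noteq> 0" "b \<noteq> 0" "fst Q = a *s fst P" "\<And>X. snd Q X = b *s snd P X"
    using assms(1) unfolding same_prefoliation_def by blast
  have L: "Leg Q z x = (a * b) * Leg P z x" for z x
    by (cases z) (simp add: Leg_def superposition_def Leg_line_def Leg_foliation_def Let_def ab(3,4) algebra_simps)
  have "web_decomposition (Leg P) U \<omega>1 \<omega>2 \<omega>3" if dec: "web_decomposition (Leg Q) U \<omega>1 \<omega>2 \<omega>3" for U \<omega>1 \<omega>2 \<omega>3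
  proof -
    have "\<exists>c. c \<noteq> 0 \<and> (\<forall>x. Leg P z x = c * form_at \<omega>1 z x *
       form_at \<omega>2 z x * form_at \<omega>3 z x)" if "z \<in> U" for z
    proof -
      obtain c where c: "c \<noteq> 0" "\<And>x. (a * b) * Leg P z x = c * form_at \<omega>1 z x *
         form_at \<omega>2 z x * form_at \<omega>3 z x"
        using dec \<open>z \<in> U\<close> unfolding web_decomposition_def L by blast
      have "Leg P z x = (a * b * Leg P z x) / (a * b)" for x using ab by simp
      with c ab show ?thesis by (intro exI[of _ "c / (a * b)"]) simp
    qed
    with dec show ?thesis unfolding web_decomposition_def by blast
  qed
  with assms(2) show ?thesis unfolding flat_web_def by blast
qed

section \<open>Homogeneous polynomials\<close>

lemma homogeneous_poly_monomial:
  assumes "i + j + k = n"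
  shows "homogeneous_poly n (\<lambda>X. (X $ 1) ^ i * (X $ 2) ^ j * (X $ 3) ^ k)"
proof -
  have "(\<Sum>i'\<le>n. \<Sum>j'\<le>n - i'. (if i' = i \<and> j' = j then 1 else 0) * (X $ 1) ^ i' * (X $ 2) ^ j' * (X $ 3) ^ (n - i' - j')) =
     (X $ 1) ^ i * (X $ 2) ^ j * (X $ 3) ^ k" for X :: "complex ^ 3"
  proof -
    let ?m = "\<lambda>i' j'. (X $ 1) ^ i' * (X $ 2) ^ j' * (X $ 3) ^ (n - i' - j')"
    have inner: "(\<Sum>j'\<le>n - i'. (if i' = i \<and> j' = j then 1 else 0) * (X $ 1) ^ i' * (X $ 2) ^ j' * (X $ 3) ^ (n - i' - j')) =
        (if i' = i then ?m i j else 0)" for i'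
    proof (cases "i' = i")
      case True
      have "(\<Sum>j'\<le>n - i'. (if i' = i \<and> j' = j then 1 else 0) * (X $ 1) ^ i' * (X $ 2) ^ j' * (X $ 3) ^ (n - i' - j')) =
          (\<Sum>j'\<le>n - i. if j' = j then ?m i j' else 0)"
        unfolding True by (intro sum.cong refl) simp
      also have "\<dots> = ?m i j" using assms by (simp add: sum.delta)
      finally show ?thesis using True by simp
    qed simp
    have "(\<Sum>i'\<le>n. \<Sum>j'\<le>n - i'. (if i' = i \<and> j' = j then 1 else 0) * (X $ 1) ^ i' * (X $ 2) ^ j' * (X $ 3) ^ (n - i' - j'))
        = ?m i j"
      unfolding inner using assms by (simp add: sum.delta)
    also have "\<dots> = (X $ 1) ^ i * (X $ 2) ^ j * (X $ 3) ^ k" using assms by auto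
    finally show ?thesis .
  qed
  then show ?thesis unfolding homogeneous_poly_def
    by (intro exI[of _ "\<lambda>i' j'. if i' = i \<and> j' = j then 1 else 0"]) simp
qed

lemma homogeneous_poly_add:
  assumes "homogeneous_poly n f" "homogeneous_poly n g"
  shows "homogeneous_poly n (\<lambda>X. f X + g X)"
proof -
  obtain c d where "\<And>X. f X = (\<Sum>i\<le>n. \<Sum>j\<le>n - i. c i j * (X $ 1) ^ i * (X $ 2) ^ j * (X $ 3) ^ (n - i - j))"
    "\<And>X. g X = (\<Sum>i\<le>n. \<Sum>j\<le>n - i. d i j * (X $ 1) ^ i * (X $ 2) ^ j * (X $ 3) ^ (n - i - j))"
    using assms unfolding homogeneous_poly_def by blast
  then show ?thesis unfolding homogeneous_poly_def
    by (intro exI[of _ "\<lambda>i j. c i j + d i j"]) (simp add: distrib_right sum.distrib)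
qed

lemma homogeneous_poly_cmult:
  assumes "homogeneous_poly n f"
  shows "homogeneous_poly n (\<lambda>X. a * f X)"
proof -
  obtain c where "\<And>X. f X = (\<Sum>i\<le>n. \<Sum>j\<le>n - i. c i j * (X $ 1) ^ i * (X $ 2) ^ j * (X $ 3) ^ (n - i - j))"
    using assms unfolding homogeneous_poly_def by blast
  then show ?thesis unfolding homogeneous_poly_def
    by (intro exI[of _ "\<lambda>i j. a * c i j"]) (simp add: sum_distrib_left mult.assoc)
qed

lemma homogeneous_poly_0: "homogeneous_poly n (\<lambda>X. 0)"
  unfolding homogeneous_poly_def by (intro exI[of _ "\<lambda>i j. 0"]) simp

lemma homogeneous_poly_sum:
  "finite A \<Longrightarrow> (\<And>i. i \<in> A \<Longrightarrow> homogeneous_poly n (f i)) \<Longrightarrow> homogeneous_poly n (\<lambda>X. \<Sum>i\<in>A. f i X)"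
  by (induction A rule: finite_induct) (auto intro: homogeneous_poly_0 homogeneous_poly_add)

text \<open>\<open>F\<close> is linear, so it only has to be checked on monomials.\<close>

lemma homogeneous_poly_induct:
  assumes "homogeneous_poly n f"
    and "\<And>i j k. i + j + k = n \<Longrightarrow> homogeneous_poly m (\<lambda>X. F (\<lambda>X. (X $ 1) ^ i * (X $ 2) ^ j * (X $ 3) ^ k) X)"
    and "\<And>(A :: (nat \<times> nat) set) c g X. finite A \<Longrightarrow> F (\<lambda>X. \<Sum>a\<in>A. c a * g a X) X = (\<Sum>a\<in>A. c a * F (g a) X)"
  shows "homogeneous_poly m (F f)"
proof -
  obtain c where c: "\<And>X. f X = (\<Sum>i\<le>n. \<Sum>j\<le>n - i. c i j * (X $ 1) ^ i * (X $ 2) ^ j * (X $ 3) ^ (n - i - j))"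
    using assms(1) unfolding homogeneous_poly_def by blast
  let ?A = "SIGMA i:{..n}. {..n - i}"
  let ?g = "\<lambda>(i, j) (X :: complex ^ 3). (X $ 1) ^ i * (X $ 2) ^ j * (X $ 3) ^ (n - i - j)"
  have f: "f = (\<lambda>X. \<Sum>a\<in>?A. (case a of (i, j) \<Rightarrow> c i j) * ?g a X)"
    by (rule ext, subst c, subst sum.Sigma) (auto intro!: sum.cong simp: mult.assoc)
  have "F f = (\<lambda>X. \<Sum>a\<in>?A. (case a of (i, j) \<Rightarrow> c i j) * F (?g a) X)"
    by (subst f, rule ext, rule assms(3)[of ?A "\<lambda>(i, j). c i j" ?g]) auto
  moreover have "homogeneous_poly m \<dots>"
    by (intro homogeneous_poly_sum homogeneous_poly_cmult) (auto intro!: assms(2))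
  ultimately show ?thesis by simp
qed

lemma homogeneous_poly_mult:
  assumes f: "homogeneous_poly m f" and g: "homogeneous_poly n g"
  shows "homogeneous_poly (m + n) (\<lambda>X. f X * g X)"
proof -
  have "homogeneous_poly (m + n) (\<lambda>X. ((X $ 1) ^ i * (X $ 2) ^ j * (X $ 3) ^ k) * g X)" if "i + j + k = m" for i j k
  proof (rule homogeneous_poly_induct[OF g, of _ "\<lambda>g X. ((X $ 1) ^ i * (X $ 2) ^ j * (X $ 3) ^ k) * g X"])
    fix i' j' k' assume "i' + j' + k' = n"
    then have "homogeneous_poly (m + n) (\<lambda>X. (X $ 1) ^ (i + i') * (X $ 2) ^ (j + j') * (X $ 3) ^ (k + k'))"
      using that by (intro homogeneous_poly_monomial) simp
    then show "homogeneous_poly (m + n) (\<lambda>X. (X $ 1) ^ i * (X $ 2) ^ j * (X $ 3) ^ k *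
        ((X $ 1) ^ i' * (X $ 2) ^ j' * (X $ 3) ^ k'))"
      by (simp add: power_add mult_ac)
  qed (simp only: sum_distrib_left mult.left_commute)
  then show ?thesis
    by (intro homogeneous_poly_induct[OF f, of _ "\<lambda>f X. f X * g X"]) (simp_all only: sum_distrib_right mult.assoc)
qed

lemma homogeneous_poly_coord: "homogeneous_poly 1 (\<lambda>X. X $ i)"
proof -
  have "homogeneous_poly 1 (\<lambda>X. X $ 1)" "homogeneous_poly 1 (\<lambda>X. X $ 2)" "homogeneous_poly 1 (\<lambda>X. X $ 3)"
    using homogeneous_poly_monomial[of 1 0 0 1] homogeneous_poly_monomial[of 0 1 0 1]
      homogeneous_poly_monomial[of 0 0 1 1] by simp_all
  then show ?thesis using exhaust_3[of i] by auto
qed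

lemma homogeneous_poly_coord2: "homogeneous_poly 2 (\<lambda>X. X $ i * X $ j)"
  using homogeneous_poly_mult[OF homogeneous_poly_coord homogeneous_poly_coord, of i j]
  by (simp add: numeral_2_eq_2)

lemma homogeneous_poly_power:
  assumes "homogeneous_poly 1 f"
  shows "homogeneous_poly k (\<lambda>X. f X ^ k)"
proof (induction k)
  case 0
  then show ?case using homogeneous_poly_monomial[of 0 0 0 0] by simp
next
  case (Suc k)
  then show ?case using homogeneous_poly_mult[OF assms Suc] by simp
qed

lemma homogeneous_poly_compose:
  assumes "homogeneous_poly n f"
  shows "homogeneous_poly n (\<lambda>X. f (g *v X))"
proof (rule homogeneous_poly_induct[OF assms, of _ "\<lambda>f X. f (g *v X)"])
  have l: "homogeneous_poly 1 (\<lambda>X. (g *v X) $ i)" for i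
    unfolding mult_3 by (intro homogeneous_poly_add homogeneous_poly_cmult homogeneous_poly_coord)
  show "homogeneous_poly n (\<lambda>X. (g *v X) $ 1 ^ i * (g *v X) $ 2 ^ j * (g *v X) $ 3 ^ k)" if "i + j + k = n" for i j k
    unfolding that[symmetric] by (intro homogeneous_poly_mult homogeneous_poly_power l)
qed simp

text \<open>Setting the third coordinate to 1 loses nothing, and one-variable uniqueness applies
  twice.\<close>

lemma homogeneous_poly_coeffs_unique:
  fixes c d :: "nat \<Rightarrow> nat \<Rightarrow> complex"
  assumes "\<And>X :: complex ^ 3. (\<Sum>i\<le>n. \<Sum>j\<le>n - i. c i j * (X $ 1) ^ i * (X $ 2) ^ j * (X $ 3) ^ (n - i - j)) =
    (\<Sum>i\<le>n. \<Sum>j\<le>n - i. d i j * (X $ 1) ^ i * (X $ 2) ^ j * (X $ 3) ^ (n - i - j))"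
    and "i \<le> n" "j \<le> n - i"
  shows "c i j = d i j"
proof -
  have "(\<Sum>i\<le>n. (\<Sum>j\<le>n - i. c i j * y ^ j) * x ^ i) = (\<Sum>i\<le>n. (\<Sum>j\<le>n - i. d i j * y ^ j) * x ^ i)" for x y
    using assms(1)[of "vector [x, y, 1]"] by (simp add: vector_3 sum_distrib_left mult_ac)
  then have "(\<Sum>j\<le>n - i. c i j * y ^ j) = (\<Sum>j\<le>n - i. d i j * y ^ j)" for y
    by (rule polyfun_eq_coeffs[where c = "\<lambda>i. \<Sum>j\<le>n - i. c i j * y ^ j", THEN iffD1, rule_format, OF _ assms(2)])
  then show ?thesis
    by (rule polyfun_eq_coeffs[where c = "c i", THEN iffD1, rule_format, OF _ assms(3)])
qed

section \<open>Conjugation\<close>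

lemma pullback_pullback: "pullback h (pullback g P) = pullback (g ** h) P"
  by (simp only: pullback_def fst_conv snd_conv matrix_transpose_mul matrix_vector_mul_assoc)

lemma pullback_mat_1: "pullback (mat 1) P = P"
  by (simp add: pullback_def transpose_mat del: transpose_matrix_vector)

lemma same_prefoliation_pullback:
  assumes "same_prefoliation P Q"
  shows "same_prefoliation (pullback g P) (pullback g Q)"
proof -
  obtain a b where "a \<noteq> 0" "b \<noteq> 0" "fst Q = a *s fst P" "\<And>X. snd Q X = b *s snd P X"
    using assms unfolding same_prefoliation_def by blast
  then show ?thesis unfolding same_prefoliation_def pullback_def fst_conv snd_conv
    by (intro exI[of _ a] exI[of _ b]) (simp only: vector_scalar_commute not_False_eq_True simp_thms)
qed

lemma same_prefoliation_refl: "same_prefoliation P P"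
  unfolding same_prefoliation_def by (intro exI[of _ 1]) simp

lemma same_prefoliation_sym:
  assumes "same_prefoliation P Q"
  shows "same_prefoliation Q P"
proof -
  obtain a b where "a \<noteq> 0" "b \<noteq> 0" "fst Q = a *s fst P" "\<And>X. snd Q X = b *s snd P X"
    using assms unfolding same_prefoliation_def by blast
  then show ?thesis unfolding same_prefoliation_def
    by (intro exI[of _ "1 / a"] exI[of _ "1 / b"]) (simp add: vec_eq_iff)
qed

lemma same_prefoliation_trans:
  assumes "same_prefoliation P Q" "same_prefoliation Q R"
  shows "same_prefoliation P R"
proof -
  obtain a b where "a \<noteq> 0" "b \<noteq> 0" "fst Q = a *s fst P" "\<And>X. snd Q X = b *s snd P X"
    using assms unfolding same_prefoliation_def by blast
  moreover obtain a' b' where "a' \<noteq> 0" "b' \<noteq> 0" "fst R = a' *s fst Q" "\<And>X. snd R X = b' *s snd Q X"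
    using assms unfolding same_prefoliation_def by blast
  ultimately show ?thesis unfolding same_prefoliation_def
    by (intro exI[of _ "a' * a"] exI[of _ "b' * b"]) (simp add: vec_eq_iff)
qed

lemma conjugate_trans:
  assumes "conjugate P Q" "conjugate Q R"
  shows "conjugate P R"
proof -
  obtain g h where "invertible g" "same_prefoliation (pullback g P) Q" "invertible h" "same_prefoliation (pullback h Q) R"
    using assms unfolding conjugate_def by blast
  then have "invertible (g ** h)" "same_prefoliation (pullback (g ** h) P) R"
    using invertible_mult same_prefoliation_trans[OF same_prefoliation_pullback] by (auto simp flip: pullback_pullback)
  then show ?thesis unfolding conjugate_def by blast
qed

lemma conjugate_sym:
  assumes "conjugate P Q"
  shows "conjugate Q P"
proof -
  obtain g where g: "invertible g" "same_prefoliation (pullback g P) Q"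
    using assms unfolding conjugate_def by blast
  obtain h where h: "g ** h = mat 1" "h ** g = mat 1" using g(1) unfolding invertible_def by blast
  then have "same_prefoliation P (pullback h Q)"
    using same_prefoliation_pullback[OF g(2), of h] by (simp add: pullback_pullback pullback_mat_1)
  then have "same_prefoliation (pullback h Q) P" by (rule same_prefoliation_sym)
  moreover have "invertible h" using h unfolding invertible_def by blast
  ultimately show ?thesis unfolding conjugate_def by blast
qed

lemma foliation_form_coprime:
  assumes \<Omega>: "foliation_form d \<Omega>" and "1 \<le> e" "e \<le> d + 1" "homogeneous_poly e h"
    and "\<And>i. homogeneous_poly (d + 1 - e) (\<lambda>X. \<Theta> X $ i)" "\<And>X. \<Omega> X = h X *s \<Theta> X"
  shows False
proof -
  have "\<exists>e h \<Theta>. 1 \<le> e \<and> e \<le> d + 1 \<and> homogeneous_poly e h \<and>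
      (\<forall>i. homogeneous_poly (d + 1 - e) (\<lambda>X. \<Theta> X $ i)) \<and> (\<forall>X. \<Omega> X = h X *s \<Theta> X)"
    by (intro exI[of _ e] exI[of _ h] exI[of _ \<Theta>] conjI allI) (rule assms)+
  with \<Omega> show False unfolding foliation_form_def by blast
qed

text \<open>Transporting back along the inverse matrix turns a common factor of the pullback into
  one of \<Omega>.\<close>

lemma foliation_form_pullback:
  assumes \<Omega>: "foliation_form d \<Omega>" and g: "invertible g"
  shows "foliation_form d (\<lambda>X. transpose g *v \<Omega> (g *v X))"
  unfolding foliation_form_def
proof (intro conjI allI notI)
  have hom: "homogeneous_poly (d + 1) (\<lambda>X. \<Omega> X $ i)" for i using \<Omega> unfolding foliation_form_def by blast
  show "homogeneous_poly (d + 1) (\<lambda>X. (transpose g *v \<Omega> (g *v X)) $ i)" for i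
    unfolding transpose_mult_3 by (intro homogeneous_poly_add homogeneous_poly_cmult homogeneous_poly_compose[OF hom])
  show "(\<Sum>i\<in>UNIV. (transpose g *v \<Omega> (g *v X)) $ i * X $ i) = 0" for X
  proof -
    have "(\<Sum>i\<in>UNIV. (transpose g *v \<Omega> (g *v X)) $ i * X $ i) = (\<Sum>i\<in>UNIV. \<Omega> (g *v X) $ i * (g *v X) $ i)"
      unfolding sum_3 transpose_mult_3 unfolding mult_3 by (simp add: algebra_simps)
    then show ?thesis using \<Omega> unfolding foliation_form_def by simp
  qed
  assume "\<exists>e h \<Theta>. 1 \<le> e \<and> e \<le> d + 1 \<and> homogeneous_poly e h \<and> (\<forall>i. homogeneous_poly (d + 1 - e) (\<lambda>X. \<Theta> X $ i)) \<and>
      (\<forall>X. transpose g *v \<Omega> (g *v X) = h X *s \<Theta> X)"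
  then obtain e h \<Theta> where e: "1 \<le> e" "e \<le> d + 1" "homogeneous_poly e h" "\<And>i. homogeneous_poly (d + 1 - e) (\<lambda>X. \<Theta> X $ i)"
      "\<And>X. transpose g *v \<Omega> (g *v X) = h X *s \<Theta> X" by blast
  obtain k where k: "g ** k = mat 1" "k ** g = mat 1" using g unfolding invertible_def by blast
  have "transpose k ** transpose g = mat 1" by (simp only: matrix_transpose_mul[symmetric] k transpose_mat)
  then have "\<Omega> X = transpose k *v (transpose g *v \<Omega> (g *v (k *v X)))" for X
    by (simp only: matrix_vector_mul_assoc k matrix_vector_mul_lid)
  then have "\<Omega> X = h (k *v X) *s (transpose k *v \<Theta> (k *v X))" for X
    unfolding e(5) by (simp only: vector_scalar_commute)
  moreover have "homogeneous_poly (d + 1 - e) (\<lambda>X. (transpose k *v \<Theta> (k *v X)) $ i)" for i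
    unfolding transpose_mult_3 by (intro homogeneous_poly_add homogeneous_poly_cmult homogeneous_poly_compose[OF e(4)])
  ultimately show False
    by (intro foliation_form_coprime[OF \<Omega> e(1,2) homogeneous_poly_compose[OF e(3), of k]])
qed

lemma foliation_form_cmult:
  assumes \<Omega>: "foliation_form d \<Omega>" and b: "b \<noteq> 0"
  shows "foliation_form d (\<lambda>X. b *s \<Omega> X)"
  unfolding foliation_form_def
proof (intro conjI allI notI)
  show "homogeneous_poly (d + 1) (\<lambda>X. (b *s \<Omega> X) $ i)" for i
    using \<Omega> unfolding foliation_form_def by (auto intro!: homogeneous_poly_cmult)
  show "(\<Sum>i\<in>UNIV. (b *s \<Omega> X) $ i * X $ i) = 0" for X
    using \<Omega> unfolding foliation_form_def by (simp add: mult.assoc flip: sum_distrib_left)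
  assume "\<exists>e h \<Theta>. 1 \<le> e \<and> e \<le> d + 1 \<and> homogeneous_poly e h \<and> (\<forall>i. homogeneous_poly (d + 1 - e) (\<lambda>X. \<Theta> X $ i)) \<and>
      (\<forall>X. b *s \<Omega> X = h X *s \<Theta> X)"
  then obtain e h \<Theta> where e: "1 \<le> e" "e \<le> d + 1" "homogeneous_poly e h" "\<And>i. homogeneous_poly (d + 1 - e) (\<lambda>X. \<Theta> X $ i)"
      "\<And>X. b *s \<Omega> X = h X *s \<Theta> X" by blast
  have "\<Omega> X = h X *s ((1 / b) *s \<Theta> X)" for X
  proof -
    have "\<Omega> X = (1 / b) *s (b *s \<Omega> X)" using b by simp
    then show ?thesis unfolding e(5) by (simp add: mult.commute)
  qed
  moreover have "homogeneous_poly (d + 1 - e) (\<lambda>X. ((1 / b) *s \<Theta> X) $ i)" for i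
    using homogeneous_poly_cmult[OF e(4), of "1 / b"] by simp
  ultimately show False by (intro foliation_form_coprime[OF \<Omega> e(1-3)])
qed

lemma is_prefoliation_conjugate:
  assumes "is_prefoliation d P" "conjugate P Q"
  shows "is_prefoliation d Q"
proof -
  obtain g a b where g: "invertible g" and ab: "a \<noteq> 0" "b \<noteq> 0" "fst Q = a *s (transpose g *v fst P)"
      "\<And>X. snd Q X = b *s (transpose g *v snd P (g *v X))"
    using assms(2) unfolding conjugate_def same_prefoliation_def pullback_def fst_conv snd_conv by blast
  obtain k where k: "g ** k = mat 1" using g unfolding invertible_def by blast
  have "fst P = transpose k *v (transpose g *v fst P)"
  proof -
    have "transpose k ** transpose g = mat 1" by (simp only: matrix_transpose_mul[symmetric] k transpose_mat)
    then show ?thesis by (simp only: matrix_vector_mul_assoc matrix_vector_mul_lid)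
  qed
  then have "transpose g *v fst P \<noteq> 0"
    using assms(1) unfolding is_prefoliation_def by (metis matrix_vector_mult_0_right)
  then have "fst Q \<noteq> 0" unfolding ab(3) using ab(1) by (simp del: transpose_matrix_vector)
  moreover have "foliation_form (d - 1) (snd Q)"
    using foliation_form_cmult[OF foliation_form_pullback[OF _ g] ab(2)] assms(1)
    unfolding is_prefoliation_def by (simp add: ab(4)[abs_def] del: transpose_matrix_vector)
  ultimately show ?thesis using assms(1) unfolding is_prefoliation_def by blast
qed

lemma flat_web_conjugate:
  assumes "is_prefoliation 3 P" "conjugate P Q"
  shows "flat_web (Leg P) \<longleftrightarrow> flat_web (Leg Q)"
proof -
  have *: "flat_web (Leg Q)" if P: "is_prefoliation 3 P" "conjugate P Q" "flat_web (Leg P)" for P Q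
  proof -
    obtain g where g: "invertible g" "same_prefoliation (pullback g P) Q"
      using P(2) unfolding conjugate_def by blast
    have "foliation_form 2 (snd P)" using P(1) unfolding is_prefoliation_def by simp
    from flat_web_same_prefoliation[OF g(2) flat_web_pullback[OF this g(1) P(3)]] show ?thesis .
  qed
  show ?thesis using *[OF assms] *[OF is_prefoliation_conjugate[OF assms] conjugate_sym[OF assms(2)]] by blast
qed

section \<open>Homogeneous foliations of degree two\<close>

definition quadratic_form ::
  "complex \<Rightarrow> complex \<Rightarrow> complex \<Rightarrow> complex \<Rightarrow> complex \<Rightarrow> complex \<Rightarrow> complex ^ 3 \<Rightarrow> complex ^ 3" where
  "quadratic_form a0 a1 a2 b0 b1 b2 =
     affine_form (\<lambda>x y. a0 * x\<^sup>2 + a1 * x * y + a2 * y\<^sup>2) (\<lambda>x y. b0 * x\<^sup>2 + b1 * x * y + b2 * y\<^sup>2)"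

lemma diag_form_eq_quadratic_form: "diag_form a b c d = quadratic_form a 0 b c 0 d"
  by (simp add: diag_form_def quadratic_form_def)

text \<open>The homothety with ratio 2 already separates the monomials by their degree in \<open>X, Y\<close>.\<close>

lemma homothety_2_invariant_weights:
  assumes \<Omega>: "foliation_form 2 \<Omega>" and b: "b \<noteq> 0"
    and inv: "\<And>X. \<Omega> X = b *s (transpose (homothety 2) *v \<Omega> (homothety 2 *v X))"
  shows "\<exists>(k :: 3 \<Rightarrow> nat \<Rightarrow> nat \<Rightarrow> complex) K. K \<le> 4 \<and>
    (\<forall>m X. \<Omega> X $ m = (\<Sum>i\<le>3. \<Sum>j\<le>3 - i. k m i j * (X $ 1) ^ i * (X $ 2) ^ j * (X $ 3) ^ (3 - i - j))) \<and>
    (\<forall>m i j. i \<le> 3 \<longrightarrow> j \<le> 3 - i \<longrightarrow> k m i j \<noteq> 0 \<longrightarrow> (if m = 3 then 0 else 1) + i + j = K)"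
proof -
  have "\<forall>m. \<exists>c. \<forall>X. \<Omega> X $ m = (\<Sum>i\<le>3. \<Sum>j\<le>3 - i. c i j * (X $ 1) ^ i * (X $ 2) ^ j * (X $ 3) ^ (3 - i - j))"
  proof -
    have "homogeneous_poly 3 (\<lambda>X. \<Omega> X $ m)" for m
      using \<Omega> unfolding foliation_form_def by (simp add: eval_nat_numeral)
    then show ?thesis unfolding homogeneous_poly_def by blast
  qed
  then obtain k where k: "\<forall>m X. \<Omega> X $ m = (\<Sum>i\<le>3. \<Sum>j\<le>3 - i. k m i j * (X $ 1) ^ i * (X $ 2) ^ j * (X $ 3) ^ (3 - i - j))"
    by (rule choice[THEN exE])
  have hX: "(homothety 2 *v X) $ 1 = 2 * X $ 1" "(homothety 2 *v X) $ 2 = 2 * X $ 2" "(homothety 2 *v X) $ 3 = X $ 3" for X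
    by (simp_all add: mult_3 homothety_def vector_3)
  \<comment> \<open>The differentials \<open>dX\<close> and \<open>dY\<close> have weight 1 under
    the homothety and \<open>dZ\<close> has weight 0.\<close>
  define w where "w = (\<lambda>m :: 3. if m = 3 then 0 else 1 :: nat)"
  have hT: "(transpose (homothety 2) *v v) $ m = 2 ^ w m * v $ m" for v m
  proof -
    have "\<forall>m. (transpose (homothety 2) *v v) $ m = 2 ^ w m * v $ m"
      unfolding forall_3 by (simp add: transpose_mult_3 homothety_def vector_3 w_def del: transpose_matrix_vector)
    then show ?thesis ..
  qed
  have rel: "k m i j = b * 2 ^ (w m + i + j) * k m i j" if "i \<le> 3" "j \<le> 3 - i" for m i j
  proof (rule homogeneous_poly_coeffs_unique[OF _ that])
    fix X :: "complex ^ 3"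
    have "(\<Sum>i\<le>3. \<Sum>j\<le>3 - i. k m i j * (X $ 1) ^ i * (X $ 2) ^ j * (X $ 3) ^ (3 - i - j)) =
        b * (2 ^ w m * \<Omega> (homothety 2 *v X) $ m)"
      unfolding k[rule_format, symmetric] using arg_cong[OF inv[of X], of "\<lambda>v. v $ m"]
      by (simp only: hT vector_smult_component)
    also have "\<dots> = (\<Sum>i\<le>3. \<Sum>j\<le>3 - i. b * 2 ^ (w m + i + j) * k m i j * (X $ 1) ^ i * (X $ 2) ^ j * (X $ 3) ^ (3 - i - j))"
      unfolding k[rule_format] hX sum_distrib_left
      by (intro sum.cong refl) (simp add: power_mult_distrib power_add mult_ac)
    finally show "(\<Sum>i\<le>3. \<Sum>j\<le>3 - i. k m i j * (X $ 1) ^ i * (X $ 2) ^ j * (X $ 3) ^ (3 - i - j)) =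
      (\<Sum>i\<le>3. \<Sum>j\<le>3 - i. b * 2 ^ (w m + i + j) * k m i j * (X $ 1) ^ i * (X $ 2) ^ j * (X $ 3) ^ (3 - i - j))" .
  qed
  have "\<exists>m i j. i \<le> 3 \<and> j \<le> 3 - i \<and> k m i j \<noteq> 0"
  proof (rule ccontr)
    assume "\<not> ?thesis"
    then have z: "\<And>m i j. i \<le> 3 \<Longrightarrow> j \<le> 3 - i \<Longrightarrow> k m i j = 0" by blast
    have "\<Omega> X $ m = 0" for X m
      unfolding k[rule_format] by (intro sum.neutral ballI) (simp add: z)
    \<comment> \<open>The zero form is ruled out by the condition on common factors: it is
      \<open>X $ 1\<close> times zero.\<close>
    then have "\<And>X. \<Omega> X = X $ 1 *s 0" by (simp add: vec_eq_iff)
    then show False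
      by (rule foliation_form_coprime[OF \<Omega>, of 1 "\<lambda>X. X $ 1" "\<lambda>X. 0", rotated 4])
         (use homogeneous_poly_coord[of 1] in \<open>simp_all add: homogeneous_poly_0\<close>)
  qed
  then obtain m0 i0 j0 where 0: "i0 \<le> 3" "j0 \<le> 3 - i0" "k m0 i0 j0 \<noteq> 0" by blast
  \<comment> \<open>All weights that occur satisfy \<open>b * 2 ^ weight = 1\<close>; since powers
    of 2 are distinct, they agree.\<close>
  have pw: "b * 2 ^ (w m + i + j) = 1" if "i \<le> 3" "j \<le> 3 - i" "k m i j \<noteq> 0" for m i j
    using rel[OF that(1,2), of m] that(3) by simp
  show ?thesis
  proof (intro exI[of _ k] exI[of _ "w m0 + i0 + j0"] conjI allI impI)
    show "\<Omega> X $ m = (\<Sum>i\<le>3. \<Sum>j\<le>3 - i. k m i j * (X $ 1) ^ i * (X $ 2) ^ j * (X $ 3) ^ (3 - i - j))" for m X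
      using k by blast
    show "w m0 + i0 + j0 \<le> 4" using 0(1,2) by (auto simp: w_def)
    fix m i j assume ij: "i \<le> 3" "j \<le> 3 - i" "k m i j \<noteq> 0"
    have "b * 2 ^ (w m + i + j) = b * 2 ^ (w m0 + i0 + j0)" using pw[OF ij] pw[OF 0] by simp
    then have "(of_nat (2 ^ (w m + i + j)) :: complex) = of_nat (2 ^ (w m0 + i0 + j0))" using b by simp
    then have "(2::nat) ^ (w m + i + j) = 2 ^ (w m0 + i0 + j0)" by (simp only: of_nat_eq_iff)
    then show "(if m = 3 then 0 else 1) + i + j = w m0 + i0 + j0" by (simp add: w_def)
  qed
qed

lemma sum_triangle_3:
  "(\<Sum>i\<le>3. \<Sum>j\<le>3 - i :: nat. f i j) = f 0 0 + f 0 1 + f 0 2 + f 0 3 + f 1 0 + f 1 1 + f 1 2 + f 2 0 + f 2 1 + (f 3 0 :: complex)"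
  by (simp add: eval_nat_numeral)

text \<open>Only weight 3 survives. For weight at most 2 every term contains \<open>Z\<close>, a
  common factor. For weight 4 the \<open>dZ\<close> component is zero and Euler's condition makes
  the form a multiple of \<open>Y dX - X dY\<close>. For weight 3 the first two components are
  \<open>Z\<close> times quadratic forms, and Euler's condition determines the third.\<close>

lemma homothety_2_invariant_form:
  assumes \<Omega>: "foliation_form 2 \<Omega>" and b: "b \<noteq> 0"
    and inv: "\<And>X. \<Omega> X = b *s (transpose (homothety 2) *v \<Omega> (homothety 2 *v X))"
  shows "\<exists>a0 a1 a2 b0 b1 b2. \<Omega> = quadratic_form a0 a1 a2 b0 b1 b2"
proof -
  obtain k :: "3 \<Rightarrow> nat \<Rightarrow> nat \<Rightarrow> complex" and K :: nat where K: "K \<le> 4" and k0: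
    "\<forall>m X. \<Omega> X $ m = (\<Sum>i\<le>3. \<Sum>j\<le>3 - i. k m i j * (X $ 1) ^ i * (X $ 2) ^ j * (X $ 3) ^ (3 - i - j))"
    and w: "\<forall>m i j. i \<le> 3 \<longrightarrow> j \<le> 3 - i \<longrightarrow> k m i j \<noteq> 0 \<longrightarrow> (if m = 3 then 0 else 1) + i + j = K"
    using homothety_2_invariant_weights[OF assms] by blast
  have k: "\<Omega> X $ m = k m 0 0 * X $ 3 ^ 3 + k m 0 1 * X $ 2 * X $ 3 ^ 2 + k m 0 2 * X $ 2 ^ 2 * X $ 3 + k m 0 3 * X $ 2 ^ 3
     + k m 1 0 * X $ 1 * X $ 3 ^ 2 + k m 1 1 * X $ 1 * X $ 2 * X $ 3 + k m 1 2 * X $ 1 * X $ 2 ^ 2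
     + k m 2 0 * X $ 1 ^ 2 * X $ 3 + k m 2 1 * X $ 1 ^ 2 * X $ 2 + k m 3 0 * X $ 1 ^ 3" for m X
    unfolding k0[rule_format] sum_triangle_3 by simp
  have z: "k m i j = 0" if "(if m = 3 then 0 else 1) + i + j \<noteq> K" "i \<le> 3" "j \<le> 3 - i" for m i j
    using w that by blast
  have euler: "\<Omega> X $ 1 * X $ 1 + \<Omega> X $ 2 * X $ 2 + \<Omega> X $ 3 * X $ 3 = 0" for X
    using \<Omega> unfolding foliation_form_def sum_3 by blast
  note c = homogeneous_poly_coord and c2 = homogeneous_poly_coord2
  consider "K \<le> 2" | "K = 3" | "K = 4" using K by linarith
  then show ?thesis
  proof cases
    case 1
    have t: "k m 0 3 = 0" "k m 1 2 = 0" "k m 2 1 = 0" "k m 3 0 = 0" for m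
      by (intro z; use 1 in auto)+
    define \<Theta> where "\<Theta> = (\<lambda>X :: complex ^ 3. (\<chi> m. k m 0 0 * (X $ 3 * X $ 3) + k m 0 1 * (X $ 2 * X $ 3) + k m 0 2 * (X $ 2 * X $ 2)
     + k m 1 0 * (X $ 1 * X $ 3) + k m 1 1 * (X $ 1 * X $ 2) + k m 2 0 * (X $ 1 * X $ 1)))"
    have "\<Omega> X = X $ 3 *s \<Theta> X" for X
      unfolding vec_eq_iff k t \<Theta>_def by (simp add: algebra_simps power2_eq_square power3_eq_cube)
    moreover have "homogeneous_poly 2 (\<lambda>X. \<Theta> X $ i)" for i
      unfolding \<Theta>_def vec_lambda_beta by (intro homogeneous_poly_add homogeneous_poly_cmult c2)
    ultimately have False
      by (intro foliation_form_coprime[OF \<Omega>, of 1 "\<lambda>X. X $ 3" \<Theta>]) (use c in auto)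
    then show ?thesis ..
  next
    case 2
    have t: "k m 0 0 = 0" "k m 0 1 = 0" "k m 1 0 = 0" for m
      by (intro z; use 2 in auto)+
    have t12: "m \<noteq> 3 \<Longrightarrow> k m 0 3 = 0" "m \<noteq> 3 \<Longrightarrow> k m 1 2 = 0" "m \<noteq> 3 \<Longrightarrow> k m 2 1 = 0" "m \<noteq> 3 \<Longrightarrow> k m 3 0 = 0" for m
      by (intro z; use 2 in auto)+
    have t3: "k 3 0 2 = 0" "k 3 1 1 = 0" "k 3 2 0 = 0"
      by (intro z; use 2 in auto)+
    have ne: "(1::3) \<noteq> 3" "(2::3) \<noteq> 3" by simp_all
    have e12: "\<Omega> X $ m = X $ 3 * (k m 2 0 * (X $ 1)\<^sup>2 + k m 1 1 * X $ 1 * X $ 2 + k m 0 2 * (X $ 2)\<^sup>2)" if "m \<noteq> 3" for m X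
      unfolding k t t12[OF that] by (simp add: algebra_simps)
    have e3: "\<Omega> X $ 3 = - (X $ 1 * (k 1 2 0 * (X $ 1)\<^sup>2 + k 1 1 1 * X $ 1 * X $ 2 + k 1 0 2 * (X $ 2)\<^sup>2)
      + X $ 2 * (k 2 2 0 * (X $ 1)\<^sup>2 + k 2 1 1 * X $ 1 * X $ 2 + k 2 0 2 * (X $ 2)\<^sup>2))" for X
    proof -
      \<comment> \<open>The third component does not involve \<open>Z\<close>, so it may be computed
        at \<open>Z = 1\<close>, where Euler's condition can be solved for it without
        division.\<close>
      define Y where "Y = (vector [X $ 1, X $ 2, 1] :: complex ^ 3)"
      have Y: "Y $ 1 = X $ 1" "Y $ 2 = X $ 2" "Y $ 3 = 1" by (simp_all add: Y_def vector_3)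
      have "\<Omega> X $ 3 = \<Omega> Y $ 3" unfolding k t t3 by (simp add: Y)
      moreover have "\<Omega> Y $ 1 * X $ 1 + \<Omega> Y $ 2 * X $ 2 + \<Omega> Y $ 3 = 0" using euler[of Y] by (simp add: Y)
      ultimately show ?thesis unfolding e12[OF ne(1)] e12[OF ne(2)] Y by (simp add: eq_neg_iff_add_eq_0 algebra_simps)
    qed
    have "\<Omega> = quadratic_form (k 1 2 0) (k 1 1 1) (k 1 0 2) (k 2 2 0) (k 2 1 1) (k 2 0 2)"
      unfolding fun_eq_iff vec_eq_iff forall_3 quadratic_form_def affine_form_def vector_3
      using e12[OF ne(1)] e12[OF ne(2)] e3 by blast
    then show ?thesis by blast
  next
    case 3
    have t: "k m 0 0 = 0" "k m 0 1 = 0" "k m 1 0 = 0" "k m 0 2 = 0" "k m 1 1 = 0" "k m 2 0 = 0" for m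
      by (intro z; use 3 in auto)+
    have t3: "k 3 0 3 = 0" "k 3 1 2 = 0" "k 3 2 1 = 0" "k 3 3 0 = 0"
      by (intro z; use 3 in auto)+
    have e: "\<Omega> X $ m = k m 0 3 * X $ 2 ^ 3 + k m 1 2 * X $ 1 * X $ 2 ^ 2 + k m 2 1 * X $ 1 ^ 2 * X $ 2 + k m 3 0 * X $ 1 ^ 3" for m X
      unfolding k t by simp
    have e3: "\<Omega> X $ 3 = 0" for X unfolding k t t3 by simp
    \<comment> \<open>The coefficients of Euler's condition on the points \<open>(x, 1, 0)\<close>,
      a polynomial in \<open>x\<close> that is zero.\<close>
    define u where "u = (\<lambda>i::nat. if i = 0 then k 2 0 3 else if i = 1 then k 1 0 3 + k 2 1 2 else if i = 2 then k 1 1 2 + k 2 2 1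
       else if i = 3 then k 1 2 1 + k 2 3 0 else k 1 3 0)"
    have "(\<Sum>i\<le>4. u i * x ^ i) = 0" for x
      using euler[of "vector [x, 1, 0]"] unfolding e vector_3
      by (simp add: u_def eval_nat_numeral algebra_simps)
    then have "\<forall>i\<le>4. u i = 0" using polyfun_eq_0[of u 4] by blast
    then have "u 0 = 0" "u 1 = 0" "u 2 = 0" "u 3 = 0" "u 4 = 0" by simp_all
    then have r: "k 2 0 3 = 0" "k 2 1 2 = - k 1 0 3" "k 2 2 1 = - k 1 1 2" "k 2 3 0 = - k 1 2 1" "k 1 3 0 = 0"
      by (simp_all add: u_def add_eq_0_iff)
    define h where "h = (\<lambda>X :: complex ^ 3. k 1 0 3 * (X $ 2 * X $ 2) + k 1 1 2 * (X $ 1 * X $ 2) + k 1 2 1 * (X $ 1 * X $ 1))"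
    define \<Theta> where "\<Theta> = (\<lambda>X :: complex ^ 3. (vector [X $ 2, - 1 * X $ 1, 0] :: complex ^ 3))"
    have "\<Omega> X = h X *s \<Theta> X" for X
      unfolding vec_eq_iff forall_3 vector_smult_component e3 \<Theta>_def vector_3 unfolding e r h_def
      by (simp add: algebra_simps power2_eq_square power3_eq_cube)
    moreover have "homogeneous_poly 2 h"
      unfolding h_def by (intro homogeneous_poly_add homogeneous_poly_cmult c2)
    moreover have "\<forall>i. homogeneous_poly 1 (\<lambda>X. \<Theta> X $ i)"
      unfolding forall_3 \<Theta>_def vector_3 by (intro conjI homogeneous_poly_0 homogeneous_poly_cmult c)
    ultimately have False
      by (intro foliation_form_coprime[OF \<Omega>, of 2 h \<Theta>]) auto
    then show ?thesis ..
  qed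
qed

text \<open>The quadratic formula, homogenized. The first factor is nonzero even for the zero
  form.\<close>

lemma binary_quadratic_factor:
  fixes a0 a1 a2 :: complex
  shows "\<exists>u1 u2 v1 v2. (u1 \<noteq> 0 \<or> u2 \<noteq> 0) \<and> a0 = u1 * v1 \<and> a1 = u1 * v2 + u2 * v1 \<and> a2 = u2 * v2"
proof (cases "a0 = 0")
  case True
  then show ?thesis by (intro exI[of _ 0] exI[of _ 1] exI[of _ a1] exI[of _ a2]) simp
next
  case False
  define s where "s = csqrt (a1\<^sup>2 - 4 * a0 * a2)"
  have s: "s\<^sup>2 = a1\<^sup>2 - 4 * a0 * a2" by (simp add: s_def)
  have "(a1 + s) / (2 * a0) * ((a1 - s) / 2) = (a1\<^sup>2 - s\<^sup>2) / (4 * a0)"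
    by (simp add: power2_eq_square algebra_simps)
  also have "\<dots> = a2" unfolding s using False by simp
  finally have "a2 = (a1 + s) / (2 * a0) * ((a1 - s) / 2)" ..
  moreover have "a1 = 1 * ((a1 - s) / 2) + (a1 + s) / (2 * a0) * a0"
    using False by (simp add: field_simps)
  ultimately show ?thesis
    by (intro exI[of _ 1] exI[of _ "(a1 + s) / (2 * a0)"] exI[of _ a0] exI[of _ "(a1 - s) / 2"]) simp
qed

text \<open>The second hypothesis says that the form vanishes at \<open>(u2, - u1)\<close>, the zero
  of \<open>u1 x + u2 y\<close>.\<close>

lemma binary_quadratic_root_divides:
  fixes b0 b1 b2 u1 u2 :: complex
  assumes "u1 \<noteq> 0 \<or> u2 \<noteq> 0" "b0 * u2\<^sup>2 - b1 * u1 * u2 + b2 * u1\<^sup>2 = 0"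
  shows "\<exists>w1 w2. b0 = u1 * w1 \<and> b1 = u1 * w2 + u2 * w1 \<and> b2 = u2 * w2"
proof (cases "u1 = 0")
  case True
  then show ?thesis using assms by (intro exI[of _ "b1 / u2"] exI[of _ "b2 / u2"]) auto
next
  case False
  have "b2 * u1\<^sup>2 = u2 * (b1 * u1 - u2 * b0)" using assms(2) by algebra
  then have "b2 = u2 * ((b1 - u2 * (b0 / u1)) / u1)" using False
    by (simp add: field_simps power2_eq_square)
  then show ?thesis using False
    by (intro exI[of _ "b0 / u1"] exI[of _ "(b1 - u2 * (b0 / u1)) / u1"]) simp
qed

lemma quadratic_form_no_common_factor:
  assumes \<Omega>: "foliation_form 2 (quadratic_form a0 a1 a2 b0 b1 b2)"
    and "u1 \<noteq> 0 \<or> u2 \<noteq> 0"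
    and a: "a0 = u1 * v1" "a1 = u1 * v2 + u2 * v1" "a2 = u2 * v2"
    and b: "b0 = u1 * w1" "b1 = u1 * w2 + u2 * w1" "b2 = u2 * w2"
  shows False
proof -
  note c = homogeneous_poly_coord and c2 = homogeneous_poly_coord2
  define \<Theta> where "\<Theta> = (\<lambda>X :: complex ^ 3. (vector [v1 * (X $ 1 * X $ 3) + v2 * (X $ 2 * X $ 3),
     w1 * (X $ 1 * X $ 3) + w2 * (X $ 2 * X $ 3),
     - v1 * (X $ 1 * X $ 1) + (- v2 - w1) * (X $ 1 * X $ 2) + - w2 * (X $ 2 * X $ 2)] :: complex ^ 3))"
  have "quadratic_form a0 a1 a2 b0 b1 b2 X = (u1 * X $ 1 + u2 * X $ 2) *s \<Theta> X" for X
    unfolding vec_eq_iff forall_3 vector_smult_component \<Theta>_def quadratic_form_def affine_form_def vector_3 a b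
    by (intro conjI; algebra)
  moreover have "homogeneous_poly 1 (\<lambda>X. u1 * X $ 1 + u2 * X $ 2)"
    by (intro homogeneous_poly_add homogeneous_poly_cmult c)
  moreover have "\<forall>i. homogeneous_poly 2 (\<lambda>X. \<Theta> X $ i)"
    unfolding forall_3 \<Theta>_def vector_3 by (intro conjI homogeneous_poly_add homogeneous_poly_cmult c2)
  ultimately show False
    by (intro foliation_form_coprime[OF \<Omega>, of 1 "\<lambda>X. u1 * X $ 1 + u2 * X $ 2" \<Theta>]) auto
qed

text \<open>This is the resultant of \<open>A\<close> and \<open>B\<close>, equal to the product of
  the values of \<open>B\<close> at the two zeros of \<open>A\<close>; a vanishing value gives a
  common linear factor.\<close>

lemma quadratic_form_resultant:
  assumes \<Omega>: "foliation_form 2 (quadratic_form a0 a1 a2 b0 b1 b2)"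
  shows "(a0 * b2 - a2 * b0)\<^sup>2 - (a0 * b1 - a1 * b0) * (a1 * b2 - a2 * b1) \<noteq> 0"
proof
  assume R: "(a0 * b2 - a2 * b0)\<^sup>2 - (a0 * b1 - a1 * b0) * (a1 * b2 - a2 * b1) = 0"
  obtain u1 u2 v1 v2 where u: "u1 \<noteq> 0 \<or> u2 \<noteq> 0" and a: "a0 = u1 * v1" "a1 = u1 * v2 + u2 * v1" "a2 = u2 * v2"
    using binary_quadratic_factor[of a0 a1 a2] by blast
  have "(b0 * u2\<^sup>2 - b1 * u1 * u2 + b2 * u1\<^sup>2) * (b0 * v2\<^sup>2 - b1 * v1 * v2 + b2 * v1\<^sup>2) =
      (a0 * b2 - a2 * b0)\<^sup>2 - (a0 * b1 - a1 * b0) * (a1 * b2 - a2 * b1)"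
    unfolding a by algebra
  with R have "(b0 * u2\<^sup>2 - b1 * u1 * u2 + b2 * u1\<^sup>2) * (b0 * v2\<^sup>2 - b1 * v1 * v2 + b2 * v1\<^sup>2) = 0"
    by (simp only:)
  then consider "b0 * u2\<^sup>2 - b1 * u1 * u2 + b2 * u1\<^sup>2 = 0" | "b0 * v2\<^sup>2 - b1 * v1 * v2 + b2 * v1\<^sup>2 = 0" "v1 \<noteq> 0 \<or> v2 \<noteq> 0"
    | "v1 = 0" "v2 = 0" unfolding mult_eq_0_iff by blast
  then show False
  proof cases
    case 1
    obtain w1 w2 where b: "b0 = u1 * w1" "b1 = u1 * w2 + u2 * w1" "b2 = u2 * w2"
      using binary_quadratic_root_divides[OF u 1] by blast
    show False by (rule quadratic_form_no_common_factor[OF \<Omega> u a b])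
  next
    case 2
    have a': "a0 = v1 * u1" "a1 = v1 * u2 + v2 * u1" "a2 = v2 * u2" using a by simp_all
    obtain w1 w2 where b: "b0 = v1 * w1" "b1 = v1 * w2 + v2 * w1" "b2 = v2 * w2"
      using binary_quadratic_root_divides[OF 2(2,1)] by blast
    show False by (rule quadratic_form_no_common_factor[OF \<Omega> 2(2) a' b])
  next
    \<comment> \<open>Here \<open>A\<close> is zero, and any linear factor of \<open>B\<close> is
      common to both.\<close>
    case 3
    obtain w1 w2 y1 y2 where w: "w1 \<noteq> 0 \<or> w2 \<noteq> 0" and b: "b0 = w1 * y1" "b1 = w1 * y2 + w2 * y1" "b2 = w2 * y2"
      using binary_quadratic_factor[of b0 b1 b2] by blast
    have a': "a0 = w1 * 0" "a1 = w1 * 0 + w2 * 0" "a2 = w2 * 0" using a 3 by simp_all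
    show False by (rule quadratic_form_no_common_factor[OF \<Omega> w a' b])
  qed
qed

text \<open>
  The pencil spanned by two coprime binary quadratic forms contains two squares; the linear forms
  vanish at the zeros of the Jacobian determinant, which is what is factored here. In these
  coordinates the mixed terms disappear.
\<close>

lemma simultaneous_diagonalization:
  fixes a0 a1 a2 b0 b1 b2 :: complex
  assumes R: "(a0 * b2 - a2 * b0)\<^sup>2 - (a0 * b1 - a1 * b0) * (a1 * b2 - a2 * b1) \<noteq> 0"
  obtains r1 r2 s1 s2 where "r1 * s2 - r2 * s1 \<noteq> 0"
    "2 * a0 * r1 * s1 + a1 * (r1 * s2 + r2 * s1) + 2 * a2 * r2 * s2 = 0"
    "2 * b0 * r1 * s1 + b1 * (r1 * s2 + r2 * s1) + 2 * b2 * r2 * s2 = 0"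
proof -
  obtain u1 u2 v1 v2 where J: "a0 * b1 - a1 * b0 = u1 * v1" "2 * (a0 * b2 - a2 * b0) = u1 * v2 + u2 * v1"
    "a1 * b2 - a2 * b1 = u2 * v2"
    using binary_quadratic_factor[of "a0 * b1 - a1 * b0" "2 * (a0 * b2 - a2 * b0)" "a1 * b2 - a2 * b1"] by blast
  show thesis
  \<comment> \<open>The new basis vectors \<open>(u2, - u1)\<close> and \<open>(v2, - v1)\<close>
    are the zeros of the two factors of half the Jacobian. Its discriminant is four times the
    resultant, which makes them independent.\<close>
  proof (rule that[of u2 "- v1" "- u1" v2])
    have "(u2 * - v1 - - u1 * v2)\<^sup>2 = 4 * ((a0 * b2 - a2 * b0)\<^sup>2 - (a0 * b1 - a1 * b0) * (a1 * b2 - a2 * b1))"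
      using J by algebra
    with R show "u2 * - v1 - - u1 * v2 \<noteq> 0" by auto
    have two: "x = 0" if "2 * x = 0" for x :: complex using that by simp
    show "2 * a0 * u2 * v2 + a1 * (u2 * - v1 + - u1 * v2) + 2 * a2 * - u1 * - v1 = 0"
      by (rule two) (use J in algebra)
    show "2 * b0 * u2 * v2 + b1 * (u2 * - v1 + - u1 * v2) + 2 * b2 * - u1 * - v1 = 0"
      by (rule two) (use J in algebra)
  qed
qed

definition linear_change :: "complex \<Rightarrow> complex \<Rightarrow> complex \<Rightarrow> complex \<Rightarrow> complex ^ 3 ^ 3" where
  "linear_change r1 s1 r2 s2 = vector [vector [r1, s1, 0], vector [r2, s2, 0], vector [0, 0, 1]]"

lemma invertible_linear_change: "r1 * s2 - r2 * s1 \<noteq> 0 \<Longrightarrow> invertible (linear_change r1 s1 r2 s2)"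
  by (simp add: invertible_det_nz det_3 linear_change_def vector_3 algebra_simps)

lemma pullback_linear_change_line:
  "transpose (linear_change r1 s1 r2 s2) *v line a b c = line (a * r1 + b * r2) (a * s1 + b * s2) c"
  unfolding vec_eq_iff forall_3 transpose_mult_3 by (simp add: linear_change_def line_def vector_3 mult.commute)

text \<open>The hypotheses are the mixed coefficients of \<open>A\<close> and \<open>B\<close> after
  substitution, that is, the polar forms evaluated at the two columns \<open>(r1, r2)\<close> and
  \<open>(s1, s2)\<close>.\<close>

lemma pullback_linear_change_quadratic:
  assumes "2 * a0 * r1 * s1 + a1 * (r1 * s2 + r2 * s1) + 2 * a2 * r2 * s2 = 0"
    "2 * b0 * r1 * s1 + b1 * (r1 * s2 + r2 * s1) + 2 * b2 * r2 * s2 = 0"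
  shows "transpose (linear_change r1 s1 r2 s2) *v quadratic_form a0 a1 a2 b0 b1 b2 (linear_change r1 s1 r2 s2 *v X) =
    diag_form
      (r1 * (a0 * r1\<^sup>2 + a1 * r1 * r2 + a2 * r2\<^sup>2) + r2 * (b0 * r1\<^sup>2 + b1 * r1 * r2 + b2 * r2\<^sup>2))
      (r1 * (a0 * s1\<^sup>2 + a1 * s1 * s2 + a2 * s2\<^sup>2) + r2 * (b0 * s1\<^sup>2 + b1 * s1 * s2 + b2 * s2\<^sup>2))
      (s1 * (a0 * r1\<^sup>2 + a1 * r1 * r2 + a2 * r2\<^sup>2) + s2 * (b0 * r1\<^sup>2 + b1 * r1 * r2 + b2 * r2\<^sup>2))
      (s1 * (a0 * s1\<^sup>2 + a1 * s1 * s2 + a2 * s2\<^sup>2) + s2 * (b0 * s1\<^sup>2 + b1 * s1 * s2 + b2 * s2\<^sup>2)) X"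
proof -
  have M: "(linear_change r1 s1 r2 s2 *v X) $ 1 = r1 * X $ 1 + s1 * X $ 2"
    "(linear_change r1 s1 r2 s2 *v X) $ 2 = r2 * X $ 1 + s2 * X $ 2"
    "(linear_change r1 s1 r2 s2 *v X) $ 3 = X $ 3"
    by (simp_all add: mult_3 linear_change_def vector_3)
  have T: "(transpose (linear_change r1 s1 r2 s2) *v v) $ 1 = r1 * v $ 1 + r2 * v $ 2"
    "(transpose (linear_change r1 s1 r2 s2) *v v) $ 2 = s1 * v $ 1 + s2 * v $ 2"
    "(transpose (linear_change r1 s1 r2 s2) *v v) $ 3 = v $ 3" for v
    by (simp_all add: transpose_mult_3 linear_change_def vector_3 del: transpose_matrix_vector)
  show ?thesis
    unfolding vec_eq_iff forall_3 T unfolding quadratic_form_def diag_form_def affine_form_def vector_3 M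
    using assms by (intro conjI; algebra)
qed

lemma homogeneous_prefoliation_normal_form:
  assumes P: "is_prefoliation 3 P" and hom: "homogeneous_prefoliation P"
  obtains \<alpha> \<beta> \<gamma> a b c d where "conjugate P (line \<alpha> \<beta> \<gamma>, diag_form a b c d)" "a * d - b * c \<noteq> 0"
    "\<alpha> = 0 \<and> \<beta> = 0 \<and> \<gamma> \<noteq> 0 \<or> (\<alpha> \<noteq> 0 \<or> \<beta> \<noteq> 0) \<and> \<gamma> = 0"
proof -
  obtain g where g: "invertible g"
    and inv: "\<And>s. s \<noteq> 0 \<Longrightarrow> same_prefoliation (pullback (homothety s) (pullback g P)) (pullback g P)"
    using hom unfolding homogeneous_prefoliation_def by blast
  define P1 where "P1 = pullback g P"
  have c1: "conjugate P P1" unfolding conjugate_def P1_def using g same_prefoliation_refl by blast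
  have P1: "is_prefoliation 3 P1" by (rule is_prefoliation_conjugate[OF P c1])
  have "foliation_form 2 (snd P1)" "fst P1 \<noteq> 0" using P1 unfolding is_prefoliation_def by simp_all
  note F = this
  obtain k b where kb: "k \<noteq> 0" "b \<noteq> 0" "fst P1 = k *s (transpose (homothety 2) *v fst P1)"
    "\<And>X. snd P1 X = b *s (transpose (homothety 2) *v snd P1 (homothety 2 *v X))"
    using inv[of 2] unfolding same_prefoliation_def P1_def[symmetric] pullback_def[of _ P1] fst_conv snd_conv by auto
  obtain a0 a1 a2 b0 b1 b2 where q: "snd P1 = quadratic_form a0 a1 a2 b0 b1 b2"
    using homothety_2_invariant_form[OF F(1) kb(2,4)] by blast
  have "fst P1 $ 1 = k * (2 * fst P1 $ 1)" "fst P1 $ 2 = k * (2 * fst P1 $ 2)" "fst P1 $ 3 = k * fst P1 $ 3"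
    using kb(3) unfolding vec_eq_iff forall_3 vector_smult_component transpose_mult_3
    by (simp_all add: homothety_def vector_3)
  \<comment> \<open>The first two coordinates force \<open>k = 1 / 2\<close> and the third forces
    \<open>k = 1\<close>, unless they vanish.\<close>
  then have l: "fst P1 $ 1 = 0 \<and> fst P1 $ 2 = 0 \<or> fst P1 $ 3 = 0" by auto
  have ln: "fst P1 = line (fst P1 $ 1) (fst P1 $ 2) (fst P1 $ 3)"
    by (simp add: vec_eq_iff forall_3 line_def vector_3)
  obtain r1 r2 s1 s2 where d: "r1 * s2 - r2 * s1 \<noteq> 0"
    "2 * a0 * r1 * s1 + a1 * (r1 * s2 + r2 * s1) + 2 * a2 * r2 * s2 = 0"
    "2 * b0 * r1 * s1 + b1 * (r1 * s2 + r2 * s1) + 2 * b2 * r2 * s2 = 0"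
    using simultaneous_diagonalization[OF quadratic_form_resultant[OF F(1)[unfolded q]]] .
  let ?M = "linear_change r1 s1 r2 s2"
  obtain a b c e where D: "\<And>X. transpose ?M *v quadratic_form a0 a1 a2 b0 b1 b2 (?M *v X) = diag_form a b c e X"
    using pullback_linear_change_quadratic[OF d(2,3)] by blast
  define \<alpha> \<beta> \<gamma> where "\<alpha> = fst P1 $ 1 * r1 + fst P1 $ 2 * r2" and "\<beta> = fst P1 $ 1 * s1 + fst P1 $ 2 * s2"
    and "\<gamma> = fst P1 $ 3"
  have "pullback ?M P1 = (line \<alpha> \<beta> \<gamma>, diag_form a b c e)"
  proof -
    have "transpose ?M *v fst P1 = line \<alpha> \<beta> \<gamma>"
      by (subst ln) (simp only: pullback_linear_change_line \<alpha>_def \<beta>_def \<gamma>_def)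
    then show ?thesis unfolding pullback_def q by (simp add: D del: transpose_matrix_vector)
  qed
  then have "conjugate P1 (line \<alpha> \<beta> \<gamma>, diag_form a b c e)"
    unfolding conjugate_def using invertible_linear_change[OF d(1)] same_prefoliation_refl by metis
  with c1 have c2: "conjugate P (line \<alpha> \<beta> \<gamma>, diag_form a b c e)" by (rule conjugate_trans)
  \<comment> \<open>For a diagonal pair the resultant is the square of \<open>a * e - b * c\<close>,
    so coprimality of the transformed form gives the determinant condition.\<close>
  have P2: "is_prefoliation 3 (line \<alpha> \<beta> \<gamma>, diag_form a b c e)" by (rule is_prefoliation_conjugate[OF P c2])
  then have "foliation_form 2 (quadratic_form a 0 b c 0 e)" "line \<alpha> \<beta> \<gamma> \<noteq> 0"
    unfolding is_prefoliation_def by (simp_all add: diag_form_eq_quadratic_form)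
  then have "a * e - b * c \<noteq> 0" "\<alpha> \<noteq> 0 \<or> \<beta> \<noteq> 0 \<or> \<gamma> \<noteq> 0"
    using quadratic_form_resultant[of a 0 b c 0 e] by (auto simp: line_def vec_eq_iff forall_3 vector_3)
  with c2 l show thesis
    by (intro that[of \<alpha> \<beta> \<gamma> a b c e]) (auto simp: \<alpha>_def \<beta>_def \<gamma>_def)
qed

section \<open>The classification\<close>

lemma H_eq_diag_form:
  "H1 = diag_form 0 1 (- 1) 0" "H2 lam mu = diag_form 1 lam mu (- 1)" "H3 lam = diag_form 1 lam 1 0"
  by (simp_all add: H1_def H2_def H3_def diag_form_def)

lemma pullback_linear_change_diag:
  assumes "r1 * s1 = 0" "r2 * s2 = 0"
  shows "pullback (linear_change r1 s1 r2 s2) (line \<alpha> \<beta> \<gamma>, diag_form a b c d) =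
    (line (\<alpha> * r1 + \<beta> * r2) (\<alpha> * s1 + \<beta> * s2) \<gamma>,
     diag_form (r1 * (a * r1\<^sup>2 + b * r2\<^sup>2) + r2 * (c * r1\<^sup>2 + d * r2\<^sup>2))
      (r1 * (a * s1\<^sup>2 + b * s2\<^sup>2) + r2 * (c * s1\<^sup>2 + d * s2\<^sup>2))
      (s1 * (a * r1\<^sup>2 + b * r2\<^sup>2) + s2 * (c * r1\<^sup>2 + d * r2\<^sup>2))
      (s1 * (a * s1\<^sup>2 + b * s2\<^sup>2) + s2 * (c * s1\<^sup>2 + d * s2\<^sup>2)))"
proof -
  have "2 * a * r1 * s1 + 0 * (r1 * s2 + r2 * s1) + 2 * b * r2 * s2 = 0"
    "2 * c * r1 * s1 + 0 * (r1 * s2 + r2 * s1) + 2 * d * r2 * s2 = 0"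
    using assms by algebra+
  from pullback_linear_change_quadratic[OF this] show ?thesis
    unfolding pullback_def fst_conv snd_conv pullback_linear_change_line diag_form_eq_quadratic_form[of a b c d]
    by (simp add: fun_eq_iff del: transpose_matrix_vector)
qed

lemma conjugate_swap: "conjugate (line \<alpha> \<beta> \<gamma>, diag_form a b c d) (line \<beta> \<alpha> \<gamma>, diag_form d c b a)"
proof -
  have "pullback (linear_change 0 1 1 0) (line \<alpha> \<beta> \<gamma>, diag_form a b c d) = (line \<beta> \<alpha> \<gamma>, diag_form d c b a)"
    by (subst pullback_linear_change_diag) simp_all
  moreover have "invertible (linear_change 0 1 1 0)" by (rule invertible_linear_change) simp
  ultimately show ?thesis unfolding conjugate_def using same_prefoliation_refl by metis
qed

text \<open>The change is \<open>y = \<tau> y'\<close>; \<open>dy\<close> supplies the extra \<tau>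
  in \<open>c'\<close> and \<open>d'\<close>. The constants \<open>m\<close> and \<open>k\<close>
  are the freedom in the equation of the line and in the form.\<close>

lemma conjugate_scale:
  assumes "\<tau> \<noteq> 0" "k \<noteq> 0" "m \<noteq> 0"
    and "\<alpha>' = m * \<alpha>" "\<beta>' = m * (\<tau> * \<beta>)" "\<gamma>' = m * \<gamma>"
    and "a' = k * a" "b' = k * (\<tau>\<^sup>2 * b)" "c' = k * (\<tau> * c)" "d' = k * (\<tau> ^ 3 * d)"
  shows "conjugate (line \<alpha> \<beta> \<gamma>, diag_form a b c d) (line \<alpha>' \<beta>' \<gamma>', diag_form a' b' c' d')"
proof -
  have "pullback (linear_change 1 0 0 \<tau>) (line \<alpha> \<beta> \<gamma>, diag_form a b c d) =
      (line \<alpha> (\<tau> * \<beta>) \<gamma>, diag_form a (\<tau>\<^sup>2 * b) (\<tau> * c) (\<tau> ^ 3 * d))"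
    by (subst pullback_linear_change_diag) (simp_all add: mult_ac power2_eq_square power3_eq_cube)
  moreover have "invertible (linear_change 1 0 0 \<tau>)" using assms(1) by (intro invertible_linear_change) simp
  moreover have "same_prefoliation (line \<alpha> (\<tau> * \<beta>) \<gamma>, diag_form a (\<tau>\<^sup>2 * b) (\<tau> * c) (\<tau> ^ 3 * d))
      (line \<alpha>' \<beta>' \<gamma>', diag_form a' b' c' d')"
    unfolding same_prefoliation_def
    by (rule exI[of _ m], rule exI[of _ k])
       (use assms in \<open>simp add: vec_eq_iff forall_3 line_def diag_form_def affine_form_def vector_3 algebra_simps\<close>)
  ultimately show ?thesis unfolding conjugate_def by metis
qed

lemma complex_cube_root:
  fixes w :: complex
  assumes "w \<noteq> 0"
  obtains \<tau> where "\<tau> ^ 3 = w"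
proof -
  have "(exp (Ln w / 3)) ^ 3 = exp (of_nat 3 * (Ln w / 3))" by (simp only: exp_of_nat_mult)
  also have "\<dots> = w" using assms by simp
  finally show thesis using that by blast
qed

text \<open>Flatness imposes nothing here, so this is a normal form under scaling: \<open>H2\<close>
  if \<open>a\<close> and \<open>d\<close> are both nonzero, \<open>H3\<close> if exactly one is
  (the exchange of \<open>x\<close> and \<open>y\<close> makes it \<open>a\<close>),
  \<open>H1\<close> if neither is.\<close>

lemma line_infinity_classification:
  assumes "a * d - b * c \<noteq> 0" "\<gamma> \<noteq> 0"
  shows "conjugate (line 0 0 \<gamma>, diag_form a b c d) (L_inf, H1) \<or>
    (\<exists>lam. lam \<noteq> 0 \<and> conjugate (line 0 0 \<gamma>, diag_form a b c d) (L_inf, H3 lam)) \<or>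
    (\<exists>lam mu. lam * mu \<noteq> - 1 \<and> conjugate (line 0 0 \<gamma>, diag_form a b c d) (L_inf, H2 lam mu))"
proof -
  have main: "(\<exists>lam. lam \<noteq> 0 \<and> conjugate (line 0 0 \<gamma>, diag_form a b c d) (L_inf, H3 lam)) \<or>
    (\<exists>lam mu. lam * mu \<noteq> - 1 \<and> conjugate (line 0 0 \<gamma>, diag_form a b c d) (L_inf, H2 lam mu))"
    if det: "a * d - b * c \<noteq> 0" and a: "a \<noteq> 0" for a b c d
  proof (cases "d = 0")
    case True
    then have bc: "b \<noteq> 0" "c \<noteq> 0" using det by auto
    have "conjugate (line 0 0 \<gamma>, diag_form a b c d) (L_inf, H3 ((a / c)\<^sup>2 * b / a))"
      unfolding L_inf_def H_eq_diag_form
      by (rule conjugate_scale[of "a / c" "1 / a" "1 / \<gamma>"]) (use a bc True assms(2) in auto)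
    moreover have "(a / c)\<^sup>2 * b / a \<noteq> 0" using a bc by simp
    ultimately show ?thesis by blast
  next
    case d: False
    \<comment> \<open>With \<open>k = 1 / a\<close>, this cube root makes the last coefficient
      -1.\<close>
    obtain \<tau> where \<tau>: "\<tau> ^ 3 = - a / d" using complex_cube_root[of "- a / d"] a d by auto
    have \<tau>0: "\<tau> \<noteq> 0" using \<tau> a d by auto
    have "conjugate (line 0 0 \<gamma>, diag_form a b c d) (L_inf, H2 (\<tau>\<^sup>2 * b / a) (\<tau> * c / a))"
      unfolding L_inf_def H_eq_diag_form
      by (rule conjugate_scale[of \<tau> "1 / a" "1 / \<gamma>"]) (use a d \<tau> \<tau>0 assms(2) in auto)
    \<comment> \<open>The product is \<open>- b c / (a d)\<close>, different from -1 by the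
      determinant condition.\<close>
    moreover have "\<tau>\<^sup>2 * b / a * (\<tau> * c / a) \<noteq> - 1"
    proof
      assume "\<tau>\<^sup>2 * b / a * (\<tau> * c / a) = - 1"
      then have "\<tau> ^ 3 * (b * c) = - (a * a)" using a by (simp add: field_simps power2_eq_square power3_eq_cube)
      then have "- a * (b * c) = - (a * a) * d" unfolding \<tau> using d by (simp add: field_simps)
      then have "a * (a * d - b * c) = 0" by algebra
      then show False using a det by simp
    qed
    ultimately show ?thesis by blast
  qed
  consider "a \<noteq> 0" | "a = 0" "d \<noteq> 0" | "a = 0" "d = 0" by blast
  then show ?thesis
  proof cases
    case 1
    then show ?thesis using main[OF assms(1)] by blast
  next
    case 2
    have "d * a - c * b \<noteq> 0" using assms(1) by (simp add: mult.commute)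
    from main[OF this 2(2)] conjugate_trans[OF conjugate_swap[of 0 0 \<gamma> a b c d]] show ?thesis by blast
  next
    case 3
    then have bc: "b \<noteq> 0" "c \<noteq> 0" using assms(1) by auto
    \<comment> \<open>The scaling is chosen to send \<open>b\<close> to 1 and \<open>c\<close> to
      -1.\<close>
    have "conjugate (line 0 0 \<gamma>, diag_form a b c d) (L_inf, H1)"
      unfolding L_inf_def H_eq_diag_form
      by (rule conjugate_scale[of "- c / b" "b / c\<^sup>2" "1 / \<gamma>"])
         (use 3 bc assms(2) in \<open>auto simp: field_simps power2_eq_square\<close>)
    then show ?thesis by blast
  qed
qed

text \<open>The full identity is kept beside its four coefficients because it will also be evaluated
  at the zeros of \<open>E\<close> and \<open>N\<close>.\<close>

lemma flat_diag_coefficients: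
  assumes "flat_web (Leg (line \<alpha> \<beta> 0, diag_form a b c d))" "a * d - b * c \<noteq> 0" "\<alpha> \<noteq> 0 \<or> \<beta> \<noteq> 0"
  shows "\<exists>\<kappa>. \<alpha> * \<beta> * a = \<kappa> * (a * b * (\<beta>\<^sup>2 * a + \<alpha>\<^sup>2 * b)) \<and>
    \<alpha> * (\<beta> * c + \<alpha> * b) + \<beta>\<^sup>2 * a = \<kappa> * ((a * d + b * c) * (\<beta>\<^sup>2 * a + \<alpha>\<^sup>2 * b) + a * b * (\<beta>\<^sup>2 * c + \<alpha>\<^sup>2 * d)) \<and>
    \<alpha>\<^sup>2 * d + \<beta> * (\<beta> * c + \<alpha> * b) = \<kappa> * ((a * d + b * c) * (\<beta>\<^sup>2 * c + \<alpha>\<^sup>2 * d) + c * d * (\<beta>\<^sup>2 * a + \<alpha>\<^sup>2 * b)) \<and>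
    \<alpha> * \<beta> * d = \<kappa> * (c * d * (\<beta>\<^sup>2 * c + \<alpha>\<^sup>2 * d)) \<and>
    (\<forall>p. flatness_num \<alpha> \<beta> a b c d p = \<kappa> * flatness_den \<alpha> \<beta> a b c d p)"
proof -
  obtain \<kappa> where \<kappa>: "\<And>p. flatness_num \<alpha> \<beta> a b c d p = \<kappa> * flatness_den \<alpha> \<beta> a b c d p"
    using flat_diag_line_originD[OF assms] by blast
  have "\<alpha> * \<beta> * a + (\<alpha> * (\<beta> * c + \<alpha> * b) + \<beta>\<^sup>2 * a) * p + (\<alpha>\<^sup>2 * d + \<beta> * (\<beta> * c + \<alpha> * b)) * p\<^sup>2 + \<alpha> * \<beta> * d * p ^ 3 =
    \<kappa> * (a * b * (\<beta>\<^sup>2 * a + \<alpha>\<^sup>2 * b)) +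
    \<kappa> * ((a * d + b * c) * (\<beta>\<^sup>2 * a + \<alpha>\<^sup>2 * b) + a * b * (\<beta>\<^sup>2 * c + \<alpha>\<^sup>2 * d)) * p +
    \<kappa> * ((a * d + b * c) * (\<beta>\<^sup>2 * c + \<alpha>\<^sup>2 * d) + c * d * (\<beta>\<^sup>2 * a + \<alpha>\<^sup>2 * b)) * p\<^sup>2 +
    \<kappa> * (c * d * (\<beta>\<^sup>2 * c + \<alpha>\<^sup>2 * d)) * p ^ 3" for p
    using \<kappa>[of p] by algebra
  from cubic_coeffs_unique[OF this] \<kappa> show ?thesis by blast
qed

text \<open>For \<open>\<alpha> = 0\<close> the identity amounts to
  \<open>p = \<kappa> * E * N\<close>. So one of \<open>E\<close>, \<open>N\<close> is constant and
  the other a multiple of \<open>p\<close>, which gives the two cases. The line is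
  \<open>y = 0\<close>, hence the exchange of \<open>x\<close> and \<open>y\<close>.\<close>

lemma origin_classification_axis:
  assumes flat: "flat_web (Leg (line 0 \<beta> 0, diag_form a b c d))" and det: "a * d - b * c \<noteq> 0" and \<beta>: "\<beta> \<noteq> 0"
  shows "conjugate (line 0 \<beta> 0, diag_form a b c d) (line 1 0 0, H1) \<or>
    conjugate (line 0 \<beta> 0, diag_form a b c d) (line 1 0 0, H2 0 0)"
proof -
  obtain \<kappa> where e: "0 * \<beta> * a = \<kappa> * (a * b * (\<beta>\<^sup>2 * a + 0\<^sup>2 * b))"
    "0 * (\<beta> * c + 0 * b) + \<beta>\<^sup>2 * a = \<kappa> * ((a * d + b * c) * (\<beta>\<^sup>2 * a + 0\<^sup>2 * b) + a * b * (\<beta>\<^sup>2 * c + 0\<^sup>2 * d))"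
    "0\<^sup>2 * d + \<beta> * (\<beta> * c + 0 * b) = \<kappa> * ((a * d + b * c) * (\<beta>\<^sup>2 * c + 0\<^sup>2 * d) + c * d * (\<beta>\<^sup>2 * a + 0\<^sup>2 * b))"
    "0 * \<beta> * d = \<kappa> * (c * d * (\<beta>\<^sup>2 * c + 0\<^sup>2 * d))"
    using flat_diag_coefficients[OF flat det] \<beta> by blast
  note k0 = e[unfolded mult_zero_left zero_power2 add_0_right add_0_left]
  have k: "\<kappa> * (a * b * (\<beta>\<^sup>2 * a)) = 0" "\<beta>\<^sup>2 * a = \<kappa> * ((a * d + b * c) * (\<beta>\<^sup>2 * a) + a * b * (\<beta>\<^sup>2 * c))"
    "\<beta>\<^sup>2 * c = \<kappa> * ((a * d + b * c) * (\<beta>\<^sup>2 * c) + c * d * (\<beta>\<^sup>2 * a))" "\<kappa> * (c * d * (\<beta>\<^sup>2 * c)) = 0"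
    by (rule k0(1)[symmetric], rule k0(2), use k0(3) in \<open>simp only: power2_eq_square mult.assoc\<close>, rule k0(4)[symmetric])
  note sw = conjugate_trans[OF conjugate_swap[of 0 \<beta> 0 a b c d]]
  show ?thesis
  proof (cases "a = 0")
    case False
    then have "\<kappa> \<noteq> 0" using k(2) \<beta> by auto
    then have b: "b = 0" using k(1) False \<beta> by simp
    then have d: "d \<noteq> 0" using det by auto
    then have c: "c = 0" using k(4) \<open>\<kappa> \<noteq> 0\<close> \<beta> by simp
    obtain \<tau> where \<tau>: "\<tau> ^ 3 = - d / a" using complex_cube_root[of "- d / a"] False d by auto
    have "conjugate (line \<beta> 0 0, diag_form d c b a) (line 1 0 0, H2 0 0)"
      unfolding H_eq_diag_form
      by (rule conjugate_scale[of \<tau> "1 / d" "1 / \<beta>"]) (use \<tau> False b c d \<beta> in auto)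
    then show ?thesis using sw by blast
  next
    case True
    then have bc: "b \<noteq> 0" "c \<noteq> 0" using det by auto
    then have "\<kappa> \<noteq> 0" using k(3) \<beta> by auto
    then have d: "d = 0" using k(4) bc \<beta> by simp
    have "conjugate (line \<beta> 0 0, diag_form d c b a) (line 1 0 0, H1)"
      unfolding H_eq_diag_form
      by (rule conjugate_scale[of "- b / c" "c / b\<^sup>2" "1 / \<beta>"])
         (use True bc d \<beta> in \<open>auto simp: field_simps power2_eq_square\<close>)
    then show ?thesis using sw by blast
  qed
qed

text \<open>If \<open>a = d = 0\<close>, then \<open>E = c p\<close> and \<open>N = b\<close>, and
  the identity leaves the two signs in \<open>\<alpha> b = \<beta> c\<close> up to sign: the lines
  \<open>y + x = 0\<close> and \<open>y - x = 0\<close>. If \<open>a \<noteq> 0\<close>, evaluation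
  at the zero of \<open>E\<close> makes \<open>\<alpha> + \<beta> p\<close> proportional to
  \<open>E\<close>; a zero of \<open>N\<close> would do the same for \<open>N\<close>, so
  \<open>N\<close> is constant.\<close>

lemma origin_classification_general:
  assumes flat: "flat_web (Leg (line \<alpha> \<beta> 0, diag_form a b c d))" and det: "a * d - b * c \<noteq> 0"
    and \<alpha>\<beta>: "\<alpha> \<noteq> 0" "\<beta> \<noteq> 0" and ad: "a \<noteq> 0 \<or> d = 0"
  shows "conjugate (line \<alpha> \<beta> 0, diag_form a b c d) (line (- 1) 1 0, H1) \<or>
    conjugate (line \<alpha> \<beta> 0, diag_form a b c d) (line 1 1 0, H1) \<or>
    conjugate (line \<alpha> \<beta> 0, diag_form a b c d) (line 1 1 0, H3 (- 2))"
proof -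
  obtain \<kappa> where k: "\<alpha> * \<beta> * a = \<kappa> * (a * b * (\<beta>\<^sup>2 * a + \<alpha>\<^sup>2 * b))"
    "\<alpha> * (\<beta> * c + \<alpha> * b) + \<beta>\<^sup>2 * a = \<kappa> * ((a * d + b * c) * (\<beta>\<^sup>2 * a + \<alpha>\<^sup>2 * b) + a * b * (\<beta>\<^sup>2 * c + \<alpha>\<^sup>2 * d))"
    "\<alpha>\<^sup>2 * d + \<beta> * (\<beta> * c + \<alpha> * b) = \<kappa> * ((a * d + b * c) * (\<beta>\<^sup>2 * c + \<alpha>\<^sup>2 * d) + c * d * (\<beta>\<^sup>2 * a + \<alpha>\<^sup>2 * b))"
    "\<alpha> * \<beta> * d = \<kappa> * (c * d * (\<beta>\<^sup>2 * c + \<alpha>\<^sup>2 * d))"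
    and kp: "\<And>p. flatness_num \<alpha> \<beta> a b c d p = \<kappa> * flatness_den \<alpha> \<beta> a b c d p"
    using flat_diag_coefficients[OF flat det] \<alpha>\<beta> by blast
  show ?thesis
  proof (cases "a = 0")
    case True
    then have d: "d = 0" using ad by simp
    have bc: "b \<noteq> 0" "c \<noteq> 0" using det True by auto
    have 1: "\<beta> * c + \<alpha> * b = \<kappa> * b * c * (\<alpha> * b)" "\<beta> * c + \<alpha> * b = \<kappa> * b * c * (\<beta> * c)"
    proof -
      have "\<alpha> * (\<beta> * c + \<alpha> * b) = \<alpha> * (\<kappa> * b * c * (\<alpha> * b))" using k(2) unfolding True d by algebra
      then show "\<beta> * c + \<alpha> * b = \<kappa> * b * c * (\<alpha> * b)" using \<alpha>\<beta> by simp
      have "\<beta> * (\<beta> * c + \<alpha> * b) = \<beta> * (\<kappa> * b * c * (\<beta> * c))" using k(3) unfolding True d by algebra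
      then show "\<beta> * c + \<alpha> * b = \<kappa> * b * c * (\<beta> * c)" using \<alpha>\<beta> by simp
    qed
    then have "\<kappa> * b * c * (\<alpha> * b) = \<kappa> * b * c * (\<beta> * c)" by (rule trans[OF sym])
    then have "\<kappa> = 0 \<or> \<alpha> * b = \<beta> * c" unfolding mult_cancel_left using bc by auto
    then have "\<beta> * c + \<alpha> * b = 0 \<or> \<alpha> * b = \<beta> * c" using 1(1) by auto
    then show ?thesis
    proof
      assume "\<beta> * c + \<alpha> * b = 0"
      then have e: "\<beta> * c = - (\<alpha> * b)" by (simp add: eq_neg_iff_add_eq_0)
      have "conjugate (line \<alpha> \<beta> 0, diag_form a b c d) (line 1 1 0, H1)"
        unfolding H_eq_diag_form
        by (rule conjugate_scale[of "- c / b" "b / c\<^sup>2" "1 / \<alpha>"])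
           (use True d bc \<alpha>\<beta> e in \<open>auto simp: field_simps power2_eq_square\<close>)
      then show ?thesis by blast
    next
      assume e: "\<alpha> * b = \<beta> * c"
      have "conjugate (line \<alpha> \<beta> 0, diag_form a b c d) (line (- 1) 1 0, H1)"
        unfolding H_eq_diag_form
        by (rule conjugate_scale[of "- c / b" "b / c\<^sup>2" "- 1 / \<alpha>"])
           (use True d bc \<alpha>\<beta> e in \<open>auto simp: field_simps power2_eq_square\<close>)
      then show ?thesis by blast
    qed
  next
    case a: False
    have b: "b \<noteq> 0" using k(1) a \<alpha>\<beta> by auto
    have c: "c \<noteq> 0" using k(4) det \<alpha>\<beta> by auto
    have ac: "\<alpha> * c = \<beta> * a"
    proof -
      \<comment> \<open>At the zero of \<open>E\<close> the identity reads
        \<open>(\<alpha> + \<beta> p) \<alpha> p N = 0\<close>, with \<open>p \<noteq> 0\<close> as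
        \<open>a \<noteq> 0\<close>, and \<open>N \<noteq> 0\<close> by \<open>det\<close>.\<close>
      define p where "p = - a / c"
      have p: "c * p = - a" using c by (simp add: p_def)
      have "(\<alpha> + \<beta> * p) * (\<alpha> * p * (b + d * p)) = 0"
        using kp[of p] unfolding p by simp
      then have "(\<alpha> * c - \<beta> * a) * (\<alpha> * (a * (a * d - b * c))) = 0" using p by algebra
      then have "\<alpha> * c - \<beta> * a = 0" using a \<alpha>\<beta>(1) det unfolding mult_eq_0_iff by blast
      then show ?thesis by simp
    qed
    have d: "d = 0"
    proof (rule ccontr)
      assume d: "d \<noteq> 0"
      define p where "p = - b / d"
      have p: "d * p = - b" using d by (simp add: p_def)
      have "(\<alpha> + \<beta> * p) * (\<beta> * (a + c * p)) = 0"
        using kp[of p] unfolding p by simp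
      then have "(\<alpha> * d - \<beta> * b) * (\<beta> * (a * d - b * c)) = 0" using p by algebra
      then have "\<alpha> * d - \<beta> * b = 0" using \<alpha>\<beta>(2) det unfolding mult_eq_0_iff by blast
      then have "\<beta> * (a * d - b * c) = 0" using ac by algebra
      then show False using det \<alpha>\<beta>(2) by simp
    qed
    define S where "S = \<beta> * c + \<alpha> * b"
    have 1: "\<beta> = \<kappa> * b * S"
    proof -
      have "(\<alpha> * a) * \<beta> = (\<alpha> * a) * (\<kappa> * b * S)" using k(1) ac unfolding S_def by algebra
      then show ?thesis using \<alpha>\<beta> a by simp
    qed
    have 2: "S = \<kappa> * b * (\<beta> * c\<^sup>2)"
    proof -
      have "\<beta> * S = \<beta> * (\<kappa> * b * (\<beta> * c\<^sup>2))" using k(3) unfolding S_def d by algebra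
      then show ?thesis using \<alpha>\<beta> by simp
    qed
    \<comment> \<open>So \<open>S\<close> is \<open>\<beta> c\<close> up to sign. The plus sign
      would give \<open>\<alpha> b = 0\<close>; the minus sign gives
      \<open>\<alpha> b = - 2 \<beta> c\<close>, the origin of the parameter -2.\<close>
    have "(\<kappa> * b) * (S\<^sup>2 - (\<beta> * c)\<^sup>2) = 0" using 1 2 by algebra
    moreover have "\<kappa> * b \<noteq> 0" using 1 \<alpha>\<beta> by auto
    ultimately have "S\<^sup>2 - (\<beta> * c)\<^sup>2 = 0" unfolding mult_eq_0_iff by blast
    then have "\<alpha> * b * (\<alpha> * b + 2 * (\<beta> * c)) = 0" unfolding S_def by algebra
    then have "\<alpha> * b + 2 * (\<beta> * c) = 0" using \<alpha>\<beta>(1) b unfolding mult_eq_0_iff by blast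
    then have e: "\<alpha> * b = - 2 * (\<beta> * c)" by (simp add: eq_neg_iff_add_eq_0)
    have eb: "b = - 2 * \<beta> * c / \<alpha>" and ea: "a = \<alpha> * c / \<beta>" using e ac \<alpha>\<beta> by (simp_all add: field_simps)
    \<comment> \<open>The ratio \<open>\<alpha> / \<beta>\<close> moves the line to
      \<open>x + y = 0\<close>; the relations \<open>ea\<close> and \<open>eb\<close> then fix the
      rest.\<close>
    have "conjugate (line \<alpha> \<beta> 0, diag_form a b c d) (line 1 1 0, H3 (- 2))"
      unfolding H_eq_diag_form
      by (rule conjugate_scale[of "\<alpha> / \<beta>" "1 / a" "1 / \<alpha>"])
         (use \<alpha>\<beta> c in \<open>simp_all add: d ea eb field_simps power2_eq_square\<close>)
    then show ?thesis by blast
  qed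
qed

text \<open>The value of \<kappa> is -1 for \<open>x = 0\<close> with \<open>H1\<close> and with
  \<open>H2 0 0\<close>, -2 for \<open>y - x = 0\<close> with \<open>H1\<close>, 0 for
  \<open>y + x = 0\<close> with \<open>H1\<close>, and 1/2 for \<open>y + x = 0\<close> with
  \<open>H3 (- 2)\<close>.\<close>

lemma flat_models:
  "flat_web (Leg (L_inf, H1))" "flat_web (Leg (L_inf, H2 lam mu))" "flat_web (Leg (L_inf, H3 lam))"
  "flat_web (Leg (line 1 0 0, H1))" "flat_web (Leg (line (- 1) 1 0, H1))" "flat_web (Leg (line 1 1 0, H1))"
  "flat_web (Leg (line 1 0 0, H2 0 0))" "flat_web (Leg (line 1 1 0, H3 (- 2)))"
  unfolding H_eq_diag_form L_inf_def
  by (fact flat_diag_line_infinity)+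
     (rule flat_diag_line_originI[where \<kappa> = "- 1"] flat_diag_line_originI[where \<kappa> = "- 2"]
       flat_diag_line_originI[where \<kappa> = 0] flat_diag_line_originI[where \<kappa> = "1 / 2"],
      simp add: algebra_simps power2_eq_square; fail)+

theorem corollary4p5:
  fixes P :: prefoliation
  assumes "is_prefoliation 3 P" and "homogeneous_prefoliation P"
  shows "flat_web (Leg P) \<longleftrightarrow>
    conjugate P (L_inf, H1) \<or>
    conjugate P (line 1 0 0, H1) \<or>
    conjugate P (line (- 1) 1 0, H1) \<or>
    conjugate P (line 1 1 0, H1) \<or>
    conjugate P (line 1 0 0, H2 0 0) \<or>
    conjugate P (line 1 1 0, H3 (- 2)) \<or>
    (\<exists>lam. lam \<noteq> 0 \<and> conjugate P (L_inf, H3 lam)) \<or>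
    (\<exists>lam mu. lam * mu \<noteq> - 1 \<and> conjugate P (L_inf, H2 lam mu))"
proof (rule iffI, goal_cases)
  case flat: 1
  obtain \<alpha> \<beta> \<gamma> a b c d where c: "conjugate P (line \<alpha> \<beta> \<gamma>, diag_form a b c d)" and det: "a * d - b * c \<noteq> 0"
    and l: "\<alpha> = 0 \<and> \<beta> = 0 \<and> \<gamma> \<noteq> 0 \<or> (\<alpha> \<noteq> 0 \<or> \<beta> \<noteq> 0) \<and> \<gamma> = 0"
    using homogeneous_prefoliation_normal_form[OF assms] by metis
  note tr = conjugate_trans[OF c]
  note sw = conjugate_trans[OF c conjugate_swap]
  have flat1: "flat_web (Leg (line \<alpha> \<beta> \<gamma>, diag_form a b c d))"
    using flat flat_web_conjugate[OF assms(1) c] by blast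
  have flat2: "flat_web (Leg (line \<beta> \<alpha> \<gamma>, diag_form d c b a))"
    using flat flat_web_conjugate[OF assms(1) sw] by blast
  have det2: "d * a - c * b \<noteq> 0" using det by (simp add: mult.commute)
  \<comment> \<open>The last two cases overlap. The situation \<open>a = 0\<close>,
    \<open>d \<noteq> 0\<close> falls under the fifth, where exchanging \<open>x\<close> and
    \<open>y\<close> exchanges \<open>a\<close> and \<open>d\<close>.\<close>
  consider "\<alpha> = 0" "\<beta> = 0" "\<gamma> \<noteq> 0" | "\<alpha> = 0" "\<beta> \<noteq> 0" "\<gamma> = 0" | "\<beta> = 0" "\<alpha> \<noteq> 0" "\<gamma> = 0"
    | "\<alpha> \<noteq> 0" "\<beta> \<noteq> 0" "\<gamma> = 0" "a \<noteq> 0 \<or> d = 0" | "\<alpha> \<noteq> 0" "\<beta> \<noteq> 0" "\<gamma> = 0" "d \<noteq> 0 \<or> a = 0"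
    using l by blast
  then show ?case
  proof cases
    case 1
    from line_infinity_classification[OF det 1(3)] tr[unfolded 1(1,2)] show ?thesis by blast
  next
    case 2
    from origin_classification_axis[OF flat1[unfolded 2(1,3)] det 2(2)] tr[unfolded 2(1,3)] show ?thesis by blast
  next
    case 3
    from origin_classification_axis[OF flat2[unfolded 3(1,3)] det2 3(2)] conjugate_trans[OF sw, unfolded 3(1,3)]
    show ?thesis by blast
  next
    case 4
    from origin_classification_general[OF flat1[unfolded 4(3)] det 4(1,2,4)] tr[unfolded 4(3)] show ?thesis by blast
  next
    case 5
    from origin_classification_general[OF flat2[unfolded 5(3)] det2 5(2,1,4)] conjugate_trans[OF sw, unfolded 5(3)]
    show ?thesis by blast
  qed
next
  case 2
  have *: "flat_web (Leg P)" if "conjugate P Q" "flat_web (Leg Q)" for Q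
    using flat_web_conjugate[OF assms(1) that(1)] that(2) by blast
  with 2 show ?case using flat_models by blast
qed

end
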